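(* Let $\alpha\in[0,2\pi[$, $\beta\in\,]0,\pi[$, and let $A=\{e^{i\varphi}:\alpha+\beta\le\varphi\le\alpha+2\pi-\beta\}$ be the corresponding arc of the unit circle $\mathbb{T}$. Let $T(1_A)$ be the Toeplitz operator on $H^2(\mathbb{T})$ with symbol the indicator function $1_A$, and let $Y:=X_+V:L^2(0,1)\to H^2(\mathbb{T})$ be the Hilbert space isomorphism defined in the context. Then $$T(1_A)=Y\,M(\operatorname{id}_{[0,1]})\,Y^{-1},$$ where $M(\operatorname{id}_{[0,1]})$ is the operator of multiplication by the identity function, $h(s)\mapsto s\,h(s)$, on $L^2(0,1)$.
   Context: $\mathbb{R}_+=\{x>0\}$; $\mathbb{T}\subset\mathbb{C}$ is the unit circle with normalized Lebesgue measure; $H^2(\mathbb{T})\subset L^2(\mathbb{T})$ is the Hardy space with orthonormal basis $e_n(z)=z^n$, $n\in\mathbb{N}_0$; $Q_+:L^2(\mathbb{T})\to H^2(\mathbb{T})$ is the orthogonal projection and $Q_+^*$ the inclusion. For $\omega\in L^\infty(\mathbb{T})$ the Toeplitz operator is $T(\omega)=Q_+M(\omega)Q_+^*$, with $M(\omega)$ multiplication by $\omega$ on $L^2(\mathbb{T})$. $\mathcal{F}$ is the unitary Fourier transformation on $L^2(\mathbb{R})$ with $\mathcal{F}f(x)=(2\pi)^{-1/2}\int e^{-ixy}f(y)\,dy$ for $f\in L^1\cap L^2$. $P_+^*:L^2(\mathbb{R}_+)\to L^2(\mathbb{R})$ is extension by zero. Put $\chi(x)=e^{i\alpha}\frac{x-i\tan(\beta/2)}{x+i\tan(\beta/2)}$,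 with inverse $\chi^{-1}(z)=i\tan(\beta/2)\frac{z+e^{i\alpha}}{-z+e^{i\alpha}}$. $X:L^2(\mathbb{R})\to L^2(\mathbb{T})$ is the Hilbert space isomorphism $$(Xf)(z)=(2\pi)^{1/2}e^{i\alpha}\frac{\sqrt{2\tan(\beta/2)}}{-z+e^{i\alpha}}f\big(\chi^{-1}(z)\big),$$ and $X_+:=Q_+X\mathcal{F}^{-1}P_+^*:L^2(\mathbb{R}_+)\to H^2(\mathbb{T})$, which is a Hilbert space isomorphism. $V:L^2(0,1)\to L^2(\mathbb{R}_+)$ is the Hilbert space isomorphism $Vh=\operatorname{l.i.m.}_{0<a,a'\to0}\int_a^{1-a'}q_+(s,\cdot)h(s)\,ds$ (limit in $L^2$) with $$q_+(s,x)=\tfrac12\pi^{-3/2}s^{-1}(1-s)^{-1/2}\int_{-1}^1e^{-ixu}(1-u^2)^{-1/2}\exp\Big(\tfrac{i}{2\pi}\ln\big(\tfrac1s-1\big)\ln\big(\tfrac{1-u}{1+u}\big)\Big)du .$$ *)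

theory Defs
  imports "HOL-Analysis.Analysis"
begin

section \<open>The Hilbert space of square-integrable functions modulo null sets\<close>

text \<open>
  The measure \<open>M\<close> is a term, so \<open>L\<^sup>2(M)\<close> is a set of equivalence classes rather than a type.
\<close>

definition L2_fun :: "'a measure \<Rightarrow> ('a \<Rightarrow> complex) set" where
  "L2_fun M = {f \<in> borel_measurable M. integrable M (\<lambda>x. (cmod (f x))\<^sup>2)}"

definition L2_class :: "'a measure \<Rightarrow> ('a \<Rightarrow> complex) \<Rightarrow> ('a \<Rightarrow> complex) set" where
  "L2_class M f = {g \<in> L2_fun M. AE x in M. g x = f x}"

definition L2 :: "'a measure \<Rightarrow> ('a \<Rightarrow> complex) set set" where
  "L2 M = L2_class M ` L2_fun M"

definition L2_rep :: "('a \<Rightarrow> complex) set \<Rightarrow> 'a \<Rightarrow> complex" where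
  "L2_rep F = (SOME f. f \<in> F)"

definition L2_add ::
    "'a measure \<Rightarrow> ('a \<Rightarrow> complex) set \<Rightarrow> ('a \<Rightarrow> complex) set \<Rightarrow> ('a \<Rightarrow> complex) set" where
  "L2_add M F G = L2_class M (\<lambda>x. L2_rep F x + L2_rep G x)"

definition L2_diff ::
    "'a measure \<Rightarrow> ('a \<Rightarrow> complex) set \<Rightarrow> ('a \<Rightarrow> complex) set \<Rightarrow> ('a \<Rightarrow> complex) set" where
  "L2_diff M F G = L2_class M (\<lambda>x. L2_rep F x - L2_rep G x)"

definition mult_op ::
    "'a measure \<Rightarrow> ('a \<Rightarrow> complex) \<Rightarrow> ('a \<Rightarrow> complex) set \<Rightarrow> ('a \<Rightarrow> complex) set" where
  "mult_op M \<omega> F = L2_class M (\<lambda>x. \<omega> x * L2_rep F x)"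

definition L2_scale ::
    "'a measure \<Rightarrow> complex \<Rightarrow> ('a \<Rightarrow> complex) set \<Rightarrow> ('a \<Rightarrow> complex) set" where
  "L2_scale M c = mult_op M (\<lambda>x. c)"

definition L2_inner ::
    "'a measure \<Rightarrow> ('a \<Rightarrow> complex) set \<Rightarrow> ('a \<Rightarrow> complex) set \<Rightarrow> complex" where
  "L2_inner M F G = (LINT x|M. L2_rep F x * cnj (L2_rep G x))"

definition L2_norm :: "'a measure \<Rightarrow> ('a \<Rightarrow> complex) set \<Rightarrow> real" where
  "L2_norm M F = sqrt (LINT x|M. (cmod (L2_rep F x))\<^sup>2)"

definition L2_tendsto ::
    "'a measure \<Rightarrow> ('i \<Rightarrow> ('a \<Rightarrow> complex) set) \<Rightarrow> ('a \<Rightarrow> complex) set \<Rightarrow> 'i filter \<Rightarrow> bool" where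
  "L2_tendsto M F G net \<longleftrightarrow>
     G \<in> L2 M \<and> (\<forall>\<^sub>F i in net. F i \<in> L2 M) \<and> ((\<lambda>i. L2_norm M (L2_diff M (F i) G)) \<longlongrightarrow> 0) net"

text \<open>\<open>U\<close> is a Hilbert space isomorphism from the closed subspace \<open>A\<close> of \<open>L\<^sup>2(M)\<close> onto the
  closed subspace \<open>B\<close> of \<open>L\<^sup>2(N)\<close>.\<close>

definition hilbert_isomorphism ::
    "'a measure \<Rightarrow> ('a \<Rightarrow> complex) set set \<Rightarrow> 'b measure \<Rightarrow> ('b \<Rightarrow> complex) set set \<Rightarrow>
     (('a \<Rightarrow> complex) set \<Rightarrow> ('b \<Rightarrow> complex) set) \<Rightarrow> bool" where
  "hilbert_isomorphism M A N B U \<longleftrightarrow>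
     bij_betw U A B \<and>
     (\<forall>F\<in>A. \<forall>G\<in>A. U (L2_add M F G) = L2_add N (U F) (U G)) \<and>
     (\<forall>c. \<forall>F\<in>A. U (L2_scale M c F) = L2_scale N c (U F)) \<and>
     (\<forall>F\<in>A. \<forall>G\<in>A. L2_inner N (U F) (U G) = L2_inner M F G)"

lemma L2_rep_class:
  assumes "f \<in> L2_fun M"
  shows "L2_rep (L2_class M f) \<in> L2_fun M" "AE x in M. L2_rep (L2_class M f) x = f x"
proof -
  have "f \<in> L2_class M f"
    using assms by (simp add: L2_class_def)
  then have "L2_rep (L2_class M f) \<in> L2_class M f"
    unfolding L2_rep_def by (rule someI[where P = "\<lambda>g. g \<in> L2_class M f"])
  then show "L2_rep (L2_class M f) \<in> L2_fun M" "AE x in M. L2_rep (L2_class M f) x = f x"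
    by (simp_all add: L2_class_def)
qed

lemma L2_class_cong:
  assumes "AE x in M. f x = g x"
  shows "L2_class M f = L2_class M g"
proof -
  have "(AE x in M. h x = f x) \<longleftrightarrow> (AE x in M. h x = g x)" for h
    using assms by (auto elim: eventually_elim2)
  then show ?thesis
    by (simp add: L2_class_def)
qed

lemma L2_class_eq_iff:
  assumes "f \<in> L2_fun M"
  shows "L2_class M f = L2_class M g \<longleftrightarrow> (AE x in M. f x = g x)"
proof
  assume "L2_class M f = L2_class M g"
  moreover have "f \<in> L2_class M f"
    using assms by (simp add: L2_class_def)
  ultimately show "AE x in M. f x = g x"
    by (simp add: L2_class_def)
qed (rule L2_class_cong)


section \<open>The Hardy space and Toeplitz operators\<close>

definition circle_measure :: "complex measure" where
  "circle_measure =
     distr (uniform_measure lborel {0..<2 * pi}) (restrict_space borel (sphere 0 1)) cis"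

text \<open>The closed linear span of \<open>z \<mapsto> z ^ n\<close>, \<open>n \<ge> 0\<close>, in \<open>L\<^sup>2\<close> of the circle.\<close>

definition H2 :: "(complex \<Rightarrow> complex) set set" where
  "H2 = {F \<in> L2 circle_measure. \<forall>\<epsilon>>0. \<exists>N::nat. \<exists>c::nat \<Rightarrow> complex.
     L2_norm circle_measure
       (L2_diff circle_measure F (L2_class circle_measure (\<lambda>z. \<Sum>n\<le>N. c n * z ^ n))) < \<epsilon>}"

definition Q_plus :: "(complex \<Rightarrow> complex) set \<Rightarrow> (complex \<Rightarrow> complex) set" where
  "Q_plus F = (THE H. H \<in> H2 \<and>
     (\<forall>G\<in>H2. L2_inner circle_measure (L2_diff circle_measure F H) G = 0))"

text \<open>\<open>H2\<close> is a subset of \<open>L2 circle_measure\<close>, so the inclusion \<open>Q\<^sub>+\<^sup>*\<close> is the identity.\<close>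

definition toeplitz ::
    "(complex \<Rightarrow> complex) \<Rightarrow> (complex \<Rightarrow> complex) set \<Rightarrow> (complex \<Rightarrow> complex) set" where
  "toeplitz \<omega> F = Q_plus (mult_op circle_measure \<omega> F)"


section \<open>The Fourier transformation\<close>

definition fourier :: "(real \<Rightarrow> complex) set \<Rightarrow> (real \<Rightarrow> complex) set" where
  "fourier = (THE U. U \<in> extensional (L2 lborel) \<and>
     hilbert_isomorphism lborel (L2 lborel) lborel (L2 lborel) U \<and>
     (\<forall>f \<in> L2_fun lborel. integrable lborel f \<longrightarrow>
        U (L2_class lborel f) =
          L2_class lborel (\<lambda>x. complex_of_real ((2 * pi) powr (- 1 / 2)) *
            (LINT y|lborel. exp (- \<i> * complex_of_real (x * y)) * f y))))"

definition fourier_inv :: "(real \<Rightarrow> complex) set \<Rightarrow> (real \<Rightarrow> complex) set" where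
  "fourier_inv = inv_into (L2 lborel) fourier"


section \<open>The isomorphism \<open>X\<^sub>+\<close>\<close>

abbreviation Rplus :: "real measure" where
  "Rplus \<equiv> restrict_space lborel {0<..}"

definition P_plus_star :: "(real \<Rightarrow> complex) set \<Rightarrow> (real \<Rightarrow> complex) set" where
  "P_plus_star F = L2_class lborel (\<lambda>x. if 0 < x then L2_rep F x else 0)"

definition chi :: "real \<Rightarrow> real \<Rightarrow> real \<Rightarrow> complex" where
  "chi \<alpha> \<beta> x = cis \<alpha> *
     (complex_of_real x - \<i> * complex_of_real (tan (\<beta> / 2))) /
     (complex_of_real x + \<i> * complex_of_real (tan (\<beta> / 2)))"

text \<open>On the unit circle without \<open>cis \<alpha>\<close> this is the inverse of \<open>chi\<close> and takes real values.
  The excluded point is a null set.\<close>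

definition chi_inv :: "real \<Rightarrow> real \<Rightarrow> complex \<Rightarrow> complex" where
  "chi_inv \<alpha> \<beta> z =
     \<i> * complex_of_real (tan (\<beta> / 2)) * (z + cis \<alpha>) / (- z + cis \<alpha>)"

lemma chi_inv_chi:
  assumes "0 < \<beta>" "\<beta> < pi"
  shows "chi_inv \<alpha> \<beta> (chi \<alpha> \<beta> x) = complex_of_real x"
proof -
  define t where "t = tan (\<beta> / 2)"
  have "0 < t"
    unfolding t_def using assms by (intro tan_gt_zero) auto
  then have d: "complex_of_real x + \<i> * complex_of_real t \<noteq> 0"
    by (auto simp: complex_eq_iff)
  have n: "- chi \<alpha> \<beta> x + cis \<alpha> = cis \<alpha> * (2 * \<i> * t) / (complex_of_real x + \<i> * t)"
    using d by (simp add: chi_def flip: t_def) (simp add: field_simps)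
  have p: "chi \<alpha> \<beta> x + cis \<alpha> = cis \<alpha> * (2 * x) / (complex_of_real x + \<i> * t)"
    using d by (simp add: chi_def flip: t_def) (simp add: field_simps)
  show ?thesis
    unfolding chi_inv_def n p using \<open>0 < t\<close> d by (simp add: field_simps flip: t_def)
qed

definition X_op :: "real \<Rightarrow> real \<Rightarrow> (real \<Rightarrow> complex) set \<Rightarrow> (complex \<Rightarrow> complex) set" where
  "X_op \<alpha> \<beta> F = L2_class circle_measure (\<lambda>z.
     complex_of_real (sqrt (2 * pi)) * cis \<alpha> *
     (complex_of_real (sqrt (2 * tan (\<beta> / 2))) / (- z + cis \<alpha>)) *
     L2_rep F (Re (chi_inv \<alpha> \<beta> z)))"

definition X_plus :: "real \<Rightarrow> real \<Rightarrow> (real \<Rightarrow> complex) set \<Rightarrow> (complex \<Rightarrow> complex) set" where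
  "X_plus \<alpha> \<beta> = Q_plus \<circ> X_op \<alpha> \<beta> \<circ> fourier_inv \<circ> P_plus_star"


section \<open>The isomorphisms \<open>V\<close> and \<open>Y\<close>\<close>

abbreviation unit_interval :: "real measure" where
  "unit_interval \<equiv> restrict_space lborel {0<..<1}"

definition q_plus :: "real \<Rightarrow> real \<Rightarrow> complex" where
  "q_plus s x =
     complex_of_real (1 / 2 * pi powr (- 3 / 2) * (1 / s) * (1 - s) powr (- 1 / 2)) *
     (LINT u:{-1<..<1}|lborel.
        exp (- \<i> * complex_of_real (x * u)) *
        complex_of_real ((1 - u\<^sup>2) powr (- 1 / 2)) *
        exp (\<i> / complex_of_real (2 * pi) *
             complex_of_real (ln (1 / s - 1) * ln ((1 - u) / (1 + u)))))"

definition V_op :: "(real \<Rightarrow> complex) set \<Rightarrow> (real \<Rightarrow> complex) set" where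
  "V_op H = (THE G.
     L2_tendsto Rplus
       (\<lambda>(a, a'). L2_class Rplus (\<lambda>x. LINT s:{a..1 - a'}|lborel. q_plus s x * L2_rep H s))
       G (at_right 0 \<times>\<^sub>F at_right 0))"

definition Y_op :: "real \<Rightarrow> real \<Rightarrow> (real \<Rightarrow> complex) set \<Rightarrow> (complex \<Rightarrow> complex) set" where
  "Y_op \<alpha> \<beta> = X_plus \<alpha> \<beta> \<circ> V_op"

end

theory Submission
  imports Defs "HOL-Complex_Analysis.Complex_Analysis" "HOL-Probability.Sinc_Integral"
begin

text \<open>
  The substitution \<open>chi\<close> turns \<open>H2\<close> into the Hardy space of the upper half-plane (Fourier transform
  vanishing on the negative half-line) and \<open>toeplitz (indicator A)\<close> into the compression to it of
  the multiplication by the indicator function of \<open>[-1, 1]\<close>.  The coordinate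
  \<open>w = ln ((1 - u) / (1 + u)) / (2 * pi)\<close> maps the upper half-plane onto a strip of height \<open>1/2\<close>,
  whose two boundary lines correspond to the inside and the outside of \<open>[-1, 1]\<close>.  A translation by
  \<open>\<i>/2\<close> multiplies the Fourier transform by \<open>exp (l/2)\<close>, so, with \<open>s = 1 / (1 + exp l)\<close>, the Hardy
  space consists of the functions whose two pieces have the Fourier transforms \<open>sqrt s * x\<close> and
  \<open>sqrt (1 - s) * x\<close> for some square-integrable \<open>x\<close>; its orthogonal complement belongs to the pairs
  \<open>sqrt (1 - s) * z\<close>, \<open>- sqrt s * z\<close>.  Cutting down to \<open>[-1, 1]\<close> leaves
  \<open>(sqrt s * x, 0) = (sqrt s * (s * x), sqrt (1 - s) * (s * x)) +
     (sqrt (1 - s) * z, - sqrt s * z)\<close> with \<open>z = sqrt (s * (1 - s)) * x\<close>,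
  so the compression is the multiplication by \<open>s\<close>.  By the same identity the part on the positive
  half-line of the Fourier transform of the function belonging to \<open>s * x\<close> is an integral over
  \<open>[-1, 1]\<close> alone, which yields the kernel \<open>q_plus\<close>.
\<close>

section \<open>Square-integrable classes on the line as a complex Hilbert space\<close>

section \<open>The Hilbert space of square-integrable functions on the real line\<close>

text \<open>The spaces \<open>L2 M\<close> are sets of classes, and \<open>fourier\<close>,
  \<open>Q_plus\<close>, \<open>V_op\<close> are definite descriptions, so each needs existence and
  uniqueness before anything can be computed. All spaces are therefore embedded isometrically by
  \<open>emb\<close> into one type \<open>l2\<close> of classes on the line; identities are proved
  there and pulled back by injectivity. The analytic input is reduced to explicit kernels:
  \<open>Gp x\<close> lies in \<open>hardy\<close> as soon as it is orthogonal to enough functions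
  \<open>rsv b\<close>, that is 1 / (b + \<i> u), and the two pieces of such a kernel are, up to
  sign, one analytic function on the two edges of the strip. Shifting the contour for this function
  alone gives the factor exp (l/2). That \<open>Gp\<close> reaches all of \<open>hardy\<close> is
  then algebra: the pointwise matrix with rows (sqrt s, sqrt (1 - s)) and (sqrt (1 - s), - sqrt s)
  is orthogonal, so every function is a sum \<open>Gp y + Gm z\<close>. The angle \<beta> leaves the
  spectral side: \<open>chi\<close> is scaled by tan (\<beta>/2) in such a way that every arc
  becomes [-1, 1].\<close>

lemma L2_fun_measurable [measurable_dest]: "f \<in> L2_fun M \<Longrightarrow> f \<in> borel_measurable M"
  by (simp add: L2_fun_def)

lemma borel_measurable_cnj [measurable (raw)]:
  "f \<in> borel_measurable M \<Longrightarrow> (\<lambda>x. cnj (f x)) \<in> borel_measurable M"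
  by (rule measurable_compose[OF _ borel_measurable_continuous_onI]) (auto intro: continuous_intros)

lemma L2_fun_iff_nn_integral:
  "f \<in> L2_fun M \<longleftrightarrow> f \<in> borel_measurable M \<and> (\<integral>\<^sup>+x. ennreal ((cmod (f x))\<^sup>2) \<partial>M) < \<infinity>"
  by (auto simp: L2_fun_def integrable_iff_bounded)

lemma nn_integral_L2_fun:
  assumes "f \<in> L2_fun M"
  shows "(\<integral>\<^sup>+x. ennreal ((cmod (f x))\<^sup>2) \<partial>M) = ennreal (LINT x|M. (cmod (f x))\<^sup>2)"
  using assms by (intro nn_integral_eq_integral) (auto simp: L2_fun_def)

lemma L2_fun_bound:
  assumes "g \<in> L2_fun M" "f \<in> borel_measurable M" "AE x in M. cmod (f x) \<le> C * cmod (g x)"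
  shows "f \<in> L2_fun M"
proof -
  have "integrable M (\<lambda>x. C\<^sup>2 * (cmod (g x))\<^sup>2)"
    using assms(1) by (simp add: L2_fun_def)
  then have "integrable M (\<lambda>x. (cmod (f x))\<^sup>2)"
  proof (rule Bochner_Integration.integrable_bound)
    show "AE x in M. norm ((cmod (f x))\<^sup>2) \<le> norm (C\<^sup>2 * (cmod (g x))\<^sup>2)"
      using assms(3)
    proof eventually_elim
      case (elim x)
      then have "(cmod (f x))\<^sup>2 \<le> (C * cmod (g x))\<^sup>2"
        by (intro power_mono) auto
      then show ?case by (simp add: power_mult_distrib)
    qed
  qed (use assms(2) in measurable)
  then show ?thesis using assms(2) by (simp add: L2_fun_def)
qed

lemma L2_fun_cong:
  assumes "g \<in> L2_fun M" "f \<in> borel_measurable M" "AE x in M. f x = g x"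
  shows "f \<in> L2_fun M"
  by (rule L2_fun_bound[OF assms(1,2), of 1]) (use assms(3) in auto)

lemma L2_fun_zero [simp]: "(\<lambda>x. 0) \<in> L2_fun M"
  by (simp add: L2_fun_def)

lemma L2_fun_add [intro]:
  assumes "f \<in> L2_fun M" "g \<in> L2_fun M"
  shows "(\<lambda>x. f x + g x) \<in> L2_fun M"
proof -
  have [measurable]: "f \<in> borel_measurable M" "g \<in> borel_measurable M"
    using assms by auto
  have "integrable M (\<lambda>x. 2 * (cmod (f x))\<^sup>2 + 2 * (cmod (g x))\<^sup>2)"
    using assms by (simp add: L2_fun_def)
  then have "integrable M (\<lambda>x. (cmod (f x + g x))\<^sup>2)"
  proof (rule Bochner_Integration.integrable_bound)
    have "(cmod (f x + g x))\<^sup>2 \<le> 2 * (cmod (f x))\<^sup>2 + 2 * (cmod (g x))\<^sup>2" for x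
    proof -
      have "(cmod (f x + g x))\<^sup>2 \<le> (cmod (f x) + cmod (g x))\<^sup>2"
        by (intro power_mono norm_triangle_ineq) auto
      also have "\<dots> \<le> 2 * (cmod (f x))\<^sup>2 + 2 * (cmod (g x))\<^sup>2"
        using sum_squares_bound[of "cmod (f x)" "cmod (g x)"] by (simp add: power2_sum)
      finally show ?thesis .
    qed
    then show "AE x in M. norm ((cmod (f x + g x))\<^sup>2) \<le> norm (2 * (cmod (f x))\<^sup>2 + 2 * (cmod (g x))\<^sup>2)"
      by (intro AE_I2) (simp add: add_nonneg_nonneg)
  qed measurable
  then show ?thesis by (simp add: L2_fun_def)
qed

lemma L2_fun_cmult [intro]: "f \<in> L2_fun M \<Longrightarrow> (\<lambda>x. c * f x) \<in> L2_fun M"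
  by (rule L2_fun_bound[of f _ _ "cmod c"]) (auto simp: norm_mult)

lemma L2_fun_diff [intro]:
  assumes "f \<in> L2_fun M" "g \<in> L2_fun M"
  shows "(\<lambda>x. f x - g x) \<in> L2_fun M"
  using L2_fun_add[OF assms(1) L2_fun_cmult[OF assms(2), of "-1"]] by simp

lemma L2_fun_cnj: "f \<in> L2_fun M \<Longrightarrow> (\<lambda>x. cnj (f x)) \<in> L2_fun M"
  by (rule L2_fun_bound[of f _ _ 1]) auto

lemma L2_fun_integrable_mult:
  assumes "f \<in> L2_fun M" "g \<in> L2_fun M"
  shows "integrable M (\<lambda>x. f x * g x)"
proof (rule Bochner_Integration.integrable_bound)
  show "integrable M (\<lambda>x. (cmod (f x))\<^sup>2 + (cmod (g x))\<^sup>2)"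
    using assms by (simp add: L2_fun_def)
  have "cmod (f x) * cmod (g x) \<le> (cmod (f x))\<^sup>2 + (cmod (g x))\<^sup>2" for x
    using sum_squares_bound[of "cmod (f x)" "cmod (g x)"]
      mult_nonneg_nonneg[OF norm_ge_zero[of "f x"] norm_ge_zero[of "g x"]] by linarith
  then show "AE x in M. norm (f x * g x) \<le> norm ((cmod (f x))\<^sup>2 + (cmod (g x))\<^sup>2)"
    by (intro AE_I2) (simp add: norm_mult add_nonneg_nonneg)
qed (use assms in measurable)

lemma L2_fun_integrable_mult_cnj:
  assumes "f \<in> L2_fun M" "g \<in> L2_fun M"
  shows "integrable M (\<lambda>x. f x * cnj (g x))"
  by (rule L2_fun_integrable_mult[OF assms(1) L2_fun_cnj[OF assms(2)]])

lemma L2_cases: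
  assumes "F \<in> L2 M"
  obtains f where "f \<in> L2_fun M" "F = L2_class M f"
  using assms by (auto simp: L2_def)

lemma L2_rep_in: "F \<in> L2 M \<Longrightarrow> L2_rep F \<in> L2_fun M"
  by (erule L2_cases) (simp add: L2_rep_class)

lemma L2_class_rep: "F \<in> L2 M \<Longrightarrow> L2_class M (L2_rep F) = F"
  by (erule L2_cases) (simp add: L2_class_cong[OF L2_rep_class(2)])

lemma L2_class_in: "f \<in> L2_fun M \<Longrightarrow> L2_class M f \<in> L2 M"
  by (simp add: L2_def)

text \<open>With the measure fixed to Lebesgue measure on the line the classes form a type, so
  limits, closures and extension by continuity come from the type classes \<open>real_inner\<close>
  and \<open>banach\<close>. The other spaces enter later through isometric embeddings into this
  type.\<close>

typedef l2 = "L2 (lborel :: real measure)" morphisms set_of Abs_l2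
  by (rule exI[of _ "L2_class lborel (\<lambda>x. 0)"]) (simp add: L2_class_in)

definition cls :: "(real \<Rightarrow> complex) \<Rightarrow> l2" where
  "cls f = Abs_l2 (L2_class lborel f)"

definition rep :: "l2 \<Rightarrow> real \<Rightarrow> complex" where
  "rep x = L2_rep (set_of x)"

lemma rep_L2 [simp]: "rep x \<in> L2_fun lborel"
  using set_of[of x] by (simp add: rep_def L2_rep_in)

lemma rep_measurable [measurable]: "rep x \<in> borel_measurable borel"
  using L2_fun_measurable[OF rep_L2[of x]] by simp

lemma cls_rep [simp]: "cls (rep x) = x"
  using set_of[of x] by (simp add: cls_def rep_def L2_class_rep set_of_inverse)

lemma set_of_cls: "f \<in> L2_fun lborel \<Longrightarrow> set_of (cls f) = L2_class lborel f"
  by (simp add: cls_def Abs_l2_inverse L2_class_in)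

lemma rep_cls: "f \<in> L2_fun lborel \<Longrightarrow> AE x in lborel. rep (cls f) x = f x"
  by (simp add: rep_def set_of_cls L2_rep_class)

lemma cls_cong: "AE x in lborel. f x = g x \<Longrightarrow> cls f = cls g"
  by (simp add: cls_def L2_class_cong)

lemma cls_eq_iff:
  assumes "f \<in> L2_fun lborel" "g \<in> L2_fun lborel"
  shows "cls f = cls g \<longleftrightarrow> (AE x in lborel. f x = g x)"
  using assms set_of_cls L2_class_eq_iff cls_cong by metis

lemma l2_cases:
  obtains f where "f \<in> L2_fun lborel" "x = cls f"
  using that[of "rep x"] by simp

text \<open>The type class \<open>real_inner\<close> sees only real scalars, so the complex
  structure is kept by \<open>ip\<close> and \<open>cmul\<close>; the inner product of the class
  will be the real part of \<open>ip\<close>.\<close>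

definition ip :: "l2 \<Rightarrow> l2 \<Rightarrow> complex" where
  "ip x y = (LINT t|lborel. rep x t * cnj (rep y t))"

definition cmul :: "complex \<Rightarrow> l2 \<Rightarrow> l2" where
  "cmul c x = cls (\<lambda>t. c * rep x t)"

lemma ip_cls:
  assumes "f \<in> L2_fun lborel" "g \<in> L2_fun lborel"
  shows "ip (cls f) (cls g) = (LINT t|lborel. f t * cnj (g t))"
  unfolding ip_def
proof (rule integral_cong_AE)
  show "AE t in lborel. rep (cls f) t * cnj (rep (cls g) t) = f t * cnj (g t)"
    using rep_cls[OF assms(1)] rep_cls[OF assms(2)] by eventually_elim simp
qed (use assms in measurable)

lemma ip_cnj: "ip y x = cnj (ip x y)"
  by (simp add: ip_def mult.commute flip: Bochner_Integration.integral_cnj)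

lemma cmul_cls: "f \<in> L2_fun lborel \<Longrightarrow> cmul c (cls f) = cls (\<lambda>t. c * f t)"
  unfolding cmul_def by (rule cls_cong) (use rep_cls in fastforce)

lemma ip_cmul_left: "ip (cmul c x) y = c * ip x y"
proof -
  have "ip (cmul c x) y = ip (cls (\<lambda>t. c * rep x t)) (cls (rep y))"
    by (simp add: cmul_def)
  also have "\<dots> = (LINT t|lborel. c * (rep x t * cnj (rep y t)))"
    by (subst ip_cls) (auto simp: mult.assoc)
  finally show ?thesis by (simp add: ip_def)
qed

lemma ip_cmul_right: "ip x (cmul c y) = cnj c * ip x y"
  by (subst (1 2) ip_cnj) (simp add: ip_cmul_left)

lemma ip_self: "ip x x = complex_of_real (LINT t|lborel. (cmod (rep x t))\<^sup>2)"
  unfolding ip_def integral_complex_of_real[symmetric] by (simp only: complex_norm_square)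

lemma ip_self_0: "ip x x = 0 \<longleftrightarrow> x = cls (\<lambda>t. 0)"
proof
  assume "ip x x = 0"
  then have "(LINT t|lborel. (cmod (rep x t))\<^sup>2) = 0"
    by (simp add: ip_self)
  then have "AE t in lborel. (cmod (rep x t))\<^sup>2 = 0"
    using rep_L2[of x] by (subst (asm) integral_nonneg_eq_0_iff_AE) (auto simp: L2_fun_def)
  then have "cls (rep x) = cls (\<lambda>t. 0)"
    by (intro cls_cong) auto
  then show "x = cls (\<lambda>t. 0)" by simp
qed (simp add: ip_cls)

instantiation l2 :: real_inner
begin

definition zero_l2_def: "0 = cls (\<lambda>t. 0)"
definition plus_l2_def: "x + y = cls (\<lambda>t. rep x t + rep y t)"
definition minus_l2_def: "x - y = cls (\<lambda>t. rep x t - rep y t)"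
definition uminus_l2_def: "- x = cls (\<lambda>t. - rep x t)"
definition scaleR_l2_def: "scaleR r x = cmul (complex_of_real r) x"
definition inner_l2_def: "inner x y = Re (ip x y)"
definition norm_l2_def: "norm (x :: l2) = sqrt (inner x x)"
definition sgn_l2_def: "sgn (x :: l2) = scaleR (inverse (norm x)) x"
definition dist_l2_def: "dist (x :: l2) y = norm (x - y)"
definition uniformity_l2_def:
  "(uniformity :: (l2 \<times> l2) filter) = (INF e\<in>{0 <..}. principal {(x, y). dist x y < e})"
definition open_l2_def:
  "open (U :: l2 set) = (\<forall>x\<in>U. \<forall>\<^sub>F (x', y) in uniformity. x' = x \<longrightarrow> y \<in> U)"

lemma plus_cls:
  assumes "f \<in> L2_fun lborel" "g \<in> L2_fun lborel"
  shows "cls f + cls g = cls (\<lambda>t. f t + g t)"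
  unfolding plus_l2_def
  by (rule cls_cong) (use rep_cls[OF assms(1)] rep_cls[OF assms(2)] in eventually_elim, simp)

lemma minus_cls:
  assumes "f \<in> L2_fun lborel" "g \<in> L2_fun lborel"
  shows "cls f - cls g = cls (\<lambda>t. f t - g t)"
  unfolding minus_l2_def
  by (rule cls_cong) (use rep_cls[OF assms(1)] rep_cls[OF assms(2)] in eventually_elim, simp)

lemma ip_add_left: "ip (x + y) z = ip x z + ip y z"
proof -
  have "ip (x + y) z = ip (cls (\<lambda>t. rep x t + rep y t)) (cls (rep z))"
    by (simp add: plus_l2_def)
  also have "\<dots> = (LINT t|lborel. rep x t * cnj (rep z t) + rep y t * cnj (rep z t))"
    by (subst ip_cls) (auto simp: algebra_simps)
  also have "\<dots> = ip x z + ip y z"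
    unfolding ip_def by (intro Bochner_Integration.integral_add L2_fun_integrable_mult_cnj) auto
  finally show ?thesis .
qed

instance
proof
  fix x y z :: l2 and a b :: real
  show "x + y + z = x + (y + z)"
    by (rule l2_cases[of x], rule l2_cases[of y], rule l2_cases[of z])
       (simp add: plus_cls L2_fun_add add.assoc)
  show "x + y = y + x"
    by (simp add: plus_l2_def add.commute)
  show "0 + x = x"
    by (rule l2_cases[of x]) (simp add: plus_cls zero_l2_def)
  show "- x + x = 0"
    by (rule l2_cases[of x])
       (simp add: uminus_l2_def zero_l2_def plus_l2_def, rule cls_cong, use rep_cls[of "\<lambda>t. - rep x t"] L2_fun_cmult[OF rep_L2, of "-1" x] in fastforce)
  show "x - y = x + - y"
  proof -
    have "x + - y = cls (rep x) + cls (\<lambda>t. - rep y t)"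
      by (simp add: uminus_l2_def)
    also have "\<dots> = x - y"
      using L2_fun_cmult[OF rep_L2, of "-1" y] by (subst plus_cls) (auto simp: minus_l2_def)
    finally show ?thesis by simp
  qed
  show "a *\<^sub>R (x + y) = a *\<^sub>R x + a *\<^sub>R y"
    by (rule l2_cases[of x], rule l2_cases[of y])
       (simp add: scaleR_l2_def plus_cls L2_fun_add L2_fun_cmult cmul_cls distrib_left distrib_right)
  show "(a + b) *\<^sub>R x = a *\<^sub>R x + b *\<^sub>R x"
    by (rule l2_cases[of x])
       (simp add: scaleR_l2_def plus_cls L2_fun_add L2_fun_cmult cmul_cls distrib_left distrib_right)
  show "a *\<^sub>R b *\<^sub>R x = (a * b) *\<^sub>R x"
    by (rule l2_cases[of x])
       (simp add: scaleR_l2_def L2_fun_cmult cmul_cls mult.assoc)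
  show "1 *\<^sub>R x = x"
    by (simp add: scaleR_l2_def cmul_def)
  show "sgn x = inverse (norm x) *\<^sub>R x" by (rule sgn_l2_def)
  show "dist x y = norm (x - y)" by (rule dist_l2_def)
  show "uniformity = (INF e\<in>{0 <..}. principal {(x :: l2, y). dist x y < e})"
    by (rule uniformity_l2_def)
  show "open U = (\<forall>x\<in>U. \<forall>\<^sub>F (x', y) in uniformity. x' = x \<longrightarrow> y \<in> U)" for U :: "l2 set"
    by (rule open_l2_def)
  show "inner x y = inner y x"
    unfolding inner_l2_def by (subst ip_cnj) simp
  show "inner (x + y) z = inner x z + inner y z"
    by (simp add: inner_l2_def ip_add_left)
  show "inner (a *\<^sub>R x) y = a * inner x y"
    by (simp add: inner_l2_def scaleR_l2_def ip_cmul_left)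
  show "0 \<le> inner x x"
    by (simp add: inner_l2_def ip_self)
  show "inner x x = 0 \<longleftrightarrow> x = 0"
    unfolding inner_l2_def zero_l2_def ip_self_0[symmetric] by (simp add: ip_self)
  show "norm x = sqrt (inner x x)" by (rule norm_l2_def)
qed

end

lemma zero_cls: "cls (\<lambda>t. 0) = 0"
  by (simp add: zero_l2_def)

lemma norm_cls:
  assumes "f \<in> L2_fun lborel"
  shows "norm (cls f) = sqrt (LINT t|lborel. (cmod (f t))\<^sup>2)"
proof -
  have "ip (cls f) (cls f) = complex_of_real (LINT t|lborel. (cmod (f t))\<^sup>2)"
    unfolding integral_complex_of_real[symmetric] by (simp only: ip_cls[OF assms assms] complex_norm_square)
  then show ?thesis
    unfolding norm_l2_def inner_l2_def by simp
qed

lemma norm_cls_nn: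
  assumes "f \<in> L2_fun lborel"
  shows "ennreal ((norm (cls f))\<^sup>2) = (\<integral>\<^sup>+t. ennreal ((cmod (f t))\<^sup>2) \<partial>lborel)"
  by (simp add: nn_integral_L2_fun[OF assms] norm_cls[OF assms])

lemma norm_rep_nn: "ennreal ((norm x)\<^sup>2) = (\<integral>\<^sup>+t. ennreal ((cmod (rep x t))\<^sup>2) \<partial>lborel)"
  using norm_cls_nn[OF rep_L2[of x]] by simp

lemma sum_cls:
  assumes "finite I" "\<And>i. i \<in> I \<Longrightarrow> f i \<in> L2_fun lborel"
  shows "(\<lambda>t. \<Sum>i\<in>I. f i t) \<in> L2_fun lborel" "(\<Sum>i\<in>I. cls (f i)) = cls (\<lambda>t. \<Sum>i\<in>I. f i t)"
proof -
  have "(\<lambda>t. \<Sum>i\<in>I. f i t) \<in> L2_fun lborel \<and> (\<Sum>i\<in>I. cls (f i)) = cls (\<lambda>t. \<Sum>i\<in>I. f i t)"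
    using assms by (induction I rule: finite_induct) (auto simp: zero_cls plus_cls)
  then show "(\<lambda>t. \<Sum>i\<in>I. f i t) \<in> L2_fun lborel" "(\<Sum>i\<in>I. cls (f i)) = cls (\<lambda>t. \<Sum>i\<in>I. f i t)"
    by auto
qed

lemma norm_cls_le:
  assumes "f \<in> borel_measurable borel" "(\<integral>\<^sup>+t. ennreal ((cmod (f t))\<^sup>2) \<partial>lborel) \<le> ennreal (c\<^sup>2)" "0 \<le> c"
  shows "f \<in> L2_fun lborel" "norm (cls f) \<le> c"
proof -
  show *: "f \<in> L2_fun lborel"
    using assms by (auto simp: L2_fun_iff_nn_integral intro: le_less_trans)
  have "ennreal ((norm (cls f))\<^sup>2) \<le> ennreal (c\<^sup>2)"
    using assms(2) by (simp add: norm_cls_nn[OF *])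
  then show "norm (cls f) \<le> c"
    using assms(3) by (subst (asm) ennreal_le_iff) (auto intro: power2_le_imp_le)
qed

text \<open>Riesz-Fischer argument: the partial sums of the moduli of the increments have norm at
  most 2, so by monotone convergence their supremum is finite almost everywhere, and there the
  increments are summable.\<close>

lemma l2_AE_Cauchy:
  fixes X :: "nat \<Rightarrow> l2"
  assumes X: "\<And>n. norm (X (Suc n) - X n) \<le> (1 / 2) ^ n"
  shows "AE t in lborel. Cauchy (\<lambda>n. rep (X n) t)"
proof -
  define a where "a n t = cmod (rep (X (Suc n)) t - rep (X n) t)" for n t
  have [measurable]: "a n \<in> borel_measurable borel" for n
    unfolding a_def by measurable
  define b where "b N t = complex_of_real (\<Sum>n<N. a n t)" for N t
  have a2: "(\<lambda>t. complex_of_real (a n t)) \<in> L2_fun lborel" for n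
    by (rule L2_fun_bound[OF L2_fun_diff[OF rep_L2[of "X (Suc n)"] rep_L2[of "X n"]], where C = 1])
       (auto simp: a_def)
  have na: "norm (cls (\<lambda>t. complex_of_real (a n t))) \<le> (1 / 2) ^ n" for n
    using X[of n] a2[of n] by (simp add: norm_cls minus_l2_def L2_fun_diff a_def)
  have b: "b N \<in> L2_fun lborel" "cls (b N) = (\<Sum>n<N. cls (\<lambda>t. complex_of_real (a n t)))" for N
    using sum_cls[of "{..<N}" "\<lambda>n t. complex_of_real (a n t)"] a2 by (auto simp: b_def[abs_def])
  have nb: "norm (cls (b N)) \<le> 2" for N
  proof -
    have "norm (cls (b N)) \<le> (\<Sum>n<N. (1 / 2) ^ n)"
      unfolding b(2) by (intro sum_norm_le na)
    also have "\<dots> \<le> (\<Sum>n. (1 / 2) ^ n)"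
      by (intro sum_le_suminf) (auto intro: summable_geometric)
    also have "\<dots> = (2::real)"
      by (subst suminf_geometric) auto
    finally show ?thesis .
  qed
  have bsq: "(cmod (b N t))\<^sup>2 = (\<Sum>n<N. a n t)\<^sup>2" for N t
    unfolding b_def by (simp only: norm_of_real power2_abs)
  have "(\<integral>\<^sup>+t. (SUP N. ennreal ((\<Sum>n<N. a n t)\<^sup>2)) \<partial>lborel) = (SUP N. \<integral>\<^sup>+t. ennreal ((\<Sum>n<N. a n t)\<^sup>2) \<partial>lborel)"
    by (intro nn_integral_monotone_convergence_SUP)
       (auto simp: incseq_def le_fun_def a_def intro!: ennreal_leI power_mono sum_mono2 sum_nonneg)
  also have "\<dots> \<le> ennreal 4"
  proof (rule SUP_least)
    fix N
    have "(\<integral>\<^sup>+t. ennreal ((\<Sum>n<N. a n t)\<^sup>2) \<partial>lborel) = ennreal ((norm (cls (b N)))\<^sup>2)"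
      by (simp only: norm_cls_nn[OF b(1)] bsq)
    also have "\<dots> \<le> ennreal 4"
      using power_mono[OF nb[of N], of 2] by (intro ennreal_leI) auto
    finally show "(\<integral>\<^sup>+t. ennreal ((\<Sum>n<N. a n t)\<^sup>2) \<partial>lborel) \<le> ennreal 4" .
  qed
  finally have "(\<integral>\<^sup>+t. (SUP N. ennreal ((\<Sum>n<N. a n t)\<^sup>2)) \<partial>lborel) \<noteq> \<infinity>"
    using ennreal_less_top le_less_trans by (metis infinity_ennreal_def less_irrefl)
  then have "AE t in lborel. (SUP N. ennreal ((\<Sum>n<N. a n t)\<^sup>2)) \<noteq> \<infinity>"
    by (intro nn_integral_PInf_AE) auto
  then show ?thesis
  proof eventually_elim
    case (elim t)
    then obtain c where c: "(SUP N. ennreal ((\<Sum>n<N. a n t)\<^sup>2)) = ennreal c" "0 \<le> c"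
      by (cases "SUP N. ennreal ((\<Sum>n<N. a n t)\<^sup>2)") auto
    have le: "(\<Sum>n<N. a n t) \<le> sqrt c" for N
    proof -
      have "ennreal ((\<Sum>n<N. a n t)\<^sup>2) \<le> ennreal c"
        unfolding c(1)[symmetric] by (rule SUP_upper) simp
      then show ?thesis
        using c(2) by (simp add: real_le_rsqrt)
    qed
    have "summable (\<lambda>n. a n t)"
      by (rule bounded_imp_summable[of _ "sqrt c"]) (use le[of "Suc _"] in \<open>auto simp: a_def lessThan_Suc_atMost\<close>)
    then have "summable (\<lambda>n. rep (X (Suc n)) t - rep (X n) t)"
      unfolding a_def by (rule summable_norm_cancel)
    then have "convergent (\<lambda>N. \<Sum>n<N. (rep (X (Suc n)) t - rep (X n) t))"
      by (simp add: summable_iff_convergent)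
    then have "convergent (\<lambda>N. (rep (X N) t - rep (X 0) t) + rep (X 0) t)"
      unfolding sum_lessThan_telescope[of "\<lambda>n. rep (X n) t"]
      by (intro convergent_add convergent_const)
    then show ?case
      by (simp add: Cauchy_convergent_iff)
  qed
qed

text \<open>The pointwise limit is the candidate; Fatou's lemma turns the bound on
  \<open>X m - X n\<close> into the same bound on the distance from \<open>X n\<close> to the
  limit.\<close>

lemma l2_tendsto_of_fast_Cauchy:
  fixes X :: "nat \<Rightarrow> l2"
  assumes X: "\<And>n m. n \<le> m \<Longrightarrow> norm (X m - X n) \<le> (1 / 2) ^ n"
  shows "convergent X"
proof -
  define f where "f t = lim (\<lambda>n. rep (X n) t)" for t
  have [measurable]: "f \<in> borel_measurable borel"
    unfolding f_def[abs_def] by (rule borel_measurable_lim_metric) (rule rep_measurable)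
  have f: "AE t in lborel. (\<lambda>n. rep (X n) t) \<longlonglongrightarrow> f t"
    using l2_AE_Cauchy[of X, OF X[OF le_SucI[OF order_refl]]]
    by eventually_elim (simp add: f_def Cauchy_convergent_iff convergent_LIMSEQ_iff)
  have *: "(\<integral>\<^sup>+t. ennreal ((cmod (f t - rep (X n) t))\<^sup>2) \<partial>lborel) \<le> ennreal (((1 / 2) ^ n)\<^sup>2)" for n
  proof -
    have "(\<integral>\<^sup>+t. ennreal ((cmod (f t - rep (X n) t))\<^sup>2) \<partial>lborel)
        = (\<integral>\<^sup>+t. liminf (\<lambda>m. ennreal ((cmod (rep (X m) t - rep (X n) t))\<^sup>2)) \<partial>lborel)"
    proof (rule nn_integral_cong_AE)
      show "AE t in lborel. ennreal ((cmod (f t - rep (X n) t))\<^sup>2)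
          = liminf (\<lambda>m. ennreal ((cmod (rep (X m) t - rep (X n) t))\<^sup>2))"
        using f
      proof eventually_elim
        case (elim t)
        then have "(\<lambda>m. ennreal ((cmod (rep (X m) t - rep (X n) t))\<^sup>2))
            \<longlonglongrightarrow> ennreal ((cmod (f t - rep (X n) t))\<^sup>2)"
          by (intro tendsto_ennrealI tendsto_power tendsto_norm tendsto_diff tendsto_const)
        then show ?case by (rule lim_imp_Liminf[OF sequentially_bot, symmetric])
      qed
    qed
    also have "\<dots> \<le> liminf (\<lambda>m. \<integral>\<^sup>+t. ennreal ((cmod (rep (X m) t - rep (X n) t))\<^sup>2) \<partial>lborel)"
      by (rule nn_integral_liminf) measurable
    also have "\<dots> = liminf (\<lambda>m. ennreal ((norm (X m - X n))\<^sup>2))"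
      by (simp add: minus_l2_def norm_cls_nn L2_fun_diff)
    also have "\<dots> \<le> ennreal (((1 / 2) ^ n)\<^sup>2)"
    proof (rule Liminf_le)
      show "\<forall>\<^sub>F m in sequentially. ennreal ((norm (X m - X n))\<^sup>2) \<le> ennreal (((1 / 2) ^ n)\<^sup>2)"
        using eventually_ge_at_top[of n]
        by eventually_elim (intro ennreal_leI power_mono X, auto)
    qed simp
    finally show ?thesis .
  qed
  have fn: "(\<lambda>t. f t - rep (X n) t) \<in> L2_fun lborel" "norm (cls (\<lambda>t. f t - rep (X n) t)) \<le> (1 / 2) ^ n" for n
    using norm_cls_le[OF _ *[of n]] by auto
  have f2: "f \<in> L2_fun lborel"
    using L2_fun_add[OF fn(1)[of 0] rep_L2[of "X 0"]] by simp
  have "norm (X n - cls f) \<le> (1 / 2) ^ n" for n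
    using fn(2)[of n] minus_cls[OF f2 rep_L2[of "X n"]] by (simp add: norm_minus_commute)
  then have "(\<lambda>n. X n - cls f) \<longlonglongrightarrow> 0"
    by (intro Lim_null_comparison[OF always_eventually[OF allI] LIMSEQ_power_zero[of "1 / 2 :: real"]]) auto
  then have "X \<longlonglongrightarrow> cls f" by (rule LIM_zero_cancel)
  then show ?thesis by (rule convergentI)
qed

instance l2 :: banach
proof
  fix X :: "nat \<Rightarrow> l2" assume X: "Cauchy X"
  then have "\<forall>n. \<exists>M. \<forall>m\<ge>M. \<forall>k\<ge>M. norm (X m - X k) < (1 / 2) ^ n"
    unfolding Cauchy_iff by simp
  then obtain M where M: "\<And>n m k. m \<ge> M n \<Longrightarrow> k \<ge> M n \<Longrightarrow> norm (X m - X k) < (1 / 2) ^ n"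
    by metis
  \<comment> \<open>The sum dominates \<open>M n\<close>; the summand \<open>n\<close> makes
    \<open>r\<close> strictly increasing even where \<open>M\<close> vanishes.\<close>
  define r where "r n = n + (\<Sum>i\<le>n. M i)" for n
  have r: "strict_mono r"
    by (rule strict_monoI_Suc) (simp add: r_def)
  have rM: "M n \<le> r n" for n
    unfolding r_def using member_le_sum[of n "{..n}" M] by simp
  have "norm (X (r m) - X (r n)) \<le> (1 / 2) ^ n" if "n \<le> m" for n m
    using M[of n "r m" "r n"] rM[of n] strict_mono_leD[OF r that] by simp
  then have "convergent (X \<circ> r)"
    by (intro l2_tendsto_of_fast_Cauchy) auto
  then obtain L where "(X \<circ> r) \<longlonglongrightarrow> L"
    by (auto simp: convergent_def)
  from Cauchy_converges_subseq[OF X r this] show "convergent X"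
    by (rule convergentI)
qed

section \<open>Complex-linear bounded operators, dense complex spans, extension by
  continuity\<close>

subsection \<open>Complex scalars, inner product and bounded operators\<close>

lemma cmul_add_right: "cmul c (x + y) = cmul c x + cmul c y"
  by (rule l2_cases[of x], rule l2_cases[of y])
     (simp add: plus_cls L2_fun_add L2_fun_cmult cmul_cls distrib_left)

lemma cmul_add_left: "cmul (c + d) x = cmul c x + cmul d x"
  by (rule l2_cases[of x]) (simp add: plus_cls L2_fun_cmult cmul_cls distrib_right)

lemma cmul_cmul [simp]: "cmul c (cmul d x) = cmul (c * d) x"
  by (rule l2_cases[of x]) (simp add: L2_fun_cmult cmul_cls mult.assoc)

lemma cmul_1 [simp]: "cmul 1 x = x"
  by (simp add: cmul_def)

lemma scaleR_eq_cmul: "r *\<^sub>R x = cmul (complex_of_real r) x"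
  by (simp add: scaleR_l2_def)

lemma cmul_zero_left [simp]: "cmul 0 x = 0"
  using scaleR_eq_cmul[of 0 x] by simp

lemma cmul_zero_right [simp]: "cmul c 0 = 0"
  using cmul_cmul[of c 0 0] by simp

lemma diff_eq_cmul: "x - y = x + cmul (- 1) y"
  using scaleR_eq_cmul[of "-1" y] by simp

lemma cmul_minus_right: "cmul c (- x) = - cmul c x"
  using cmul_add_right[of c x "- x"] by (simp add: eq_neg_iff_add_eq_0 add.commute)

lemma cmul_diff_right: "cmul c (x - y) = cmul c x - cmul c y"
  using cmul_add_right[of c x "- y"] by (simp add: cmul_minus_right)

lemma ip_norm: "ip x x = complex_of_real ((norm x)\<^sup>2)"
  using norm_cls[OF rep_L2[of x]] by (simp add: ip_self)

lemma norm_cmul: "norm (cmul c x) = cmod c * norm x"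
proof -
  have "complex_of_real ((norm (cmul c x))\<^sup>2) = c * cnj c * complex_of_real ((norm x)\<^sup>2)"
    unfolding ip_norm[symmetric] ip_cmul_left ip_cmul_right by simp
  also have "\<dots> = complex_of_real ((cmod c * norm x)\<^sup>2)"
    by (simp add: complex_norm_square[symmetric] power_mult_distrib)
  finally have "(norm (cmul c x))\<^sup>2 = (cmod c * norm x)\<^sup>2"
    by (simp only: of_real_eq_iff)
  then show ?thesis by (rule power2_eq_imp_eq) auto
qed

lemma ip_add_right: "ip x (y + z) = ip x y + ip x z"
  by (subst (1 2 3) ip_cnj) (simp add: ip_add_left)

lemma ip_zero_left [simp]: "ip 0 x = 0"
  using ip_cmul_left[of 0 0 x] by simp

lemma ip_zero_right [simp]: "ip x 0 = 0"
  by (subst ip_cnj) simp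

lemma ip_diff_left: "ip (x - y) z = ip x z - ip y z"
  using ip_add_left[of "x - y" y z] by simp

lemma ip_diff_right: "ip x (y - z) = ip x y - ip x z"
  using ip_add_right[of x "y - z" z] by simp

text \<open>The imaginary part of \<open>ip\<close> is a real inner product against a rotated
  vector, so a complex-linear map that preserves \<open>inner\<close> also preserves
  \<open>ip\<close>.\<close>

lemma ip_eq_Complex: "ip x y = Complex (inner x y) (inner x (cmul \<i> y))"
  by (simp add: complex_eq_iff inner_l2_def ip_cmul_right)

lemma norm_ip_le: "cmod (ip x y) \<le> norm x * norm y"
proof (cases "ip x y = 0")
  case False
  \<comment> \<open>The phase \<open>c\<close> makes \<open>ip (cmul c x) y\<close> real and
    nonnegative, hence equal to the real inner product, to which the real Cauchy-Schwarz inequality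
    applies.\<close>
  define c where "c = cnj (ip x y) / cmod (ip x y)"
  have "cmod c = 1" using False by (simp add: c_def norm_divide)
  have "ip (cmul c x) y = complex_of_real (cmod (ip x y))"
    using False complex_norm_square[of "ip x y"]
    by (simp add: ip_cmul_left c_def field_simps power2_eq_square)
  then have "cmod (ip x y) = inner (cmul c x) y"
    by (simp add: inner_l2_def)
  also have "\<dots> \<le> norm (cmul c x) * norm y"
    by (rule norm_cauchy_schwarz)
  finally show ?thesis using \<open>cmod c = 1\<close> by (simp add: norm_cmul)
qed simp

lemma bounded_linear_ip_left: "bounded_linear (\<lambda>x. ip x y)"
proof (rule bounded_linear_intro)
  show "ip (a + b) y = ip a y + ip b y" for a b by (rule ip_add_left)
  show "ip (r *\<^sub>R a) y = r *\<^sub>R ip a y" for r a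
    by (simp add: scaleR_eq_cmul ip_cmul_left scaleR_conv_of_real)
  show "norm (ip a y) \<le> norm a * norm y" for a by (rule norm_ip_le)
qed

lemma bounded_linear_ip_right: "bounded_linear (\<lambda>y. ip x y)"
proof (rule bounded_linear_intro)
  show "ip x (a + b) = ip x a + ip x b" for a b by (rule ip_add_right)
  show "ip x (r *\<^sub>R a) = r *\<^sub>R ip x a" for r a
    by (simp add: scaleR_eq_cmul ip_cmul_right scaleR_conv_of_real)
  show "norm (ip x a) \<le> norm a * norm x" for a using norm_ip_le[of x a] by (simp add: mult.commute)
qed

text \<open>\<open>bounded_linear\<close> means linearity over the reals; the second conjunct adds
  the complex scalars.\<close>

definition bclin :: "(l2 \<Rightarrow> l2) \<Rightarrow> bool" where
  "bclin T \<longleftrightarrow> bounded_linear T \<and> (\<forall>c x. T (cmul c x) = cmul c (T x))"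

lemma bclinI:
  assumes "\<And>x y. T (x + y) = T x + T y" "\<And>c x. T (cmul c x) = cmul c (T x)"
    and "\<And>x. norm (T x) \<le> K * norm x"
  shows "bclin T"
  unfolding bclin_def
proof (intro conjI allI)
  show "bounded_linear T"
    by (rule bounded_linear_intro[of _ K]) (use assms in \<open>auto simp: scaleR_eq_cmul mult.commute\<close>)
qed (rule assms)

lemma bclin_bounded_linear: "bclin T \<Longrightarrow> bounded_linear T"
  by (simp add: bclin_def)

lemma bclin_cmul: "bclin T \<Longrightarrow> T (cmul c x) = cmul c (T x)"
  by (simp add: bclin_def)

lemma bclin_add: "bclin T \<Longrightarrow> T (x + y) = T x + T y"
  by (simp add: bclin_def linear_simps)

lemma bclin_diff: "bclin T \<Longrightarrow> T (x - y) = T x - T y"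
  by (simp add: bclin_def linear_simps)

lemma bclin_0: "bclin T \<Longrightarrow> T 0 = 0"
  by (simp add: bclin_def linear_simps)

lemma bclin_tendsto: "bclin T \<Longrightarrow> (f \<longlongrightarrow> x) F \<Longrightarrow> ((\<lambda>i. T (f i)) \<longlongrightarrow> T x) F"
  by (auto dest: bclin_bounded_linear intro: bounded_linear.tendsto)

lemma bclin_continuous: "bclin T \<Longrightarrow> continuous_on S T"
  by (auto dest: bclin_bounded_linear intro: linear_continuous_on)

lemma bclin_compose: "bclin S \<Longrightarrow> bclin T \<Longrightarrow> bclin (\<lambda>x. S (T x))"
  using bounded_linear_compose[of S T] by (simp add: bclin_def o_def)

lemma bclin_plus: "bclin S \<Longrightarrow> bclin T \<Longrightarrow> bclin (\<lambda>x. S x + T x)"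
  using bounded_linear_add[of S T] by (simp add: bclin_def cmul_add_right)

lemma bclin_minus: "bclin S \<Longrightarrow> bclin T \<Longrightarrow> bclin (\<lambda>x. S x - T x)"
  using bounded_linear_sub[of S T] by (simp add: bclin_def cmul_diff_right)

lemma bclin_id: "bclin (\<lambda>x. x)"
  by (simp add: bclin_def)

lemma bclin_cmulI: "bclin (cmul c)"
  by (rule bclinI[of _ "cmod c"]) (auto simp: cmul_add_right norm_cmul mult.commute)

text \<open>Polarisation on \<open>x + y\<close> gives the real part; complex linearity moves the
  factor \<i> through \<open>T\<close> and gives the imaginary part.\<close>

lemma bclin_isometry_ip:
  assumes "bclin T" "\<And>x. norm (T x) = norm x"
  shows "ip (T x) (T y) = ip x y"
proof -
  have r: "inner (T x) (T y) = inner x y" for x y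
    using assms(2)[of "x + y"] assms(2)[of x] assms(2)[of y]
    unfolding bclin_add[OF assms(1)] norm_eq_sqrt_inner
    by (simp add: inner_add_left inner_add_right inner_commute)
  show ?thesis
    unfolding ip_eq_Complex bclin_cmul[OF assms(1), symmetric] r ..
qed

lemma bclin_isometryI:
  assumes "\<And>x y. T (x + y) = T x + T y" "\<And>c x. T (cmul c x) = cmul c (T x)"
    and "\<And>x. norm (T x) = norm x"
  shows "bclin T"
  by (rule bclinI[of _ 1]) (use assms in auto)

subsection \<open>Complex spans\<close>

text \<open>The complex span is written as a real span of all complex multiples, so that the theory
  of \<open>span\<close> applies.\<close>

definition cspan :: "l2 set \<Rightarrow> l2 set" where
  "cspan S = span {cmul c x |c x. x \<in> S}"

lemma cspan_base: "x \<in> S \<Longrightarrow> x \<in> cspan S"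
  unfolding cspan_def by (rule span_base) (use cmul_1[of x, symmetric] in blast)

lemma cspan_add: "x \<in> cspan S \<Longrightarrow> y \<in> cspan S \<Longrightarrow> x + y \<in> cspan S"
  unfolding cspan_def by (rule span_add)

lemma cspan_diff: "x \<in> cspan S \<Longrightarrow> y \<in> cspan S \<Longrightarrow> x - y \<in> cspan S"
  unfolding cspan_def by (rule span_diff)

lemma cspan_0: "0 \<in> cspan S"
  unfolding cspan_def by (rule span_zero)

lemma cspan_induct [consumes 1, case_names zero add]:
  assumes "x \<in> cspan S" "P 0" "\<And>c x y. x \<in> S \<Longrightarrow> y \<in> cspan S \<Longrightarrow> P y \<Longrightarrow> P (cmul c x + y)"
  shows "P x"
proof -
  have "x \<in> cspan S \<and> P x"
    using assms(1) unfolding cspan_def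
  proof (induction rule: span_induct_alt)
    case base
    then show ?case using assms(2) by (simp add: span_zero)
  next
    case (step r z y)
    then obtain c x where z: "z = cmul c x" "x \<in> S" by auto
    have "r *\<^sub>R z = cmul (complex_of_real r * c) x"
      by (simp add: z scaleR_eq_cmul)
    moreover have "cmul (complex_of_real r * c) x \<in> span {cmul c x |c x. x \<in> S}"
      using z(2) by (intro span_base) blast
    ultimately show ?case
      using step z assms(3)[of x y "complex_of_real r * c"] by (simp add: cspan_def span_add)
  qed
  then show ?thesis by simp
qed

lemma cspan_cmul: "x \<in> cspan S \<Longrightarrow> cmul c x \<in> cspan S"
proof (induction rule: cspan_induct)
  case (add d x y)
  have "cmul (c * d) x \<in> cspan S"
    unfolding cspan_def by (rule span_base) (use add in auto)
  with add show ?case by (simp add: cmul_add_right cspan_add)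
qed (simp add: cspan_0)

lemma closure_cspan_add:
  assumes "x \<in> closure (cspan S)" "y \<in> closure (cspan S)"
  shows "x + y \<in> closure (cspan S)"
proof -
  obtain X Y where X: "\<And>n. X n \<in> cspan S" "X \<longlonglongrightarrow> x" and Y: "\<And>n. Y n \<in> cspan S" "Y \<longlonglongrightarrow> y"
    using assms unfolding closure_sequential by metis
  then show ?thesis
    unfolding closure_sequential
    by (intro exI[of _ "\<lambda>n. X n + Y n"] conjI allI cspan_add tendsto_add)
qed

lemma closure_cspan_cmul:
  assumes "x \<in> closure (cspan S)"
  shows "cmul c x \<in> closure (cspan S)"
proof -
  obtain X where X: "\<And>n. X n \<in> cspan S" "X \<longlonglongrightarrow> x"
    using assms unfolding closure_sequential by metis
  then show ?thesis
    unfolding closure_sequential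
    by (intro exI[of _ "\<lambda>n. cmul c (X n)"] conjI allI cspan_cmul bclin_tendsto[OF bclin_cmulI])
qed

lemma closure_cspan_0: "0 \<in> closure (cspan S)"
  using cspan_0 closure_subset by blast

lemma closure_cspan_base: "x \<in> S \<Longrightarrow> x \<in> closure (cspan S)"
  using cspan_base closure_subset by blast

lemma closure_cspan_sum: "(\<And>i. i \<in> I \<Longrightarrow> f i \<in> closure (cspan S)) \<Longrightarrow> (\<Sum>i\<in>I. f i) \<in> closure (cspan S)"
  by (induction I rule: infinite_finite_induct) (auto simp: closure_cspan_0 closure_cspan_add)

lemma closure_cspan_tendsto:
  "(\<And>n::nat. f n \<in> closure (cspan S)) \<Longrightarrow> f \<longlonglongrightarrow> x \<Longrightarrow> x \<in> closure (cspan S)"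
  by (rule closed_sequentially[OF closed_closure]) auto

lemma closure_cspan_image:
  assumes "x \<in> closure (cspan S)" "bclin T" "\<And>y. y \<in> S \<Longrightarrow> T y \<in> closure (cspan S')"
  shows "T x \<in> closure (cspan S')"
proof -
  have *: "T y \<in> closure (cspan S')" if "y \<in> cspan S" for y
    using that
    by (induction rule: cspan_induct)
       (auto simp: bclin_0 bclin_add bclin_cmul assms closure_cspan_0 closure_cspan_add closure_cspan_cmul)
  show ?thesis
    using image_closure_subset[OF bclin_continuous[OF assms(2)] closed_closure, of "cspan S" "cspan S'"]
      assms(1) * by auto
qed

text \<open>The difference of \<open>T\<close> and \<open>U\<close> sends the generators to 0, hence
  the closed span into the closed span of the empty set, which is trivial.\<close>

lemma closure_cspan_eqI:
  assumes "x \<in> closure (cspan S)" "bclin T" "bclin U" "\<And>y. y \<in> S \<Longrightarrow> T y = U y"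
  shows "T x = U x"
proof -
  have "T x - U x \<in> closure (cspan {})"
    by (rule closure_cspan_image[OF assms(1) bclin_minus[OF assms(2,3)]])
       (simp add: assms(4) closure_cspan_0)
  then show ?thesis by (simp add: cspan_def)
qed

lemma closure_cspan_orthogonal:
  assumes "x \<in> closure (cspan S)" "\<And>y. y \<in> S \<Longrightarrow> ip z y = 0"
  shows "ip z x = 0"
proof -
  have "ip z y = 0" if "y \<in> cspan S" for y
    using that by (induction rule: cspan_induct) (auto simp: ip_add_right ip_cmul_right assms(2))
  then have "ip z ` closure (cspan S) \<subseteq> {0}"
    by (intro image_closure_subset linear_continuous_on bounded_linear_ip_right) auto
  then show ?thesis using assms(1) by auto
qed

lemma closure_cspan_orthogonal_zero:
  assumes "x \<in> closure (cspan S)" "\<And>y. y \<in> S \<Longrightarrow> ip x y = 0"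
  shows "x = 0"
  using closure_cspan_orthogonal[OF assms] by (simp add: ip_norm)

text \<open>\<open>T\<close> is prescribed on the span alone and may be arbitrary elsewhere.
  Linearity there makes it isometric on differences, hence uniformly continuous; the continuous
  extension inherits additivity, homogeneity and the norm along sequences from the span.\<close>

lemma isometric_extension:
  assumes dense: "closure (cspan S) = UNIV"
    and add: "\<And>x y. x \<in> cspan S \<Longrightarrow> y \<in> cspan S \<Longrightarrow> T (x + y) = T x + T y"
    and cmul: "\<And>c x. x \<in> cspan S \<Longrightarrow> T (cmul c x) = cmul c (T x)"
    and norm: "\<And>x. x \<in> cspan S \<Longrightarrow> norm (T x) = norm x"
  obtains U where "bclin U" "\<And>x. norm (U x) = norm x" "\<And>x. x \<in> cspan S \<Longrightarrow> U x = T x"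
proof -
  have diff: "T (x - y) = T x - T y" if "x \<in> cspan S" "y \<in> cspan S" for x y
    using add[OF that(1) cspan_cmul[OF that(2), of "-1"]] cmul[OF that(2), of "-1"]
    by (simp only: diff_eq_cmul)
  have "uniformly_continuous_on (cspan S) T"
    unfolding uniformly_continuous_on_def dist_norm
  proof (intro allI impI)
    fix e :: real assume "0 < e"
    moreover have "norm (T x - T y) = norm (x - y)" if "x \<in> cspan S" "y \<in> cspan S" for x y
      using norm[OF cspan_diff[OF that]] diff[OF that] by simp
    ultimately show "\<exists>d>0. \<forall>x\<in>cspan S. \<forall>x'\<in>cspan S. norm (x' - x) < d \<longrightarrow> norm (T x' - T x) < e"
      by auto
  qed
  from uniformly_continuous_on_extension_on_closure[OF this]
  obtain U where U: "uniformly_continuous_on UNIV U" "\<And>x. x \<in> cspan S \<Longrightarrow> T x = U x"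
    unfolding dense by metis
  have cont: "continuous_on UNIV U"
    by (rule uniformly_continuous_imp_continuous[OF U(1)])
  have lim: "(\<lambda>n. U (X n)) \<longlonglongrightarrow> U x" if "X \<longlonglongrightarrow> x" for X x
    using continuous_on_tendsto_compose[OF cont that] by simp
  have ex: "\<exists>X. (\<forall>n. X n \<in> cspan S) \<and> X \<longlonglongrightarrow> x" for x
    using dense closure_sequential[of x "cspan S"] by auto
  have "U (x + y) = U x + U y" for x y
  proof -
    obtain X Y where X: "\<And>n. X n \<in> cspan S" "X \<longlonglongrightarrow> x" and Y: "\<And>n. Y n \<in> cspan S" "Y \<longlonglongrightarrow> y"
      using ex by metis
    have "(\<lambda>n. U (X n + Y n)) \<longlonglongrightarrow> U (x + y)"
      by (intro lim tendsto_add X Y)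
    moreover have "U (X n + Y n) = U (X n) + U (Y n)" for n
      using add[OF X(1) Y(1)] U(2) X(1) Y(1) cspan_add by metis
    ultimately show ?thesis
      using tendsto_add[OF lim[OF X(2)] lim[OF Y(2)]] by (simp add: LIMSEQ_unique)
  qed
  moreover have "U (cmul c x) = cmul c (U x)" for c x
  proof -
    obtain X where X: "\<And>n. X n \<in> cspan S" "X \<longlonglongrightarrow> x" using ex by metis
    have "(\<lambda>n. U (cmul c (X n))) \<longlonglongrightarrow> U (cmul c x)"
      by (intro lim bclin_tendsto[OF bclin_cmulI] X)
    moreover have "U (cmul c (X n)) = cmul c (U (X n))" for n
      using cmul[OF X(1)] U(2) X(1) cspan_cmul by metis
    ultimately show ?thesis
      using bclin_tendsto[OF bclin_cmulI lim[OF X(2)]] by (simp add: LIMSEQ_unique)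
  qed
  moreover have "norm (U x) = norm x" for x
  proof -
    obtain X where X: "\<And>n. X n \<in> cspan S" "X \<longlonglongrightarrow> x" using ex by metis
    have "norm (U (X n)) = norm (X n)" for n
      using norm[OF X(1)] U(2)[OF X(1)] by metis
    then show ?thesis
      using tendsto_norm[OF lim[OF X(2)]] tendsto_norm[OF X(2)] by (simp add: LIMSEQ_unique)
  qed
  ultimately show ?thesis
    using that[of U] U(2) bclin_isometryI[of U] by simp
qed

section \<open>Multiplication by bounded functions, and norm limits from pointwise limits\<close>

subsection \<open>Multiplication operators and dominated convergence\<close>

definition bdd_meas :: "(real \<Rightarrow> complex) \<Rightarrow> bool" where
  "bdd_meas m \<longleftrightarrow> m \<in> borel_measurable borel \<and> (\<exists>C. \<forall>t. cmod (m t) \<le> C)"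

definition mlt :: "(real \<Rightarrow> complex) \<Rightarrow> l2 \<Rightarrow> l2" where
  "mlt m x = cls (\<lambda>t. m t * rep x t)"

lemma bdd_meas_measurable [measurable_dest]: "bdd_meas m \<Longrightarrow> m \<in> borel_measurable borel"
  by (simp add: bdd_meas_def)

lemma bdd_meas_mult: "bdd_meas m \<Longrightarrow> bdd_meas n \<Longrightarrow> bdd_meas (\<lambda>t. m t * n t)"
  unfolding bdd_meas_def
proof safe
  fix C D assume "\<forall>t. cmod (m t) \<le> C" "\<forall>t. cmod (n t) \<le> D"
  then have "cmod (m t * n t) \<le> C * D" for t
    unfolding norm_mult by (intro mult_mono) (auto intro: order_trans[OF norm_ge_zero])
  then show "\<exists>C. \<forall>t. cmod (m t * n t) \<le> C" by blast
qed auto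

lemma bdd_meas_indicator [simp]: "A \<in> sets borel \<Longrightarrow> bdd_meas (indicator A)"
  unfolding bdd_meas_def by (auto intro!: exI[of _ 1] simp: indicator_def)

lemma L2_fun_mlt:
  assumes "bdd_meas m" "f \<in> L2_fun lborel"
  shows "(\<lambda>t. m t * f t) \<in> L2_fun lborel"
proof -
  have [measurable]: "f \<in> borel_measurable borel"
    using L2_fun_measurable[OF assms(2)] by simp
  obtain C where "\<And>t. cmod (m t) \<le> C"
    using assms(1) by (auto simp: bdd_meas_def)
  then show ?thesis
    using assms by (intro L2_fun_bound[OF assms(2), of _ C]) (auto simp: norm_mult intro!: mult_right_mono)
qed

lemma mlt_cls: "f \<in> L2_fun lborel \<Longrightarrow> mlt m (cls f) = cls (\<lambda>t. m t * f t)"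
  unfolding mlt_def by (rule cls_cong) (use rep_cls in fastforce)

lemma mlt_mlt: "bdd_meas m \<Longrightarrow> bdd_meas n \<Longrightarrow> mlt m (mlt n x) = mlt (\<lambda>t. m t * n t) x"
  by (rule l2_cases[of x]) (simp add: mlt_cls L2_fun_mlt mult.assoc)

lemma mlt_add_mlt: "bdd_meas m \<Longrightarrow> bdd_meas n \<Longrightarrow> mlt m x + mlt n x = mlt (\<lambda>t. m t + n t) x"
  by (rule l2_cases[of x]) (simp add: mlt_cls L2_fun_mlt plus_cls distrib_right)

lemma norm_mlt_le:
  assumes "bdd_meas m" "\<And>t. cmod (m t) \<le> C"
  shows "norm (mlt m x) \<le> C * norm x"
proof -
  have C: "0 \<le> C" using assms(2)[of 0] norm_ge_zero order_trans by blast
  have "(\<integral>\<^sup>+t. ennreal ((cmod (m t * rep x t))\<^sup>2) \<partial>lborel) \<le> (\<integral>\<^sup>+t. ennreal (C\<^sup>2) * ennreal ((cmod (rep x t))\<^sup>2) \<partial>lborel)"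
  proof (rule nn_integral_mono)
    fix t
    have "(cmod (m t * rep x t))\<^sup>2 \<le> (C * cmod (rep x t))\<^sup>2"
      unfolding norm_mult by (intro power_mono mult_right_mono assms(2)) auto
    then show "ennreal ((cmod (m t * rep x t))\<^sup>2) \<le> ennreal (C\<^sup>2) * ennreal ((cmod (rep x t))\<^sup>2)"
      by (simp add: power_mult_distrib flip: ennreal_mult)
  qed
  also have "\<dots> = ennreal (C\<^sup>2) * ennreal ((norm x)\<^sup>2)"
    by (subst nn_integral_cmult) (auto simp: norm_rep_nn)
  also have "\<dots> = ennreal ((C * norm x)\<^sup>2)"
    by (simp add: power_mult_distrib flip: ennreal_mult)
  finally show ?thesis
    unfolding mlt_def using C assms(1) by (intro norm_cls_le) auto
qed

lemma bclin_mlt: "bdd_meas m \<Longrightarrow> bclin (mlt m)"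
proof -
  assume m: "bdd_meas m"
  then obtain C where "\<And>t. cmod (m t) \<le> C"
    by (auto simp: bdd_meas_def)
  then show ?thesis
  proof (intro bclinI)
    show "mlt m (x + y) = mlt m x + mlt m y" for x y
      by (rule l2_cases[of x], rule l2_cases[of y])
         (simp add: mlt_cls L2_fun_mlt[OF m] plus_cls L2_fun_add distrib_left)
    show "mlt m (cmul c x) = cmul c (mlt m x)" for c x
      by (rule l2_cases[of x])
         (simp add: mlt_cls L2_fun_mlt[OF m] cmul_cls L2_fun_cmult mult.left_commute)
    show "norm (mlt m x) \<le> C * norm x" for x
      by (rule norm_mlt_le) fact+
  qed
qed

lemma ip_mlt:
  assumes "bdd_meas m"
  shows "ip (mlt m x) y = ip x (mlt (\<lambda>t. cnj (m t)) y)"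
proof -
  have m: "bdd_meas (\<lambda>t. cnj (m t))"
    using assms by (auto simp: bdd_meas_def)
  have "ip (mlt m x) y = ip (mlt m x) (cls (rep y))" by simp
  also have "\<dots> = (LINT t|lborel. m t * rep x t * cnj (rep y t))"
    unfolding mlt_def by (rule ip_cls) (simp_all add: L2_fun_mlt assms)
  also have "\<dots> = (LINT t|lborel. rep x t * cnj (cnj (m t) * rep y t))"
    by (simp add: ac_simps)
  also have "\<dots> = ip (cls (rep x)) (mlt (\<lambda>t. cnj (m t)) y)"
    unfolding mlt_def by (rule ip_cls[symmetric]) (simp_all add: L2_fun_mlt m)
  finally show ?thesis by simp
qed

text \<open>The limit is bounded by \<open>w\<close> as well, so the squares of the differences are
  dominated by the integrable function (2 |w|)^2.\<close>

lemma l2_dominated_convergence: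
  assumes w: "w \<in> L2_fun lborel"
    and f [measurable]: "\<And>n. f n \<in> borel_measurable borel" "g \<in> borel_measurable borel"
    and le: "\<And>n::nat. AE t in lborel. cmod (f n t) \<le> cmod (w t)"
    and lim: "AE t in lborel. (\<lambda>n. f n t) \<longlonglongrightarrow> g t"
  shows "(\<lambda>n. cls (f n)) \<longlonglongrightarrow> cls g" and "g \<in> L2_fun lborel"
proof -
  have [measurable]: "w \<in> borel_measurable borel"
    using L2_fun_measurable[OF w] by simp
  have fn: "f n \<in> L2_fun lborel" for n
    by (rule L2_fun_bound[OF w, of _ 1]) (use le in auto)
  have le2: "AE t in lborel. \<forall>n. cmod (f n t) \<le> cmod (w t)"
    using le by (simp add: AE_all_countable)
  have gw: "AE t in lborel. cmod (g t) \<le> cmod (w t)"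
    using le2 lim
  proof eventually_elim
    case (elim t)
    then show ?case
      by (intro LIMSEQ_le_const2[OF tendsto_norm]) auto
  qed
  show g: "g \<in> L2_fun lborel"
    by (rule L2_fun_bound[OF w, of _ 1]) (use gw in auto)
  have "(\<lambda>n. LINT t|lborel. (cmod (f n t - g t))\<^sup>2) \<longlonglongrightarrow> (LINT t|(lborel :: real measure). 0)"
  proof (rule integral_dominated_convergence[where w = "\<lambda>t. (2 * cmod (w t))\<^sup>2"])
    show "integrable lborel (\<lambda>t. (2 * cmod (w t))\<^sup>2)"
      using w by (simp add: L2_fun_def power_mult_distrib)
    show "AE t in lborel. (\<lambda>n. (cmod (f n t - g t))\<^sup>2) \<longlonglongrightarrow> 0"
      using lim
    proof eventually_elim
      case (elim t)
      have "(\<lambda>n. (cmod (f n t - g t))\<^sup>2) \<longlonglongrightarrow> (cmod (g t - g t))\<^sup>2"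
        by (intro tendsto_intros elim)
      then show ?case by simp
    qed
    show "AE t in lborel. norm ((cmod (f n t - g t))\<^sup>2) \<le> (2 * cmod (w t))\<^sup>2" for n
      using le[of n] gw
    proof eventually_elim
      case (elim t)
      then have "cmod (f n t - g t) \<le> 2 * cmod (w t)"
        using norm_triangle_ineq4[of "f n t" "g t"] by linarith
      from power_mono[OF this, of 2] show ?case by simp
    qed
  qed auto
  then have "(\<lambda>n. sqrt (LINT t|lborel. (cmod (f n t - g t))\<^sup>2)) \<longlonglongrightarrow> sqrt 0"
    by (intro tendsto_real_sqrt) simp
  then have "(\<lambda>n. norm (cls (f n) - cls g)) \<longlonglongrightarrow> 0"
    by (simp add: minus_cls fn g norm_cls L2_fun_diff)
  then show "(\<lambda>n. cls (f n)) \<longlonglongrightarrow> cls g"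
    by (simp add: tendsto_norm_zero_iff LIM_zero_cancel)
qed

section \<open>Operators of the form f to J (f o \<phi>) as partial isometries\<close>

section \<open>Weighted composition operators\<close>

text \<open>The equation of measures says that multiplying \<open>f o \<phi>\<close> by
  \<open>J\<close> is a partial isometry from L2 of \<open>M\<close> to L2 of \<open>N\<close> whose
  initial space consists of the functions living on \<open>S\<close>. This one notion covers
  substitutions on the line, restrictions to subsets and the passage to the circle.\<close>

definition weighted_comp ::
    "'a measure \<Rightarrow> 'b measure \<Rightarrow> ('a \<Rightarrow> complex) \<Rightarrow> ('a \<Rightarrow> 'b) \<Rightarrow> 'b set \<Rightarrow> bool" where
  "weighted_comp N M J \<phi> S \<longleftrightarrow> J \<in> borel_measurable N \<and> \<phi> \<in> measurable N M \<and> S \<in> sets M \<and>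
     distr (density N (\<lambda>u. ennreal ((cmod (J u))\<^sup>2))) M \<phi> = density M (indicator S)"

lemma weighted_compD:
  assumes "weighted_comp N M J \<phi> S"
  shows "J \<in> borel_measurable N" "\<phi> \<in> measurable N M" "S \<in> sets M"
    "distr (density N (\<lambda>u. ennreal ((cmod (J u))\<^sup>2))) M \<phi> = density M (indicator S)"
  using assms by (auto simp: weighted_comp_def)

lemma weighted_comp_nn_integral:
  assumes W: "weighted_comp N M J \<phi> S" and [measurable]: "g \<in> borel_measurable M"
  shows "(\<integral>\<^sup>+u. ennreal ((cmod (J u))\<^sup>2) * g (\<phi> u) \<partial>N) = (\<integral>\<^sup>+x. indicator S x * g x \<partial>M)"
proof -
  note [measurable] = weighted_compD(1-3)[OF W]
  have "(\<integral>\<^sup>+u. ennreal ((cmod (J u))\<^sup>2) * g (\<phi> u) \<partial>N)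
      = (\<integral>\<^sup>+x. g x \<partial>distr (density N (\<lambda>u. ennreal ((cmod (J u))\<^sup>2))) M \<phi>)"
    by (simp add: nn_integral_distr nn_integral_density)
  also have "\<dots> = (\<integral>\<^sup>+x. indicator S x * g x \<partial>M)"
    unfolding weighted_compD(4)[OF W] by (simp add: nn_integral_density)
  finally show ?thesis .
qed

text \<open>The preimage of a null set under \<open>\<phi>\<close> can have positive measure, but
  only inside the zero set of \<open>J\<close>, where the weighted composition does not see
  it.\<close>

lemma weighted_comp_AE:
  assumes W: "weighted_comp N M J \<phi> S" and P: "AE x in M. P x"
  shows "AE u in N. J u \<noteq> 0 \<longrightarrow> P (\<phi> u)"
proof -
  note [measurable] = weighted_compD(1-3)[OF W]
  obtain A where A: "A \<in> null_sets M" "{x \<in> space M. \<not> P x} \<subseteq> A"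
    using P by (auto simp: eventually_ae_filter)
  note [measurable] = null_setsD2[OF A(1)]
  have "AE x in M. x \<notin> A" by (rule AE_not_in[OF A(1)])
  then have "(\<integral>\<^sup>+x. indicator S x * indicator A x \<partial>M) = (\<integral>\<^sup>+x. 0 \<partial>M)"
    by (intro nn_integral_cong_AE) auto
  then have "(\<integral>\<^sup>+u. ennreal ((cmod (J u))\<^sup>2) * indicator A (\<phi> u) \<partial>N) = 0"
    by (subst weighted_comp_nn_integral[OF W]) auto
  then have "AE u in N. ennreal ((cmod (J u))\<^sup>2) * indicator A (\<phi> u) = 0"
    by (subst (asm) nn_integral_0_iff_AE) auto
  moreover have "AE u in N. \<phi> u \<in> space M"
    using measurable_space[OF weighted_compD(2)[OF W]] by (intro AE_I2)
  ultimately show ?thesis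
  proof eventually_elim
    case (elim u)
    then show ?case using A(2) by (auto simp: indicator_def split: if_splits)
  qed
qed

lemma weighted_comp_cong:
  assumes "weighted_comp N M J \<phi> S" "AE x in M. f x = g x"
  shows "AE u in N. J u * f (\<phi> u) = J u * g (\<phi> u)"
  using weighted_comp_AE[OF assms] by auto

lemma weighted_comp_L2:
  assumes W: "weighted_comp N M J \<phi> S" and f: "f \<in> L2_fun M"
  shows "(\<lambda>u. J u * f (\<phi> u)) \<in> L2_fun N"
    and "(\<integral>\<^sup>+u. ennreal ((cmod (J u * f (\<phi> u)))\<^sup>2) \<partial>N) = (\<integral>\<^sup>+x. indicator S x * ennreal ((cmod (f x))\<^sup>2) \<partial>M)"
proof -
  note [measurable] = weighted_compD(1-3)[OF W] L2_fun_measurable[OF f]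
  show *: "(\<integral>\<^sup>+u. ennreal ((cmod (J u * f (\<phi> u)))\<^sup>2) \<partial>N) = (\<integral>\<^sup>+x. indicator S x * ennreal ((cmod (f x))\<^sup>2) \<partial>M)"
    by (simp add: norm_mult power_mult_distrib ennreal_mult weighted_comp_nn_integral[OF W, symmetric])
  also have "\<dots> \<le> (\<integral>\<^sup>+x. ennreal ((cmod (f x))\<^sup>2) \<partial>M)"
    by (intro nn_integral_mono) (auto simp: indicator_def)
  also have "\<dots> < \<infinity>"
    using f by (simp add: L2_fun_iff_nn_integral)
  finally show "(\<lambda>u. J u * f (\<phi> u)) \<in> L2_fun N"
    unfolding L2_fun_iff_nn_integral by (auto intro!: borel_measurable_times measurable_compose[OF weighted_compD(2)[OF W]])
qed

lemma weighted_comp_integral: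
  assumes W: "weighted_comp N M J \<phi> S" and [measurable]: "h \<in> borel_measurable M"
  shows "(LINT u|N. (J u * cnj (J u)) * h (\<phi> u)) = (LINT x|M. indicator S x * h x :: complex)"
proof -
  note [measurable] = weighted_compD(1-3)[OF W]
  have "(LINT u|N. (J u * cnj (J u)) * h (\<phi> u)) = (LINT u|N. (cmod (J u))\<^sup>2 *\<^sub>R h (\<phi> u))"
    unfolding complex_norm_square[symmetric] scaleR_conv_of_real ..
  also have "\<dots> = (LINT x|distr (density N (\<lambda>u. ennreal ((cmod (J u))\<^sup>2))) M \<phi>. h x)"
    by (simp add: integral_distr integral_density)
  also have "\<dots> = (LINT x|density M (\<lambda>x. ennreal (indicator S x)). h x)"
    unfolding weighted_compD(4)[OF W] by (simp add: ennreal_indicator)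
  also have "\<dots> = (LINT x|M. indicator S x *\<^sub>R h x)"
    by (rule integral_density) auto
  finally show ?thesis
    by (simp add: scaleR_conv_of_real of_real_indicator)
qed

definition wc :: "(real \<Rightarrow> complex) \<Rightarrow> (real \<Rightarrow> real) \<Rightarrow> l2 \<Rightarrow> l2" where
  "wc J \<phi> x = cls (\<lambda>u. J u * rep x (\<phi> u))"

abbreviation wcomp :: "(real \<Rightarrow> complex) \<Rightarrow> (real \<Rightarrow> real) \<Rightarrow> real set \<Rightarrow> bool" where
  "wcomp \<equiv> weighted_comp lborel lborel"

lemma wc_cls: "wcomp J \<phi> S \<Longrightarrow> f \<in> L2_fun lborel \<Longrightarrow> wc J \<phi> (cls f) = cls (\<lambda>u. J u * f (\<phi> u))"
  unfolding wc_def by (rule cls_cong, rule weighted_comp_cong, assumption, rule rep_cls)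

lemma norm_wc:
  assumes W: "wcomp J \<phi> S"
  shows "norm (wc J \<phi> x) = norm (mlt (indicator S) x)"
proof -
  have S: "S \<in> sets borel" using weighted_compD(3)[OF W] by simp
  have "ennreal ((norm (wc J \<phi> x))\<^sup>2) = (\<integral>\<^sup>+t. indicator S t * ennreal ((cmod (rep x t))\<^sup>2) \<partial>lborel)"
    unfolding wc_def by (simp add: norm_cls_nn weighted_comp_L2[OF W])
  also have "\<dots> = (\<integral>\<^sup>+t. ennreal ((cmod (indicator S t * rep x t))\<^sup>2) \<partial>lborel)"
    by (intro nn_integral_cong) (auto simp: indicator_def)
  also have "\<dots> = ennreal ((norm (mlt (indicator S) x))\<^sup>2)"
    unfolding mlt_def by (simp add: norm_cls_nn L2_fun_mlt S)
  finally show ?thesis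
    by (simp add: power2_eq_iff_nonneg)
qed

lemma bclin_wc:
  assumes W: "wcomp J \<phi> S"
  shows "bclin (wc J \<phi>)"
proof (rule bclinI)
  show "wc J \<phi> (x + y) = wc J \<phi> x + wc J \<phi> y" for x y
    by (rule l2_cases[of x], rule l2_cases[of y])
       (simp add: wc_cls[OF W] weighted_comp_L2[OF W] plus_cls L2_fun_add distrib_left)
  show "wc J \<phi> (cmul c x) = cmul c (wc J \<phi> x)" for c x
    by (rule l2_cases[of x])
       (simp add: wc_cls[OF W] weighted_comp_L2[OF W] cmul_cls L2_fun_cmult mult.left_commute)
  have S: "S \<in> sets borel" using weighted_compD(3)[OF W] by simp
  show "norm (wc J \<phi> x) \<le> 1 * norm x" for x
    unfolding norm_wc[OF W] by (rule norm_mlt_le) (auto simp: S indicator_def)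
qed

lemma wc_wc:
  assumes "wcomp J \<phi> S" "wcomp K \<psi> T"
  shows "wc J \<phi> (wc K \<psi> x) = cls (\<lambda>u. J u * K (\<phi> u) * rep x (\<psi> (\<phi> u)))"
  by (subst (2) wc_def) (simp add: wc_cls[OF assms(1)] weighted_comp_L2[OF assms(2)] mult.assoc)

lemma wc_inverse:
  assumes "wcomp J \<phi> S" "wcomp K \<psi> T"
    and "\<And>u. u \<in> R \<Longrightarrow> J u * K (\<phi> u) = 1 \<and> \<psi> (\<phi> u) = u" "\<And>u. u \<notin> R \<Longrightarrow> J u * K (\<phi> u) = 0"
  shows "wc J \<phi> (wc K \<psi> x) = mlt (indicator R) x"
  unfolding wc_wc[OF assms(1,2)] mlt_def
  by (rule cls_cong[OF AE_I2]) (use assms(3,4) in \<open>auto simp: indicator_def\<close>)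

subsection \<open>Change of variables\<close>

text \<open>\<open>B\<close> lies in a bounded interval so that its indicator is integrable, as the
  substitution theorem for absolutely integrable functions requires. That theorem speaks of the
  completed measure; \<open>integral_completion\<close> returns to \<open>lborel\<close>.\<close>

lemma nn_integral_change_of_variables_indicator:
  fixes g g' :: "real \<Rightarrow> real"
  assumes [measurable]: "S \<in> sets borel" "g \<in> borel_measurable borel" "g' \<in> borel_measurable borel"
    and [measurable]: "g ` S \<in> sets borel" "B \<in> sets borel"
    and der: "\<And>x. x \<in> S \<Longrightarrow> (g has_real_derivative g' x) (at x)" and inj: "inj_on g S"
    and B: "B \<subseteq> {-real n..real n}"
  shows "(\<integral>\<^sup>+x. ennreal (indicator S x * (\<bar>g' x\<bar> * indicator B (g x))) \<partial>lborel) = emeasure lborel (B \<inter> g ` S)"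
proof -
  have "emeasure lborel (B \<inter> g ` S) \<le> emeasure lborel {-real n..real n}"
    using B by (intro emeasure_mono) auto
  also have "\<dots> < \<infinity>" by simp
  finally have fin: "emeasure lborel (B \<inter> g ` S) < \<infinity>" .
  have eq: "indicator (g ` S) y *\<^sub>R indicator B y = (indicator (B \<inter> g ` S) y :: real)" for y
    by (auto simp: indicator_def)
  have int: "integrable lborel (\<lambda>y. indicator (g ` S) y *\<^sub>R (indicator B y :: real))"
    unfolding eq using fin by (intro integrable_real_indicator) auto
  then have abs: "(\<lambda>y. indicator B y :: real) absolutely_integrable_on g ` S"
    unfolding set_integrable_def by (subst integrable_completion) auto
  define b where "b = integral (g ` S) (\<lambda>y. indicator B y :: real)"
  have "S \<in> sets lebesgue" using assms(1) by auto
  from has_absolute_integral_change_of_variables_1'[OF this DERIV_subset[OF der subset_UNIV] inj, of "indicator B" b]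
  have 1: "(\<lambda>x. \<bar>g' x\<bar> * indicator B (g x)) absolutely_integrable_on S"
    "integral S (\<lambda>x. \<bar>g' x\<bar> * indicator B (g x)) = b"
    using abs by (auto simp: b_def)
  have 2: "integrable lborel (\<lambda>x. indicator S x *\<^sub>R (\<bar>g' x\<bar> * indicator B (g x)))"
    using 1(1) unfolding set_integrable_def by (subst (asm) integrable_completion) auto
  have "(\<integral>\<^sup>+x. ennreal (indicator S x *\<^sub>R (\<bar>g' x\<bar> * indicator B (g x))) \<partial>lborel)
      = ennreal (LINT x|lborel. indicator S x *\<^sub>R (\<bar>g' x\<bar> * indicator B (g x)))"
    by (intro nn_integral_eq_integral 2) (auto simp: indicator_def)
  also have "(LINT x|lborel. indicator S x *\<^sub>R (\<bar>g' x\<bar> * indicator B (g x))) = b"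
    using set_lebesgue_integral_eq_integral(2)[OF 1(1)] 1(2)
    unfolding set_lebesgue_integral_def by (subst (asm) integral_completion) auto
  also have "b = (LINT y|lborel. indicator (g ` S) y *\<^sub>R (indicator B y :: real))"
    using set_lebesgue_integral_eq_integral(2)[OF abs]
    unfolding set_lebesgue_integral_def b_def by (subst (asm) integral_completion) auto
  also have "ennreal \<dots> = emeasure lborel (B \<inter> g ` S)"
    unfolding eq using fin by (simp add: emeasure_eq_ennreal_measure)
  finally show ?thesis by simp
qed

text \<open>The bounded pieces of a Borel set come from
  \<open>nn_integral_change_of_variables_indicator\<close> and exhaust it from below. Only the
  modulus of \<open>J\<close> is prescribed; its phase stays free, and the choice of
  \<open>J2\<close> exploits this.\<close>

lemma weighted_comp_change_of_variables:
  fixes g g' :: "real \<Rightarrow> real"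
  assumes [measurable]: "S \<in> sets borel" "g \<in> borel_measurable borel" "g' \<in> borel_measurable borel"
    "J \<in> borel_measurable borel"
    and T [measurable]: "g ` S = T" "T \<in> sets borel"
    and der: "\<And>x. x \<in> S \<Longrightarrow> (g has_real_derivative g' x) (at x)" and inj: "inj_on g S"
    and J: "\<And>x. (cmod (J x))\<^sup>2 = indicator S x * \<bar>g' x\<bar>"
  shows "wcomp J g T"
  unfolding weighted_comp_def
proof (intro conjI)
  let ?A = "distr (density lborel (\<lambda>u. ennreal ((cmod (J u))\<^sup>2))) lborel g"
  let ?B = "density lborel (indicator T)"
  have *: "emeasure ?A B = emeasure ?B B" if [measurable]: "B \<in> sets borel" "B \<subseteq> {-real n..real n}" for n B
  proof -
    have "emeasure ?A B = (\<integral>\<^sup>+x. ennreal ((cmod (J x))\<^sup>2) * indicator (g -` B) x \<partial>lborel)"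
      by (subst emeasure_distr, simp, simp, subst emeasure_density)
         (auto intro!: measurable_sets_borel[of g borel])
    also have "\<dots> = (\<integral>\<^sup>+x. ennreal (indicator S x * (\<bar>g' x\<bar> * indicator B (g x))) \<partial>lborel)"
      by (intro nn_integral_cong) (auto simp: J indicator_def)
    also have "\<dots> = emeasure lborel (B \<inter> g ` S)"
      by (rule nn_integral_change_of_variables_indicator) (use that der inj T in auto)
    also have "\<dots> = emeasure ?B B"
      by (subst emeasure_density) (auto simp: T(1) nn_integral_indicator[symmetric] indicator_inter_arith mult.commute
          simp del: nn_integral_indicator intro!: nn_integral_cong)
    finally show ?thesis .
  qed
  show "?A = ?B"
  proof (rule measure_eqI)
    fix B assume "B \<in> sets ?A"
    then have [measurable]: "B \<in> sets borel" by simp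
    have B: "B = (\<Union>n::nat. B \<inter> {-real n..real n})"
    proof safe
      fix x assume "x \<in> B"
      moreover obtain n :: nat where "\<bar>x\<bar> \<le> real n" using real_arch_simple by blast
      ultimately show "x \<in> (\<Union>n::nat. B \<inter> {-real n..real n})" by (auto simp: abs_le_iff intro!: exI[of _ n])
    qed
    have inc: "incseq (\<lambda>n::nat. B \<inter> {-real n..real n})"
      by (auto simp: incseq_def)
    have "emeasure ?A B = (SUP n::nat. emeasure ?A (B \<inter> {-real n..real n}))"
      by (subst B, rule SUP_emeasure_incseq[symmetric]) (auto simp: inc)
    also have "\<dots> = (SUP n::nat. emeasure ?B (B \<inter> {-real n..real n}))"
      by (intro SUP_cong refl, rule *) auto
    also have "\<dots> = emeasure ?B B"
      by (subst (2) B, rule SUP_emeasure_incseq) (auto simp: inc)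
    finally show "emeasure ?A B = emeasure ?B B" .
  qed simp
qed (use assms in auto)

section \<open>The spectral variable and the logarithmic coordinate on both sides of [-1, 1]\<close>

subsection \<open>Logarithmic coordinates\<close>

lemma image_eq_of_inverse:
  assumes "\<And>x. x \<in> S \<Longrightarrow> g x \<in> T" "\<And>y. y \<in> T \<Longrightarrow> h y \<in> S \<and> g (h y) = y"
  shows "g ` S = T"
  using assms by force

lemma wcomp_uminus: "wcomp (\<lambda>u. 1) uminus UNIV"
  by (rule weighted_comp_change_of_variables[where g' = "\<lambda>x. - 1" and S = UNIV])
     (auto intro!: derivative_eq_intros injI)

text \<open>The weights are chosen such that the operators are partial isometries.  The eigenvalue
  parameter \<open>s\<close> is written as \<open>sig l\<close>, so that \<open>l = ln (1/s - 1)\<close>.\<close>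

definition sig :: "real \<Rightarrow> real" where "sig l = 1 / (1 + exp l)"

lemma sig_bounds: "0 < sig l" "sig l < 1"
  by (auto simp: sig_def field_simps add_pos_pos)

lemma one_minus_sig: "1 - sig l = exp l * sig l"
proof -
  have "1 + exp l \<noteq> 0" using exp_gt_zero[of l] by linarith
  then show ?thesis by (simp add: sig_def field_simps)
qed

lemma sig_measurable [measurable]: "sig \<in> borel_measurable borel"
  unfolding sig_def by measurable

lemma sig_deriv: "(sig has_real_derivative - (sig l * (1 - sig l))) (at l)"
proof -
  have nz: "1 + exp l \<noteq> 0" using exp_gt_zero[of l] by linarith
  have "(sig has_real_derivative - exp l / (1 + exp l)\<^sup>2) (at l)"
    unfolding sig_def[abs_def] using nz
    by (auto intro!: derivative_eq_intros simp: power2_eq_square divide_simps)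
  also have "- exp l / (1 + exp l)\<^sup>2 = - (sig l * (1 - sig l))"
    unfolding one_minus_sig by (simp add: sig_def power2_eq_square)
  finally show ?thesis .
qed

lemma ln_sig: "ln (1 / sig l - 1) = l"
  by (simp add: sig_def)

lemma sig_ln:
  assumes "0 < s" "s < 1"
  shows "sig (ln (1 / s - 1)) = s"
  using assms by (simp add: sig_def field_simps)

definition Jsig :: "real \<Rightarrow> complex" where
  "Jsig l = complex_of_real (sqrt (sig l * (1 - sig l)))"

lemma Jsig_measurable [measurable]: "Jsig \<in> borel_measurable borel"
  unfolding Jsig_def[abs_def] by measurable

lemma wcomp_sig: "wcomp Jsig sig {0<..<1}"
proof (rule weighted_comp_change_of_variables[where g' = "\<lambda>l. - (sig l * (1 - sig l))" and S = UNIV])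
  show "inj_on sig UNIV"
    by (metis injI ln_sig)
  show "range sig = {0<..<1}"
    by (rule image_eq_of_inverse[where h = "\<lambda>s. ln (1 / s - 1)"]) (auto simp: sig_bounds sig_ln)
  show "(cmod (Jsig l))\<^sup>2 = indicator UNIV l * \<bar>- (sig l * (1 - sig l))\<bar>" for l
    using sig_bounds[of l] by (simp add: Jsig_def abs_mult)
qed (auto simp: sig_deriv Jsig_def)

text \<open>The absolute value lets one formula serve inside and outside [-1, 1]; \<open>u1\<close>
  and \<open>u2\<close> are the two inverse branches. Division by 2 pi turns the change by pi of the
  argument of (1 - u) / (1 + u) at u = 1 and u = -1 into the strip height 1/2.\<close>

definition logw :: "real \<Rightarrow> real" where "logw u = ln \<bar>(1 - u) / (1 + u)\<bar> / (2 * pi)"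
definition u1 :: "real \<Rightarrow> real" where "u1 w = - tanh (pi * w)"
definition u2 :: "real \<Rightarrow> real" where "u2 w = - 1 / tanh (pi * w)"
text \<open>Its reciprocal is the square root of the modulus of the derivative of
  \<open>logw\<close>.\<close>

definition kap :: "real \<Rightarrow> real" where "kap u = sqrt (pi * \<bar>1 - u\<^sup>2\<bar>)"

definition J1 :: "real \<Rightarrow> complex" where
  "J1 u = (if \<bar>u\<bar> < 1 then complex_of_real (1 / kap u) else 0)"
text \<open>The phase \<i> sgn u is the one that 1 / sqrt (1 - u^2) acquires by continuation through
  the upper half-plane, so \<open>J1\<close> and \<open>J2\<close> are boundary values of one
  analytic function there.\<close>

definition J2 :: "real \<Rightarrow> complex" where
  "J2 u = (if 1 < \<bar>u\<bar> then \<i> * complex_of_real (sgn u / kap u) else 0)"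
definition K1 :: "real \<Rightarrow> complex" where
  "K1 w = complex_of_real (kap (u1 w))"
definition K2 :: "real \<Rightarrow> complex" where
  "K2 w = - \<i> * complex_of_real (sgn (u2 w) * kap (u2 w))"

lemma log_measurable [measurable]:
  "logw \<in> borel_measurable borel" "u1 \<in> borel_measurable borel" "u2 \<in> borel_measurable borel"
  "kap \<in> borel_measurable borel" "J1 \<in> borel_measurable borel" "J2 \<in> borel_measurable borel"
proof -
  have [measurable]: "(tanh :: real \<Rightarrow> real) \<in> borel_measurable borel"
    unfolding tanh_altdef by measurable
  show "logw \<in> borel_measurable borel" "u1 \<in> borel_measurable borel" "u2 \<in> borel_measurable borel"
    unfolding logw_def u1_def u2_def by measurable
  show [measurable]: "kap \<in> borel_measurable borel"
    unfolding kap_def by measurable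
  show "J1 \<in> borel_measurable borel" "J2 \<in> borel_measurable borel"
    unfolding J1_def J2_def by measurable
qed

lemma K_measurable [measurable]: "K1 \<in> borel_measurable borel" "K2 \<in> borel_measurable borel"
  unfolding K1_def K2_def by measurable

lemma u1_bounds: "\<bar>u1 w\<bar> < 1"
  using tanh_real_bounds[of "pi * w"] by (auto simp: u1_def abs_if)

lemma u2_bounds: "w \<noteq> 0 \<Longrightarrow> 1 < \<bar>u2 w\<bar>"
proof -
  assume w: "w \<noteq> 0"
  have "\<bar>tanh (pi * w)\<bar> < 1" "0 < \<bar>tanh (pi * w)\<bar>"
    using tanh_real_bounds[of "pi * w"] w by (auto simp: abs_less_iff minus_less_iff)
  then show ?thesis by (simp add: u2_def abs_divide)
qed

lemma u1_bounds': "-1 < u1 w" "u1 w < 1"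
  using u1_bounds[of w] by (auto simp: abs_less_iff)

lemma divide_divide_cancel: "c \<noteq> 0 \<Longrightarrow> (a / c) / (b / c) = a / (b :: real)"
  by simp

lemma tanh_pi_eq: "tanh (pi * w) = (1 - exp (- (2 * pi * w))) / (1 + exp (- (2 * pi * w)))"
  by (simp add: tanh_real_altdef mult.assoc)

lemma logw_u1: "logw (u1 w) = w"
proof -
  define e where "e = exp (- (2 * pi * w))"
  have e: "0 < e" by (simp add: e_def)
  have t: "tanh (pi * w) = (1 - e) / (1 + e)" by (simp add: tanh_pi_eq e_def)
  have "1 - u1 w = 2 / (1 + e)" "1 + u1 w = 2 * e / (1 + e)"
    unfolding u1_def t using e by (auto simp: field_simps)
  then have "(1 - u1 w) / (1 + u1 w) = 2 / (2 * e)"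
    using e by (simp only: divide_divide_cancel)
  then have "\<bar>(1 - u1 w) / (1 + u1 w)\<bar> = 1 / e"
    using e by simp
  then show ?thesis by (simp add: logw_def e_def ln_div)
qed

lemma logw_u2: "w \<noteq> 0 \<Longrightarrow> logw (u2 w) = w"
proof -
  assume w: "w \<noteq> 0"
  define e where "e = exp (- (2 * pi * w))"
  have e: "0 < e" "e \<noteq> 1" using w by (auto simp: e_def)
  have t: "tanh (pi * w) = (1 - e) / (1 + e)" by (simp add: tanh_pi_eq e_def)
  have "1 - u2 w = 2 / (1 - e)" "1 + u2 w = - 2 * e / (1 - e)"
    unfolding u2_def t using e by (auto simp: field_simps)
  then have "(1 - u2 w) / (1 + u2 w) = 2 / (- 2 * e)"
    using e by (simp only: divide_divide_cancel)
  then have "\<bar>(1 - u2 w) / (1 + u2 w)\<bar> = 1 / e"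
    using e by simp
  then show ?thesis by (simp add: logw_def e_def ln_div)
qed

lemma exp_logw:
  assumes "\<bar>u\<bar> \<noteq> 1"
  shows "exp (- (2 * pi * logw u)) = \<bar>(1 + u) / (1 - u)\<bar>"
proof -
  have "1 - u \<noteq> 0" "1 + u \<noteq> 0" using assms by auto
  then have "0 < \<bar>(1 - u) / (1 + u)\<bar>" by simp
  then have "exp (- (2 * pi * logw u)) = inverse \<bar>(1 - u) / (1 + u)\<bar>"
    by (simp add: logw_def exp_minus)
  then show ?thesis by (simp add: abs_divide)
qed

lemma u1_logw:
  assumes "\<bar>u\<bar> < 1"
  shows "u1 (logw u) = u"
proof -
  have "exp (- (2 * pi * logw u)) = (1 + u) / (1 - u)"
    using assms by (subst exp_logw) (auto intro!: abs_of_nonneg divide_nonneg_nonneg simp: abs_less_iff)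
  moreover have nz: "1 - u \<noteq> 0" using assms by auto
  then have "1 - (1 + u) / (1 - u) = - 2 * u / (1 - u)" "1 + (1 + u) / (1 - u) = 2 / (1 - u)"
    by (auto simp: field_simps)
  ultimately have "tanh (pi * logw u) = - 2 * u / 2"
    unfolding tanh_pi_eq by (simp only: divide_divide_cancel[OF nz])
  then show ?thesis by (simp add: u1_def)
qed

lemma u2_logw:
  assumes "1 < \<bar>u\<bar>"
  shows "u2 (logw u) = u" "logw u \<noteq> 0"
proof -
  have e: "exp (- (2 * pi * logw u)) = (1 + u) / (u - 1)"
    using assms by (subst exp_logw) (auto simp: abs_if field_simps split: if_splits)
  have nz: "u - 1 \<noteq> 0" "u \<noteq> 0" using assms by auto
  then have "1 - (1 + u) / (u - 1) = - 2 / (u - 1)" "1 + (1 + u) / (u - 1) = 2 * u / (u - 1)"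
    by (auto simp: field_simps)
  then have "tanh (pi * logw u) = (- 2 / (u - 1)) / (2 * u / (u - 1))"
    unfolding tanh_pi_eq e by simp
  also have "\<dots> = - 2 / (2 * u)" using nz(1) by (rule divide_divide_cancel)
  also have "\<dots> = - 1 / u" by simp
  finally have "tanh (pi * logw u) = - 1 / u" .
  then show "u2 (logw u) = u" by (simp add: u2_def)
  then show "logw u \<noteq> 0" using assms by (auto simp: u2_def)
qed

lemma logw_deriv:
  assumes "\<bar>u\<bar> \<noteq> 1"
  shows "(logw has_real_derivative - 1 / (pi * (1 - u\<^sup>2))) (at u)"
proof -
  have nz: "1 - u \<noteq> 0" "1 + u \<noteq> 0" using assms by (auto simp: abs_if split: if_splits)
  define q where "q x = (1 - x) / (1 + x)" for x :: real
  \<comment> \<open>Squaring removes the absolute value and leaves a formula that is differentiable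
    on both sides of |u| = 1.\<close>
  have "logw x = ln ((q x)\<^sup>2) / (4 * pi)" for x
  proof (cases "q x = 0")
    case False
    then have "ln ((q x)\<^sup>2) = 2 * ln \<bar>q x\<bar>"
      using ln_realpow[of "\<bar>q x\<bar>" 2] by simp
    then show ?thesis by (simp add: logw_def q_def)
  qed (simp add: logw_def q_def[symmetric])
  then have eq: "logw = (\<lambda>x. ln ((q x)\<^sup>2) / (4 * pi))" ..
  have q0: "q u \<noteq> 0" using nz by (simp add: q_def)
  have "(q has_real_derivative - 2 / (1 + u)\<^sup>2) (at u)"
    unfolding q_def[abs_def] using nz
    by (auto intro!: derivative_eq_intros simp: power2_eq_square)
  then have "(logw has_real_derivative (1 / (q u)\<^sup>2 * (2 * q u * (- 2 / (1 + u)\<^sup>2))) / (4 * pi)) (at u)"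
    unfolding eq using q0 by (auto intro!: derivative_eq_intros)
  also have "(1 / (q u)\<^sup>2 * (2 * q u * (- 2 / (1 + u)\<^sup>2))) / (4 * pi) = - 1 / (pi * ((1 - u) * (1 + u)))"
    using nz by (simp add: q_def power2_eq_square divide_simps) (simp add: algebra_simps)
  also have "(1 - u) * (1 + u) = 1 - u\<^sup>2" by (simp add: power2_eq_square algebra_simps)
  finally show ?thesis .
qed

lemma wcomp_J1: "wcomp J1 logw UNIV"
proof (rule weighted_comp_change_of_variables[where g' = "\<lambda>u. - 1 / (pi * (1 - u\<^sup>2))" and S = "{-1<..<1}"])
  show "inj_on logw {-1<..<1}"
    by (rule inj_on_inverseI[of _ u1]) (auto intro: u1_logw simp: abs_less_iff)
  show "logw ` {-1<..<1} = UNIV"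
    by (rule image_eq_of_inverse[where h = u1]) (auto simp: logw_u1 u1_bounds')
  show "(cmod (J1 u))\<^sup>2 = indicator {-1<..<1} u * \<bar>- 1 / (pi * (1 - u\<^sup>2))\<bar>" for u
    by (auto simp: J1_def kap_def indicator_def abs_mult norm_divide power_divide abs_less_iff)
  show "(logw has_real_derivative - 1 / (pi * (1 - u\<^sup>2))) (at u)" if "u \<in> {-1<..<1}" for u
    using that by (intro logw_deriv) auto
qed auto

text \<open>Outside [-1, 1] the value 0 of \<open>logw\<close> is missed: it belongs to u at
  infinity. A single point is a null set, so \<open>wc J2 logw\<close> is still isometric.\<close>

lemma wcomp_J2: "wcomp J2 logw (- {0})"
proof (rule weighted_comp_change_of_variables[where g' = "\<lambda>u. - 1 / (pi * (1 - u\<^sup>2))" and S = "{u. 1 < \<bar>u\<bar>}"])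
  show "inj_on logw {u. 1 < \<bar>u\<bar>}"
    by (rule inj_on_inverseI[of _ u2]) (auto intro: u2_logw)
  show "logw ` {u. 1 < \<bar>u\<bar>} = - {0}"
    by (rule image_eq_of_inverse[where h = u2]) (auto simp: logw_u2 u2_bounds u2_logw(2))
  show "(cmod (J2 u))\<^sup>2 = indicator {u. 1 < \<bar>u\<bar>} u * \<bar>- 1 / (pi * (1 - u\<^sup>2))\<bar>" for u
    by (auto simp: J2_def kap_def indicator_def abs_mult norm_mult norm_divide power_divide abs_sgn_eq)
  show "(logw has_real_derivative - 1 / (pi * (1 - u\<^sup>2))) (at u)" if "u \<in> {u. 1 < \<bar>u\<bar>}" for u
    using that by (intro logw_deriv) auto
qed auto

lemma wcomp_K1: "wcomp K1 u1 {-1<..<1}"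
proof (rule weighted_comp_change_of_variables[where g' = "\<lambda>w. - (pi * (1 - (u1 w)\<^sup>2))" and S = UNIV])
  show "inj_on u1 UNIV"
    by (rule inj_on_inverseI[of _ logw]) (auto intro: logw_u1)
  show "range u1 = {-1<..<1}"
    by (rule image_eq_of_inverse[where h = logw]) (auto simp: u1_logw u1_bounds')
  show "(cmod (K1 w))\<^sup>2 = indicator UNIV w * \<bar>- (pi * (1 - (u1 w)\<^sup>2))\<bar>" for w
    by (simp add: K1_def kap_def abs_mult)
  show "(u1 has_real_derivative - (pi * (1 - (u1 w)\<^sup>2))) (at w)" for w
    unfolding u1_def[abs_def] by (auto intro!: derivative_eq_intros)
qed auto

lemma wcomp_K2: "wcomp K2 u2 {u. 1 < \<bar>u\<bar>}"
proof (rule weighted_comp_change_of_variables[where g' = "\<lambda>w. - (pi * (1 - (u2 w)\<^sup>2))" and S = "- {0}"])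
  show "inj_on u2 (- {0})"
    by (rule inj_on_inverseI[of _ logw]) (auto intro: logw_u2)
  show "u2 ` (- {0}) = {u. 1 < \<bar>u\<bar>}"
    by (rule image_eq_of_inverse[where h = logw]) (auto simp: u2_logw u2_bounds)
  show "(cmod (K2 w))\<^sup>2 = indicator (- {0}) w * \<bar>- (pi * (1 - (u2 w)\<^sup>2))\<bar>" for w
    using u2_bounds[of w]
    by (auto simp: K2_def kap_def abs_mult norm_mult power_mult_distrib abs_sgn_eq u2_def indicator_def)
  show "(u2 has_real_derivative - (pi * (1 - (u2 w)\<^sup>2))) (at w)" if "w \<in> - {0}" for w
    unfolding u2_def[abs_def] using that
    by (auto intro!: derivative_eq_intros simp: field_simps power2_eq_square)
qed auto

lemma kap_pos: "\<bar>u\<bar> \<noteq> 1 \<Longrightarrow> 0 < kap u"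
proof -
  assume "\<bar>u\<bar> \<noteq> 1"
  then have "u\<^sup>2 \<noteq> 1" by (auto simp: power2_eq_1_iff)
  then show ?thesis by (simp add: kap_def)
qed

lemma mlt_one [simp]: "mlt (\<lambda>t. 1) x = x"
  by (simp add: mlt_def)

lemma K1_J1: "wc K1 u1 (wc J1 logw x) = x"
proof -
  have "kap (u1 u) \<noteq> 0" for u
    using kap_pos[OF less_imp_neq[OF u1_bounds[of u]]] by simp
  then have "wc K1 u1 (wc J1 logw x) = mlt (indicator UNIV) x"
    by (intro wc_inverse[OF wcomp_K1 wcomp_J1]) (auto simp: K1_def J1_def logw_u1 u1_bounds)
  then show ?thesis by simp
qed

lemma J1_K1: "wc J1 logw (wc K1 u1 x) = mlt (indicator {-1<..<1}) x"
proof (rule wc_inverse[OF wcomp_J1 wcomp_K1])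
  fix u :: real assume u: "u \<in> {-1<..<1}"
  then have "\<bar>u\<bar> < 1" by auto
  then show "J1 u * K1 (logw u) = 1 \<and> u1 (logw u) = u"
    using kap_pos[of u] by (simp add: K1_def J1_def u1_logw)
qed (auto simp: J1_def)

lemma J2_K2: "wc J2 logw (wc K2 u2 x) = mlt (indicator {u. 1 < \<bar>u\<bar>}) x"
proof (rule wc_inverse[OF wcomp_J2 wcomp_K2])
  fix u :: real assume u: "u \<in> {u. 1 < \<bar>u\<bar>}"
  then have "0 < kap u" "sgn u * sgn u = 1" by (auto intro!: kap_pos simp: sgn_if)
  then show "J2 u * K2 (logw u) = 1 \<and> u2 (logw u) = u"
    using u by (simp add: K2_def J2_def u2_logw complex_eq_iff field_simps)
qed (simp add: J2_def)

lemma mlt_indicator_AE: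
  assumes "AE t in lborel. t \<in> S" "S \<in> sets borel"
  shows "mlt (indicator S) x = x"
proof -
  have "cls (\<lambda>t. indicator S t * rep x t) = cls (rep x)"
    by (rule cls_cong) (use assms(1) in eventually_elim, simp)
  then show ?thesis by (simp add: mlt_def)
qed

lemma norm_wc_J1: "norm (wc J1 logw x) = norm x"
  by (simp add: norm_wc[OF wcomp_J1])

lemma norm_wc_J2: "norm (wc J2 logw x) = norm x"
proof -
  have "AE t in lborel. (t :: real) \<in> - {0}"
    using AE_lborel_singleton[of "0 :: real"] by simp
  then show ?thesis by (simp add: norm_wc[OF wcomp_J2] mlt_indicator_AE)
qed

text \<open>At w = 0 the weights have no pointwise inverse, so the identity is proved after applying
  \<open>wc J2 logw\<close>, which is injective because it preserves norms.\<close>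

lemma K2_J2: "wc K2 u2 (wc J2 logw x) = x"
proof -
  have "wc J2 logw (wc K2 u2 (wc J2 logw x)) = wc J2 logw x"
    unfolding J2_K2 unfolding wc_def mlt_cls[OF weighted_comp_L2(1)[OF wcomp_J2 rep_L2]]
    by (rule cls_cong) (auto simp: J2_def indicator_def)
  then have "wc J2 logw (wc K2 u2 (wc J2 logw x) - x) = 0"
    by (simp add: bclin_diff[OF bclin_wc[OF wcomp_J2]])
  then show ?thesis using norm_wc_J2 by (metis eq_iff_diff_eq_0 norm_eq_zero)
qed

section \<open>Completeness of decaying exponentials on a half-line and on the line\<close>

section \<open>Density of exponentials\<close>

definition epf :: "real \<Rightarrow> real \<Rightarrow> complex" where
  "epf a y = (if 0 < y then complex_of_real (exp (- (a * y))) else 0)"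

definition ep :: "real \<Rightarrow> l2" where "ep a = cls (epf a)"

lemma epf_measurable [measurable]: "epf a \<in> borel_measurable borel"
  unfolding epf_def[abs_def] by measurable

lemma integrable_epf:
  assumes "0 < a"
  shows "integrable lborel (epf a)"
proof -
  have "(\<lambda>y. exp (- a * y)) integrable_on {0..}"
    by (rule integrable_on_exp_minus_to_infinity[OF assms])
  then have "(\<lambda>y. exp (- a * y)) absolutely_integrable_on {0..}"
    by (intro nonnegative_absolutely_integrable_1) auto
  then have "integrable lborel (\<lambda>y. indicator {0..} y *\<^sub>R exp (- a * y))"
    unfolding set_integrable_def by (subst (asm) integrable_completion) auto
  then show ?thesis
    by (rule Bochner_Integration.integrable_bound) (auto simp: epf_def indicator_def intro!: AE_I2)
qed

lemma epf_mult: "epf a y * epf b y = epf (a + b) y"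
  by (simp add: epf_def algebra_simps flip: exp_add of_real_mult)

lemma epf_cnj [simp]: "cnj (epf a y) = epf a y"
  by (simp add: epf_def)

lemma L2_epf [simp]:
  assumes "0 < a"
  shows "epf a \<in> L2_fun lborel"
proof -
  have "(cmod (epf a y))\<^sup>2 = cmod (epf (a + a) y)" for y
    unfolding epf_mult[symmetric] by (simp add: norm_mult power2_eq_square)
  then show ?thesis
    unfolding L2_fun_def using integrable_epf[of "a + a"] assms by (simp add: integrable_norm)
qed

abbreviation half_line :: "real set" where "half_line \<equiv> {0<..}"

text \<open>In the variable x = exp (-y) the span of these exponentials is the weight exp (-(1 + c)
  y) times the polynomials. Uniform approximation on [0, 1] gives the continuous functions of x,
  ramps give the indicators of half-lines, a Dynkin argument gives all Borel sets, and simple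
  functions give the rest.\<close>

lemma exponentials_dense_half_line:
  assumes c: "0 \<le> c"
  shows "mlt (indicator half_line) x \<in> closure (cspan (range (\<lambda>k::nat. ep (real k + 1 + c))))"
    (is "_ \<in> ?K")
proof -
  \<comment> \<open>The weight is square integrable on the half-line, so bounded pointwise
    convergence of \<open>g\<close> becomes norm convergence of \<open>W g\<close>.\<close>
  define W where "W g = cls (\<lambda>y. epf (1 + c) y * g y)" for g
  have lim: "W g \<in> ?K" if "\<And>n. W (gn n) \<in> ?K" and [measurable]: "\<And>n. gn n \<in> borel_measurable borel" "g \<in> borel_measurable borel"
    and le: "\<And>n y. 0 < y \<Longrightarrow> cmod (gn n y) \<le> C" and conv: "\<And>y. 0 < y \<Longrightarrow> (\<lambda>n. gn n y) \<longlonglongrightarrow> g y"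
    for gn :: "nat \<Rightarrow> real \<Rightarrow> complex" and g C
  proof (rule closure_cspan_tendsto)
    show "(\<lambda>n. W (gn n)) \<longlonglongrightarrow> W g"
      unfolding W_def
    proof (rule l2_dominated_convergence)
      show "(\<lambda>y. complex_of_real C * epf (1 + c) y) \<in> L2_fun lborel"
        using c by (intro L2_fun_cmult L2_epf) auto
      have C: "0 \<le> C" using le[of 1 0] norm_ge_zero order_trans by (metis zero_less_one)
      show "AE y in lborel. cmod (epf (1 + c) y * gn n y) \<le> cmod (complex_of_real C * epf (1 + c) y)" for n
        using le[of _ n] C by (intro AE_I2) (auto simp: norm_mult epf_def mult_left_mono mult.commute)
      have "(\<lambda>n. epf (1 + c) y * gn n y) \<longlonglongrightarrow> epf (1 + c) y * g y" for y
        using conv[of y] by (cases "0 < y") (auto intro: tendsto_intros simp: epf_def)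
      then show "AE y in lborel. (\<lambda>n. epf (1 + c) y * gn n y) \<longlonglongrightarrow> epf (1 + c) y * g y"
        by (intro AE_I2)
    qed measurable
  qed (rule that)
  have L2W: "(\<lambda>y. epf (1 + c) y * g y) \<in> L2_fun lborel"
    if [measurable]: "g \<in> borel_measurable borel" and "\<And>y. 0 < y \<Longrightarrow> cmod (g y) \<le> C" for g C
  proof (rule L2_fun_bound[where C = C])
    show "epf (1 + c) \<in> L2_fun lborel" using c by simp
    show "AE y in lborel. cmod (epf (1 + c) y * g y) \<le> C * cmod (epf (1 + c) y)"
      using that(2) by (intro AE_I2) (auto simp: norm_mult epf_def mult_right_mono mult.commute)
  qed measurable
  have poly: "W (\<lambda>y. complex_of_real (q (exp (- y)))) \<in> ?K" if q0: "real_polynomial_function q" for q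
  proof -
    obtain a n where q: "q = (\<lambda>x. \<Sum>i\<le>n. a i * x ^ i)"
      using q0 unfolding real_polynomial_function_iff_sum by blast
    have e: "epf (1 + c) y * complex_of_real (exp (- y)) ^ i = epf (real i + 1 + c) y" for y i
      by (simp add: epf_def algebra_simps flip: exp_add of_real_mult of_real_power exp_of_nat_mult)
    have "epf (1 + c) y * complex_of_real (q (exp (- y))) = (\<Sum>i\<le>n. complex_of_real (a i) * epf (real i + 1 + c) y)" for y
      unfolding q e[symmetric] by (simp add: sum_distrib_left ac_simps)
    then have "W (\<lambda>y. complex_of_real (q (exp (- y)))) = (\<Sum>i\<le>n. cmul (complex_of_real (a i)) (ep (real i + 1 + c)))"
      unfolding W_def ep_def using c
      by (simp add: cmul_cls sum_cls(2) L2_fun_cmult add_nonneg_pos)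
    then show ?thesis
      by (simp add: closure_cspan_sum closure_cspan_cmul closure_cspan_base)
  qed
  have cont: "W (\<lambda>y. complex_of_real (p (exp (- y)))) \<in> ?K"
    if p: "continuous_on UNIV p" for p :: "real \<Rightarrow> real"
  proof -
    have pc: "continuous_on {0..1} p" using p continuous_on_subset by blast
    have "\<exists>q. real_polynomial_function q \<and> (\<forall>x\<in>{0..1}. \<bar>p x - q x\<bar> < 1 / real (Suc n))" for n
      by (rule Stone_Weierstrass_real_polynomial_function[OF compact_Icc pc, of "1 / real (Suc n)"])
         (simp, blast)
    then obtain q where q: "\<And>n. real_polynomial_function (q n)"
      "\<And>n x. x \<in> {0..1} \<Longrightarrow> \<bar>p x - q n x\<bar> < 1 / real (Suc n)"
      by metis
    obtain B where "\<forall>x\<in>{0..1}. \<bar>p x\<bar> \<le> B"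
      using compact_imp_bounded[OF compact_continuous_image[OF pc compact_Icc]]
      unfolding bounded_iff by auto
    then have B: "\<And>x. x \<in> {0..1} \<Longrightarrow> \<bar>p x\<bar> \<le> B" by blast
    have [measurable]: "p \<in> borel_measurable borel"
      by (rule borel_measurable_continuous_onI[OF p])
    have [measurable]: "q n \<in> borel_measurable borel" for n
      using q(1)[of n] by (auto simp: real_polynomial_function_iff_sum)
    have e01: "exp (- y) \<in> {0..1}" if "0 < y" for y :: real using that by auto
    show ?thesis
    proof (rule lim[where gn = "\<lambda>n y. complex_of_real (q n (exp (- y)))" and C = "B + 1"])
      show "W (\<lambda>y. complex_of_real (q n (exp (- y)))) \<in> ?K" for n
        by (rule poly[OF q(1)])
      fix y :: real assume y: "0 < y"
      show "cmod (complex_of_real (q n (exp (- y)))) \<le> B + 1" for n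
      proof -
        have "1 / real (Suc n) \<le> 1" by simp
        with q(2)[OF e01[OF y], of n] B[OF e01[OF y]] show ?thesis
          unfolding norm_of_real by linarith
      qed
      have "(\<lambda>n. p (exp (- y)) - q n (exp (- y))) \<longlonglongrightarrow> 0"
        by (rule Lim_null_comparison[OF always_eventually[OF allI] LIMSEQ_inverse_real_of_nat])
           (use q(2)[OF e01[OF y]] in \<open>auto simp: inverse_eq_divide intro!: less_imp_le\<close>)
      from tendsto_diff[OF tendsto_const[of "p (exp (- y))"] this]
      show "(\<lambda>n. complex_of_real (q n (exp (- y)))) \<longlonglongrightarrow> complex_of_real (p (exp (- y)))"
        by (intro tendsto_of_real) simp
    qed measurable
  qed
  have W1: "W (\<lambda>y. 1) \<in> ?K"
    using cont[of "\<lambda>x. 1"] by simp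
  \<comment> \<open>Ramps in exp (-y) that vanish for y at least r and steepen with n.\<close>
  have lessThan: "W (indicator {..<r}) \<in> ?K" for r
  proof (rule lim[where C = 1 and gn = "\<lambda>n y. complex_of_real (min 1 (max 0 (real n * (exp (- y) - exp (- r)))))"])
    show "W (\<lambda>y. complex_of_real (min 1 (max 0 (real n * (exp (- y) - exp (- r)))))) \<in> ?K" for n
      by (rule cont[of "\<lambda>x. min 1 (max 0 (real n * (x - exp (- r))))"]) (intro continuous_intros)
    fix y :: real
    show "cmod (complex_of_real (min 1 (max 0 (real n * (exp (- y) - exp (- r)))))) \<le> 1" for n
      unfolding norm_of_real by (auto simp: min_def max_def abs_if)
    show "(\<lambda>n. complex_of_real (min 1 (max 0 (real n * (exp (- y) - exp (- r)))))) \<longlonglongrightarrow> indicator {..<r} y"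
    proof (cases "y < r")
      case True
      define d where "d = exp (- y) - exp (- r)"
      have d: "0 < d" using True by (simp add: d_def)
      obtain N :: nat where N: "1 / d < real N" using reals_Archimedean2 by blast
      have "\<forall>\<^sub>F n in sequentially. complex_of_real (min 1 (max 0 (real n * d))) = 1"
        using eventually_ge_at_top[of N]
      proof eventually_elim
        case (elim n)
        then have "1 / d \<le> real n" using N by linarith
        then have "1 \<le> real n * d" using d by (simp add: field_simps)
        then show ?case by simp
      qed
      then show ?thesis using True by (simp add: d_def tendsto_eventually)
    next
      case False
      then have "real n * (exp (- y) - exp (- r)) \<le> 0" for n
        by (intro mult_nonneg_nonpos) auto
      then show ?thesis using False by (simp add: max_absorb1)
    qed
  qed measurable
  have add: "W (\<lambda>y. f y + g y) = W f + W g"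
    if "f \<in> borel_measurable borel" "g \<in> borel_measurable borel" "\<And>y. cmod (f y) \<le> C" "\<And>y. cmod (g y) \<le> C'" for f g C C'
    unfolding W_def using L2W[of f C] L2W[of g C'] that by (simp add: plus_cls distrib_left)
  have cm: "W (\<lambda>y. v * f y) = cmul v (W f)"
    if "f \<in> borel_measurable borel" "\<And>y. cmod (f y) \<le> C" for f v C
    unfolding W_def using L2W[of f C] that by (simp add: cmul_cls mult.left_commute)
  \<comment> \<open>The sets with this property form a Dynkin class that contains the half-lines, an
    intersection-stable generator.\<close>
  have sets: "W (indicator A) \<in> ?K" if "A \<in> sets borel" for A :: "real set"
  proof -
    have A: "A \<in> sigma_sets UNIV (range lessThan)"
      using that unfolding borel_eq_lessThan by (simp add: eucl_lessThan[abs_def] lessThan_def[abs_def] eucl_less_def)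
    have iS: "Int_stable (range (lessThan :: real \<Rightarrow> _))"
      unfolding Int_stable_def
    proof safe
      fix a b :: real
      have "{..<a} \<inter> {..<b} = {..<min a b}" by auto
      then show "{..<a} \<inter> {..<b} \<in> range lessThan" by blast
    qed
    have bs: "B \<in> sets borel" if "B \<in> sigma_sets UNIV (range (lessThan :: real \<Rightarrow> _))" for B
      using that unfolding borel_eq_lessThan by (simp add: eucl_lessThan[abs_def] lessThan_def[abs_def] eucl_less_def)
    have sub: "range lessThan \<subseteq> Pow (UNIV :: real set)" by simp
    show ?thesis
      using iS sub A
    proof (induction rule: sigma_sets_induct_disjoint)
      case (basic B)
      then show ?case using lessThan by auto
    next
      case empty
      show ?case using closure_cspan_0 by (simp add: W_def zero_cls)
    next
      case (compl B)
      have "W (indicator (UNIV - B)) = W (\<lambda>y. 1 + (- 1) * indicator B y)"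
        by (intro arg_cong[of _ _ W] ext) (auto simp: indicator_def)
      also have "\<dots> = W (\<lambda>y. 1) + W (\<lambda>y. (- 1) * indicator B y)"
        using bs[OF compl(1)] by (intro add[where C = 1 and C' = 1]) (auto simp: indicator_def)
      also have "W (\<lambda>y. (- 1) * indicator B y) = cmul (- 1) (W (indicator B))"
        using bs[OF compl(1)] by (intro cm[where C = 1]) (auto simp: indicator_def)
      finally show ?case
        using compl W1 by (auto intro: closure_cspan_add closure_cspan_cmul)
    next
      case (union A)
      have A [measurable]: "A i \<in> sets borel" for i using bs union by auto
      show ?case
      proof (rule lim[where gn = "\<lambda>n. indicator (\<Union>i<n. A i)" and C = 1])
        show "W (indicator (\<Union>i<n. A i)) \<in> ?K" for n
        proof (induction n)
          case 0
          show ?case using closure_cspan_0 by (simp add: W_def zero_cls)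
        next
          case (Suc n)
          have "A n \<inter> (\<Union>i<n. A i) = {}"
          proof -
            have "A n \<inter> A i = {}" if "i < n" for i
              using union(1) that by (auto simp: disjoint_family_on_def)
            then show ?thesis by auto
          qed
          then have "indicator (\<Union>i<Suc n. A i) = (\<lambda>y. indicator (A n) y + (indicator (\<Union>i<n. A i) y :: complex))"
            unfolding lessThan_Suc UN_insert fun_eq_iff by (intro allI indicator_add[symmetric])
          moreover have "W (\<lambda>y. indicator (A n) y + indicator (\<Union>i<n. A i) y) = W (indicator (A n)) + W (indicator (\<Union>i<n. A i))"
            by (intro add[where C = 1 and C' = 1]) (auto simp: indicator_def)
          ultimately show ?case
            using Suc union(3) by (auto intro!: closure_cspan_add)
        qed
        show "(\<lambda>n. indicator (\<Union>i<n. A i) y :: complex) \<longlonglongrightarrow> indicator (\<Union>i. A i) y" for y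
          by (rule LIMSEQ_indicator_UN)
      qed (auto simp: indicator_def)
    qed
  qed
  have simple: "W s \<in> ?K" if s: "simple_function borel s" for s :: "real \<Rightarrow> complex"
  proof -
    have fin: "finite (range s)" using simple_functionD(1)[OF s] by simp
    have [measurable]: "s -` {v} \<in> sets borel" for v
      using simple_functionD(2)[OF s, of "{v}"] by simp
    have rep_s: "s y = (\<Sum>v\<in>range s. v * indicator (s -` {v}) y)" for y
    proof -
      have "s y = (\<Sum>v\<in>range s. indicator (s -` {v}) y *\<^sub>R v)"
        by (rule simple_function_indicator_representation_banach
            [OF s, unfolded space_borel Int_UNIV_right, OF UNIV_I])
      also have "\<dots> = (\<Sum>v\<in>range s. v * indicator (s -` {v}) y)"
        by (rule sum.cong[OF refl]) (auto simp: indicator_def)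
      finally show ?thesis .
    qed
    have "epf (1 + c) y * s y = (\<Sum>v\<in>range s. epf (1 + c) y * (v * indicator (s -` {v}) y))" for y
      by (subst rep_s[of y]) (rule sum_distrib_left)
    then have "(\<lambda>y. epf (1 + c) y * s y) = (\<lambda>y. \<Sum>v\<in>range s. epf (1 + c) y * (v * indicator (s -` {v}) y))"
      by (rule ext)
    moreover have "cls (\<lambda>y. \<Sum>v\<in>range s. epf (1 + c) y * (v * indicator (s -` {v}) y)) = (\<Sum>v\<in>range s. W (\<lambda>y. v * indicator (s -` {v}) y))"
      unfolding W_def
    proof (rule sum_cls(2)[symmetric])
      show "(\<lambda>y. epf (1 + c) y * (v * indicator (s -` {v}) y)) \<in> L2_fun lborel" for v
        by (rule L2W[where C = "cmod v"]) (measurable, auto simp: indicator_def)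
    qed (rule fin)
    moreover have "W (\<lambda>y. v * indicator (s -` {v}) y) = cmul v (W (indicator (s -` {v})))" for v
      by (rule cm[where C = 1]) (measurable, auto simp: indicator_def)
    ultimately have "W s = (\<Sum>v\<in>range s. cmul v (W (indicator (s -` {v}))))"
      by (simp add: W_def)
    then show ?thesis
      using sets by (auto intro!: closure_cspan_sum closure_cspan_cmul)
  qed
  \<comment> \<open>\<open>h\<close> divides out the weight and may be unbounded. The approximants
    are at most twice |h|, so after multiplication by the weight they are at most twice |x|, which
    dominates them in norm.\<close>
  define h where "h y = exp ((1 + c) * y) * rep x y" for y
  have [measurable]: "h \<in> borel_measurable borel" unfolding h_def by measurable
  obtain s where s: "\<And>i. simple_function borel (s i)" "\<And>y. (\<lambda>i. s i y) \<longlonglongrightarrow> h y" "\<And>i y. cmod (s i y) \<le> 2 * cmod (h y)"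
    using borel_measurable_implies_sequence_metric[of h borel 0] by (auto simp: dist_norm)
  have eh: "epf (1 + c) y * h y = indicator half_line y * rep x y" for y
    by (simp add: epf_def h_def indicator_def flip: exp_add of_real_mult mult.assoc)
  show ?thesis
  proof (rule closure_cspan_tendsto)
    show "W (s n) \<in> ?K" for n by (rule simple[OF s(1)])
    show "(\<lambda>n. W (s n)) \<longlonglongrightarrow> mlt (indicator half_line) x"
      unfolding W_def mlt_def eh[symmetric]
    proof (rule l2_dominated_convergence[where w = "\<lambda>y. 2 * rep x y"])
      show "(\<lambda>y. epf (1 + c) y * s n y) \<in> borel_measurable borel" for n
        using borel_measurable_simple_function[OF s(1)[of n]] by measurable
      show "AE y in lborel. cmod (epf (1 + c) y * s n y) \<le> cmod (2 * rep x y)" for n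
      proof (rule AE_I2)
        fix y
        have "cmod (epf (1 + c) y * s n y) \<le> cmod (epf (1 + c) y) * (2 * cmod (h y))"
          unfolding norm_mult by (intro mult_left_mono s) auto
        also have "\<dots> = 2 * cmod (epf (1 + c) y * h y)" by (simp add: norm_mult)
        also have "\<dots> \<le> cmod (2 * rep x y)" unfolding eh by (auto simp: indicator_def norm_mult)
        finally show "cmod (epf (1 + c) y * s n y) \<le> cmod (2 * rep x y)" .
      qed
      show "AE y in lborel. (\<lambda>n. epf (1 + c) y * s n y) \<longlonglongrightarrow> epf (1 + c) y * h y"
        by (intro AE_I2 tendsto_intros s)
    qed auto
  qed
qed

definition refl :: "l2 \<Rightarrow> l2" where "refl = wc (\<lambda>u. 1) uminus"

lemma refl_cls: "f \<in> L2_fun lborel \<Longrightarrow> refl (cls f) = cls (\<lambda>u. f (- u))"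
  unfolding refl_def by (simp add: wc_cls[OF wcomp_uminus])

lemma L2_fun_refl: "f \<in> L2_fun lborel \<Longrightarrow> (\<lambda>u. f (- u)) \<in> L2_fun lborel"
  for f :: "real \<Rightarrow> complex"
  using weighted_comp_L2(1)[OF wcomp_uminus, of f] by simp

lemma bclin_refl: "bclin refl"
  unfolding refl_def by (rule bclin_wc[OF wcomp_uminus])

lemma norm_refl [simp]: "norm (refl x) = norm x"
  unfolding refl_def by (simp add: norm_wc[OF wcomp_uminus])

lemma refl_refl [simp]: "refl (refl x) = x"
  by (rule l2_cases[of x]) (simp add: refl_cls L2_fun_refl)

lemma ip_refl: "ip (refl x) (refl y) = ip x y"
  by (rule bclin_isometry_ip[OF bclin_refl norm_refl])

lemma refl_mlt: "bdd_meas m \<Longrightarrow> refl (mlt m x) = mlt (\<lambda>t. m (- t)) (refl x)"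
  by (rule l2_cases[of x]) (simp add: mlt_cls refl_cls L2_fun_mlt L2_fun_refl)

definition Dpos :: "l2 set" where "Dpos = range (\<lambda>k::nat. ep (real k + 1))"
text \<open>The offset 1/2 keeps the exponents on the two half-lines distinct, because the partial
  fraction in \<open>integral_rsv_rsv\<close> divides by their difference.\<close>

definition Dneg :: "l2 set" where "Dneg = range (\<lambda>k::nat. refl (ep (real k + 1 + 1 / 2)))"

lemma Dneg_dense: "mlt (indicator {..<0}) x \<in> closure (cspan Dneg)"
proof -
  have "refl (mlt (indicator half_line) (refl x)) \<in> closure (cspan Dneg)"
    by (rule closure_cspan_image[OF exponentials_dense_half_line[of "1 / 2"] bclin_refl])
       (auto simp: Dneg_def intro!: closure_cspan_base)
  moreover have "(\<lambda>t. indicator half_line (- t) :: complex) = indicator {..<0}"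
    by (auto simp: indicator_def)
  ultimately show ?thesis by (simp add: refl_mlt)
qed

lemma Dpos_dense: "mlt (indicator half_line) x \<in> closure (cspan Dpos)"
  using exponentials_dense_half_line[of 0 x] by (simp add: Dpos_def)

lemma mlt_pos_neg: "mlt (indicator half_line) x + mlt (indicator {..<0}) x = x"
proof -
  have "mlt (indicator half_line) x + mlt (indicator {..<0}) x = mlt (\<lambda>t. indicator half_line t + indicator {..<0} t) x"
    by (rule mlt_add_mlt) auto
  also have "\<dots> = cls (rep x)"
    unfolding mlt_def
    by (rule cls_cong) (use AE_lborel_singleton[of "0::real"] in eventually_elim, auto simp: indicator_def)
  finally show ?thesis by simp
qed

lemma cspan_mono: "S \<subseteq> T \<Longrightarrow> cspan S \<subseteq> cspan T"
  unfolding cspan_def by (intro span_mono) auto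

lemma exponentials_dense: "closure (cspan (Dpos \<union> Dneg)) = UNIV"
proof -
  have "x \<in> closure (cspan (Dpos \<union> Dneg))" for x
    using closure_cspan_add[of "mlt (indicator half_line) x" "Dpos \<union> Dneg" "mlt (indicator {..<0}) x"]
      Dpos_dense[of x] Dneg_dense[of x] closure_mono[OF cspan_mono[of Dpos "Dpos \<union> Dneg"]]
      closure_mono[OF cspan_mono[of Dneg "Dpos \<union> Dneg"]]
    unfolding mlt_pos_neg by auto
  then show ?thesis by auto
qed

lemma dense_closed_induct:
  assumes "closure (cspan S) = UNIV" "closed {x. P x}" "P 0"
    "\<And>c x y. x \<in> S \<Longrightarrow> P y \<Longrightarrow> P (cmul c x + y)"
  shows "P x"
proof -
  have "cspan S \<subseteq> {x. P x}"
  proof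
    fix x assume "x \<in> cspan S"
    then show "x \<in> {x. P x}"
      by (induction rule: cspan_induct) (use assms(3,4) in auto)
  qed
  then have "closure (cspan S) \<subseteq> {x. P x}"
    by (rule closure_minimal[OF _ assms(2)])
  then show ?thesis using assms(1) by auto
qed

section \<open>Plancherel's theorem, by extension from the exponentials\<close>

section \<open>The Fourier transformation on the real line\<close>

definition fhat :: "(real \<Rightarrow> complex) \<Rightarrow> real \<Rightarrow> complex" where
  "fhat f x = complex_of_real ((2 * pi) powr (- 1 / 2)) *
     (LINT y|lborel. exp (- \<i> * complex_of_real (x * y)) * f y)"

definition cF :: complex where "cF = complex_of_real ((2 * pi) powr (- 1 / 2))"

lemma cF_sq: "cF * cF = 1 / (2 * complex_of_real pi)"
proof -
  have "(2 * pi) powr (- 1 / 2) * (2 * pi) powr (- 1 / 2) = (2 * pi) powr (- 1)"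
    by (simp flip: powr_add)
  also have "\<dots> = 1 / (2 * pi)" by (simp add: powr_minus_divide)
  finally have eq: "(2 * pi) powr (- 1 / 2) * (2 * pi) powr (- 1 / 2) = 1 / (2 * pi)" .
  show ?thesis by (simp only: cF_def of_real_mult[symmetric] eq) simp
qed

lemma cF_simps [simp]: "cnj cF = cF" "cF \<noteq> 0"
  by (auto simp: cF_def)

lemma norm_exp_ii [simp]: "cmod (exp (\<i> * complex_of_real r)) = 1"
  by (simp add: norm_exp_eq_Re)

lemma fhat_integrable:
  assumes "integrable lborel f"
  shows "integrable lborel (\<lambda>y. exp (- \<i> * complex_of_real (x * y)) * f y)"
  by (rule Bochner_Integration.integrable_bound[OF assms])
     (use borel_measurable_integrable[OF assms] in \<open>auto simp: norm_mult simp del: of_real_mult\<close>)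

lemma fhat_measurable [measurable (raw)]:
  assumes "integrable lborel f"
  shows "fhat f \<in> borel_measurable borel"
proof -
  note [measurable] = borel_measurable_integrable[OF assms]
  have [measurable]: "f \<in> borel_measurable borel"
    using borel_measurable_integrable[OF assms] by simp
  show ?thesis
    unfolding fhat_def[abs_def]
    by (intro borel_measurable_times borel_measurable_const lborel.borel_measurable_lebesgue_integral) measurable
qed

lemma fhat_cong: "AE y in lborel. f y = g y \<Longrightarrow> f \<in> borel_measurable borel \<Longrightarrow> g \<in> borel_measurable borel \<Longrightarrow> fhat f = fhat g"
  unfolding fhat_def fun_eq_iff
  by (intro allI arg_cong2[of _ _ _ _ "(*)"] refl integral_cong_AE) auto

lemma fhat_add: "integrable lborel f \<Longrightarrow> integrable lborel g \<Longrightarrow> fhat (\<lambda>y. f y + g y) x = fhat f x + fhat g x"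
  unfolding fhat_def distrib_left by (simp add: fhat_integrable[simplified] distrib_left)

lemma fhat_cmult: "fhat (\<lambda>y. c * f y) x = c * fhat f x"
  unfolding fhat_def by (simp add: mult.left_commute[of _ c])

lemma fhat_bound: "integrable lborel f \<Longrightarrow> cmod (fhat f x) \<le> cmod cF * (LINT y|lborel. cmod (f y))"
proof -
  have "cmod (LINT y|lborel. exp (- \<i> * complex_of_real (x * y)) * f y) \<le> (LINT y|lborel. cmod (exp (- \<i> * complex_of_real (x * y)) * f y))"
    by (rule integral_norm_bound)
  also have "\<dots> = (LINT y|lborel. cmod (f y))"
    by (simp add: norm_mult del: of_real_mult)
  finally show ?thesis
    unfolding fhat_def cF_def norm_mult by (intro mult_left_mono) auto
qed

lemma fhat_refl: "fhat (\<lambda>y. f (- y)) x = fhat f (- x)"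
  unfolding fhat_def using lborel_integral_real_affine[of "- 1" "\<lambda>y. exp (- \<i> * complex_of_real (x * y)) * f (- y)" 0]
  by simp

text \<open>The kernel is symmetric in its two variables, so Fubini's theorem moves the transform to
  the other factor; the conjugation turns \<open>s\<close> into \<open>- s\<close>.\<close>

lemma fhat_adjoint:
  assumes f: "integrable lborel f" and g: "integrable lborel g"
  shows "(LINT t|lborel. fhat f t * cnj (g t)) = (LINT s|lborel. f s * cnj (fhat g (- s)))"
proof -
  have [measurable]: "f \<in> borel_measurable borel" "g \<in> borel_measurable borel"
    using borel_measurable_integrable[OF f] borel_measurable_integrable[OF g] by auto
  let ?h = "\<lambda>t s. exp (- (\<i> * complex_of_real (t * s))) * f s * cnj (g t)"
  have int: "integrable (lborel \<Otimes>\<^sub>M lborel) (\<lambda>(t, s). ?h t s)"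
  proof (rule lborel_pair.Fubini_integrable)
    show "(\<lambda>(t, s). ?h t s) \<in> borel_measurable (lborel \<Otimes>\<^sub>M lborel)"
      by measurable
    have "integrable lborel (\<lambda>t. (LINT s|lborel. cmod (f s)) * cmod (g t))"
      using g by simp
    then show "integrable lborel (\<lambda>t. LINT s|lborel. norm (case (t, s) of (t, s) \<Rightarrow> ?h t s))"
      by (simp add: norm_mult del: of_real_mult)
    show "AE t in lborel. integrable lborel (\<lambda>s. case (t, s) of (t, s) \<Rightarrow> ?h t s)"
      using fhat_integrable[OF f] by (intro AE_I2) simp
  qed
  have "fhat f t * cnj (g t) = cF * (LINT s|lborel. ?h t s)" for t
  proof -
    have "(LINT s|lborel. ?h t s) = (LINT s|lborel. exp (- (\<i> * complex_of_real (t * s))) * f s) * cnj (g t)"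
      by (rule integral_mult_left_zero)
    then show ?thesis by (simp add: fhat_def cF_def del: of_real_mult)
  qed
  then have "(LINT t|lborel. fhat f t * cnj (g t)) = cF * (LINT t|lborel. (LINT s|lborel. ?h t s))"
    by (simp only: integral_mult_right_zero)
  also have "(LINT t|lborel. (LINT s|lborel. ?h t s)) = (LINT s|lborel. (LINT t|lborel. ?h t s))"
    using lborel_pair.Fubini_integral[OF int] by simp
  also have "(\<lambda>s. LINT t|lborel. ?h t s) = (\<lambda>s. f s * cnj (LINT t|lborel. exp (- \<i> * complex_of_real (- s * t)) * g t))"
  proof
    fix s
    have "(LINT t|lborel. ?h t s) = (LINT t|lborel. f s * cnj (exp (- \<i> * complex_of_real (- s * t)) * g t))"
      by (intro Bochner_Integration.integral_cong) (auto simp: exp_cnj mult_ac)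
    also have "\<dots> = f s * cnj (LINT t|lborel. exp (- \<i> * complex_of_real (- s * t)) * g t)"
      by (simp del: of_real_mult complex_cnj_mult add: Bochner_Integration.integral_cnj)
    finally show "(LINT t|lborel. ?h t s) = f s * cnj (LINT t|lborel. exp (- \<i> * complex_of_real (- s * t)) * g t)" .
  qed
  also have "cF * (LINT s|lborel. f s * cnj (LINT t|lborel. exp (- \<i> * complex_of_real (- s * t)) * g t))
      = (LINT s|lborel. f s * cnj (fhat g (- s)))"
    unfolding fhat_def cF_def[symmetric] complex_cnj_mult cF_simps
    by (simp add: mult.left_commute[of _ cF] del: of_real_mult)
  finally show ?thesis .
qed

text \<open>Up to \<open>cF\<close> the Fourier transform of \<open>epf a\<close>: a Cauchy kernel
  with its pole at \<i> a in the upper half-plane.\<close>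

definition rsv :: "real \<Rightarrow> real \<Rightarrow> complex" where
  "rsv a x = 1 / (complex_of_real a + \<i> * complex_of_real x)"

lemma rsv_measurable [measurable]: "rsv a \<in> borel_measurable borel"
  unfolding rsv_def[abs_def] by measurable

lemma rsv_denom: "0 < a \<Longrightarrow> complex_of_real a + \<i> * complex_of_real x \<noteq> 0"
  by (auto simp: complex_eq_iff)

lemma rsv_minus: "rsv a (- x) = cnj (rsv a x)"
  by (simp add: rsv_def)

lemma cmod_rsv: "(cmod (rsv a x))\<^sup>2 = 1 / (a\<^sup>2 + x\<^sup>2)"
  by (simp add: rsv_def norm_divide power_divide cmod_power2)

lemma has_integral_cauchy_kernel:
  assumes "0 < a"
  shows "has_bochner_integral lborel (\<lambda>x. a / (a\<^sup>2 + x\<^sup>2)) pi"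
proof -
  have "has_bochner_integral lborel (\<lambda>x. inverse (1 + x\<^sup>2)) (pi :: real)"
    using integrable_inverse_1_plus_square LBINT_inverse_1_plus_square
    by (simp add: has_bochner_integral_iff set_integrable_def interval_lebesgue_integral_def
        einterval_def set_lebesgue_integral_def)
  then have "has_bochner_integral lborel (\<lambda>x. inverse (1 + (0 + (1 / a) * x)\<^sup>2)) (pi /\<^sub>R \<bar>1 / a\<bar>)"
    using assms by (subst lborel_has_bochner_integral_real_affine_iff[of "1 / a" _ _ 0, symmetric]) auto
  then have "has_bochner_integral lborel (\<lambda>x. (1 / a) * inverse (1 + (0 + (1 / a) * x)\<^sup>2)) ((1 / a) * (pi /\<^sub>R \<bar>1 / a\<bar>))"
    by (rule has_bochner_integral_mult_right)
  moreover have "(1 / a) * inverse (1 + (0 + (1 / a) * x)\<^sup>2) = a / (a\<^sup>2 + x\<^sup>2)" for x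
  proof -
    have "1 + (0 + (1 / a) * x)\<^sup>2 = (a\<^sup>2 + x\<^sup>2) / a\<^sup>2"
      using assms by (simp add: field_simps power2_eq_square)
    then show ?thesis using assms by (simp add: power2_eq_square)
  qed
  ultimately show ?thesis using assms by simp
qed

lemma L2_rsv [simp]:
  assumes "0 < a"
  shows "rsv a \<in> L2_fun lborel"
proof -
  have "integrable lborel (\<lambda>x. (1 / a) * (a / (a\<^sup>2 + x\<^sup>2)))"
    using has_integral_cauchy_kernel[OF assms] by (intro integrable_mult_right) (simp add: has_bochner_integral_iff)
  then show ?thesis
    using assms by (simp add: L2_fun_def cmod_rsv)
qed

text \<open>Substituting -x for x shows that the integral is its own conjugate. This leaves only
  real parts, which for products of two \<open>rsv\<close> split into the kernels a / (a^2 +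
  x^2).\<close>

lemma integral_eq_Re:
  assumes f: "integrable lborel f" and "\<And>x::real. f (- x) = cnj (f x)"
  shows "(LINT x|lborel. f x) = complex_of_real (LINT x|lborel. Re (f x))"
proof -
  have "(LINT x|lborel. f x) = (LINT x|lborel. f (- x))"
    using lborel_integral_real_affine[of "- 1" f 0] by simp
  also have "\<dots> = cnj (LINT x|lborel. f x)"
    by (simp add: assms(2) Bochner_Integration.integral_cnj)
  finally have "Im (LINT x|lborel. f x) = 0"
    by (simp add: complex_eq_iff)
  then show ?thesis
    using integral_Re[OF f] by (simp add: complex_eq_iff)
qed

lemma integral_rsv_cnj:
  assumes "0 < a" "0 < b"
  shows "(LINT x|lborel. rsv a x * cnj (rsv b x)) = complex_of_real (2 * pi / (a + b))"
proof -
  have "(LINT x|lborel. rsv a x * cnj (rsv b x)) = complex_of_real (LINT x|lborel. Re (rsv a x * cnj (rsv b x)))"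
    using assms by (intro integral_eq_Re L2_fun_integrable_mult_cnj) (auto simp: rsv_minus)
  also have "(\<lambda>x. Re (rsv a x * cnj (rsv b x))) = (\<lambda>x. (1 / (a + b)) * (a / (a\<^sup>2 + x\<^sup>2) + b / (b\<^sup>2 + x\<^sup>2)))"
  proof
    fix x
    have nz: "a\<^sup>2 + x\<^sup>2 \<noteq> 0" "b\<^sup>2 + x\<^sup>2 \<noteq> 0" "a + b \<noteq> 0"
      using assms by (auto simp: sum_power2_eq_zero_iff)
    have r: "rsv a x = Complex (a / (a\<^sup>2 + x\<^sup>2)) (- x / (a\<^sup>2 + x\<^sup>2))"
      "rsv b x = Complex (b / (b\<^sup>2 + x\<^sup>2)) (- x / (b\<^sup>2 + x\<^sup>2))"
      by (simp_all add: rsv_def complex_eq_iff Re_divide Im_divide)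
    show "Re (rsv a x * cnj (rsv b x)) = (1 / (a + b)) * (a / (a\<^sup>2 + x\<^sup>2) + b / (b\<^sup>2 + x\<^sup>2))"
      unfolding r using nz by (simp add: divide_simps) (simp add: algebra_simps power2_eq_square)
  qed
  also have "(LINT x|lborel. (1 / (a + b)) * (a / (a\<^sup>2 + x\<^sup>2) + b / (b\<^sup>2 + x\<^sup>2))) = (1 / (a + b)) * (pi + pi)"
    using has_bochner_integral_add[OF has_integral_cauchy_kernel[OF assms(1)] has_integral_cauchy_kernel[OF assms(2)]]
    by (simp add: has_bochner_integral_iff)
  finally show ?thesis by simp
qed

text \<open>The real part is a multiple of the difference of two Cauchy kernels, each with integral
  pi. The partial fraction divides by \<open>b - a\<close>.\<close>

lemma integral_rsv_rsv:
  assumes "0 < a" "0 < b" "a \<noteq> b"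
  shows "(LINT x|lborel. rsv a x * rsv b x) = 0"
proof -
  have "(LINT x|lborel. rsv a x * rsv b x) = complex_of_real (LINT x|lborel. Re (rsv a x * rsv b x))"
    using assms by (intro integral_eq_Re L2_fun_integrable_mult) (auto simp: rsv_minus)
  also have "(\<lambda>x. Re (rsv a x * rsv b x)) = (\<lambda>x. (1 / (b - a)) * (a / (a\<^sup>2 + x\<^sup>2) - b / (b\<^sup>2 + x\<^sup>2)))"
  proof
    fix x
    have nz: "a\<^sup>2 + x\<^sup>2 \<noteq> 0" "b\<^sup>2 + x\<^sup>2 \<noteq> 0" "b - a \<noteq> 0"
      using assms by (auto simp: sum_power2_eq_zero_iff)
    have r: "rsv a x = Complex (a / (a\<^sup>2 + x\<^sup>2)) (- x / (a\<^sup>2 + x\<^sup>2))"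
      "rsv b x = Complex (b / (b\<^sup>2 + x\<^sup>2)) (- x / (b\<^sup>2 + x\<^sup>2))"
      by (simp_all add: rsv_def complex_eq_iff Re_divide Im_divide)
    show "Re (rsv a x * rsv b x) = (1 / (b - a)) * (a / (a\<^sup>2 + x\<^sup>2) - b / (b\<^sup>2 + x\<^sup>2))"
      unfolding r using nz by (simp add: divide_simps) (simp add: algebra_simps power2_eq_square)
  qed
  also have "(LINT x|lborel. (1 / (b - a)) * (a / (a\<^sup>2 + x\<^sup>2) - b / (b\<^sup>2 + x\<^sup>2))) = (1 / (b - a)) * (pi - pi)"
    using has_bochner_integral_diff[OF has_integral_cauchy_kernel[OF assms(1)] has_integral_cauchy_kernel[OF assms(2)]]
    by (simp add: has_bochner_integral_iff)
  finally show ?thesis by simp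
qed

lemma fhat_epf:
  assumes a: "0 < a"
  shows "fhat (epf a) x = cF * rsv a x"
proof -
  define z where "z = complex_of_real a + \<i> * complex_of_real x"
  have z: "z \<noteq> 0" using rsv_denom[OF a] by (simp add: z_def)
  define G where "G y = - (exp (- (z * complex_of_real y)) / z)" for y :: real
  have eq: "exp (- \<i> * complex_of_real (x * y)) * epf a y = indicator {0<..} y *\<^sub>R exp (- (z * complex_of_real y))" for y
    by (simp add: epf_def indicator_def z_def exp_of_real[symmetric] algebra_simps flip: exp_add)
  have "(LBINT y=ereal 0..\<infinity>. exp (- (z * complex_of_real y))) = 0 - (- 1 / z)"
  proof (rule interval_integral_FTC_integrable)
    show "(G has_vector_derivative exp (- (z * complex_of_real y))) (at y)" for y
      unfolding G_def using z
      by (auto intro!: derivative_eq_intros has_vector_derivative_real_field simp: field_simps)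
    have "set_integrable lborel {0<..} (\<lambda>y. exp (- (z * complex_of_real y)))"
      unfolding set_integrable_def using fhat_integrable[OF integrable_epf[OF a], of x] unfolding eq .
    then show "set_integrable lborel (einterval (ereal 0) \<infinity>) (\<lambda>y. exp (- (z * complex_of_real y)))"
      by (simp add: einterval_def greaterThan_def)
    have "(G \<longlongrightarrow> G 0) (at_right 0)"
      unfolding G_def by (intro tendsto_intros z)
    then show "((G \<circ> real_of_ereal) \<longlongrightarrow> - 1 / z) (at_right (ereal 0))"
      by (simp add: ereal_tendsto_simps G_def)
    have "((\<lambda>y. exp (- (a * y)) / cmod z) \<longlongrightarrow> 0 / cmod z) at_top"
      using a z by (intro tendsto_divide tendsto_const)
        (auto intro!: exp_at_bot[THEN filterlim_compose] filterlim_tendsto_pos_mult_at_top filterlim_ident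
          simp: filterlim_uminus_at_bot)
    then have "(G \<longlongrightarrow> 0) at_top"
      by (intro Lim_null_comparison[of G "\<lambda>y. exp (- (a * y)) / cmod z"] always_eventually)
         (auto simp: G_def norm_divide norm_exp_eq_Re z_def)
    then show "((G \<circ> real_of_ereal) \<longlongrightarrow> 0) (at_left \<infinity>)"
      by (simp add: ereal_tendsto_simps)
  qed (auto intro!: continuous_intros)
  then have "(LINT y|lborel. exp (- \<i> * complex_of_real (x * y)) * epf a y) = 1 / z"
    unfolding eq by (simp add: interval_integral_to_infinity_eq set_lebesgue_integral_def)
  then show ?thesis
    by (simp add: fhat_def cF_def rsv_def z_def)
qed

lemma ip_ep:
  assumes "0 < a" "0 < b"
  shows "ip (ep a) (ep b) = complex_of_real (1 / (a + b))"
proof -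
  have "ip (ep a) (ep b) = (LINT y|lborel. epf (a + b) y)"
    using assms by (simp add: ep_def ip_cls epf_mult)
  \<comment> \<open>The integral is, up to \<open>cF\<close>, the transform of
    \<open>epf (a + b)\<close> at 0.\<close>
  moreover have "cF * (LINT y|lborel. epf (a + b) y) = cF * complex_of_real (1 / (a + b))"
    using fhat_epf[of "a + b" 0] assms by (simp add: fhat_def cF_def rsv_def)
  ultimately show ?thesis by (simp only: mult_left_cancel[OF cF_simps(2)])
qed

lemma ip_ep_refl:
  assumes "0 < a" "0 < b"
  shows "ip (ep a) (refl (ep b)) = 0"
proof -
  have "ip (ep a) (refl (ep b)) = (LINT y|lborel. epf a y * cnj (epf b (- y)))"
    using assms by (simp add: ep_def refl_cls ip_cls L2_fun_refl del: epf_cnj)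
  also have "\<dots> = (LINT y|(lborel :: real measure). 0)"
    by (intro Bochner_Integration.integral_cong) (auto simp: epf_def)
  finally show ?thesis by simp
qed

text \<open>\<open>rep\<close> picks some representative, but the integral does not depend on it.
  \<open>FTdom\<close> marks the classes on which the integral formula converges and has a
  square-integrable value.\<close>

definition FT0 :: "l2 \<Rightarrow> l2" where "FT0 x = cls (fhat (rep x))"

definition FTdom :: "l2 \<Rightarrow> bool" where
  "FTdom x \<longleftrightarrow> integrable lborel (rep x) \<and> fhat (rep x) \<in> L2_fun lborel"

lemma FT0_cls:
  assumes "f \<in> L2_fun lborel" "integrable lborel f" "fhat f \<in> L2_fun lborel"
  shows "FTdom (cls f)" "FT0 (cls f) = cls (fhat f)"
proof -
  have [measurable]: "f \<in> borel_measurable borel"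
    using L2_fun_measurable[OF assms(1)] by simp
  have "fhat (rep (cls f)) = fhat f"
    by (rule fhat_cong[OF rep_cls[OF assms(1)]]) auto
  moreover have "integrable lborel (rep (cls f))"
    using assms(2) by (subst integrable_cong_AE[OF _ _ rep_cls[OF assms(1)]]) auto
  ultimately show "FTdom (cls f)" "FT0 (cls f) = cls (fhat f)"
    using assms(3) by (auto simp: FTdom_def FT0_def)
qed

lemma FT0_add:
  assumes "FTdom x" "FTdom y"
  shows "FTdom (x + y)" "FT0 (x + y) = FT0 x + FT0 y"
proof -
  have eq: "fhat (\<lambda>t. rep x t + rep y t) = (\<lambda>t. fhat (rep x) t + fhat (rep y) t)"
    using assms by (intro ext fhat_add) (auto simp: FTdom_def)
  have *: "(\<lambda>t. rep x t + rep y t) \<in> L2_fun lborel" "integrable lborel (\<lambda>t. rep x t + rep y t)"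
    "fhat (\<lambda>t. rep x t + rep y t) \<in> L2_fun lborel"
    using assms unfolding eq by (auto simp: FTdom_def)
  show "FTdom (x + y)" "FT0 (x + y) = FT0 x + FT0 y"
    using FT0_cls[OF *] assms by (auto simp: plus_l2_def[of x y] eq FT0_def plus_cls FTdom_def)
qed

lemma FT0_cmul:
  assumes "FTdom x"
  shows "FTdom (cmul c x)" "FT0 (cmul c x) = cmul c (FT0 x)"
proof -
  have eq: "fhat (\<lambda>t. c * rep x t) = (\<lambda>t. c * fhat (rep x) t)"
    by (intro ext fhat_cmult)
  have *: "(\<lambda>t. c * rep x t) \<in> L2_fun lborel" "integrable lborel (\<lambda>t. c * rep x t)"
    "fhat (\<lambda>t. c * rep x t) \<in> L2_fun lborel"
    using assms unfolding eq by (auto simp: FTdom_def)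
  show "FTdom (cmul c x)" "FT0 (cmul c x) = cmul c (FT0 x)"
    using FT0_cls[OF *] assms by (auto simp: cmul_def[of c x] eq FT0_def cmul_cls FTdom_def)
qed

lemma FT0_ep:
  assumes "0 < a"
  shows "FTdom (ep a)" "FT0 (ep a) = cls (\<lambda>x. cF * rsv a x)"
proof -
  have eq: "fhat (epf a) = (\<lambda>x. cF * rsv a x)"
    by (intro ext fhat_epf assms)
  show "FTdom (ep a)" "FT0 (ep a) = cls (\<lambda>x. cF * rsv a x)"
    using FT0_cls[of "epf a"] assms by (auto simp: ep_def eq integrable_epf L2_fun_cmult)
qed

lemma integrable_refl: "integrable lborel f \<Longrightarrow> integrable lborel (\<lambda>u. f (- u :: real) :: complex)"
  using lborel_integrable_real_affine[of f "- 1" 0] by simp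

lemma FT0_refl:
  assumes "FTdom x"
  shows "FTdom (refl x)" "FT0 (refl x) = refl (FT0 x)"
proof -
  have eq: "fhat (\<lambda>y. rep x (- y)) = (\<lambda>t. fhat (rep x) (- t))"
    by (intro ext fhat_refl)
  have r: "refl x = cls (\<lambda>y. rep x (- y))"
    using refl_cls[OF rep_L2[of x]] by simp
  show "FTdom (refl x)" "FT0 (refl x) = refl (FT0 x)"
    using FT0_cls[of "\<lambda>y. rep x (- y)"] assms
    by (auto simp: r eq FTdom_def L2_fun_refl FT0_def refl_cls integrable_refl)
qed

text \<open>Parseval's relation on the generators. For exponentials on the same half-line both inner
  products are 1 / (a + b); on opposite half-lines both vanish, before the transformation by
  disjoint supports and after it by \<open>integral_rsv_rsv\<close>.\<close>

lemma FT0_ip_generators: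
  assumes "x \<in> Dpos \<union> Dneg" "y \<in> Dpos \<union> Dneg"
  shows "ip (FT0 x) (FT0 y) = ip x y"
proof -
  have pp: "ip (FT0 (ep a)) (FT0 (ep b)) = ip (ep a) (ep b)" if "0 < a" "0 < b" for a b
  proof -
    have "ip (FT0 (ep a)) (FT0 (ep b)) = (LINT x|lborel. (cF * cF) * (rsv a x * cnj (rsv b x)))"
      using that by (simp add: FT0_ep ip_cls L2_fun_cmult mult_ac)
    also have "\<dots> = (cF * cF) * complex_of_real (2 * pi / (a + b))"
      by (simp only: integral_mult_right_zero integral_rsv_cnj[OF that])
    finally show ?thesis using that by (simp add: ip_ep cF_sq)
  qed
  have pn: "ip (FT0 (ep a)) (FT0 (refl (ep b))) = 0" if "0 < a" "0 < b" "a \<noteq> b" for a b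
  proof -
    have "ip (FT0 (ep a)) (FT0 (refl (ep b))) = (LINT x|lborel. (cF * cF) * (rsv a x * rsv b x))"
      using that L2_fun_refl[of "\<lambda>x. cF * rsv b x"]
      by (simp add: FT0_ep FT0_refl refl_cls ip_cls L2_fun_cmult mult_ac rsv_minus)
    also have "\<dots> = 0"
      by (simp only: integral_mult_right_zero integral_rsv_rsv[OF that] mult_zero_right)
    finally show ?thesis .
  qed
  have ne: "real k + 1 \<noteq> real j + 1 + 1 / 2" for k j
  proof
    assume "real k + 1 = real j + 1 + 1 / 2"
    then have "real (2 * k) = real (2 * j + 1)" by simp
    then have "2 * k = 2 * j + 1" by (simp only: of_nat_eq_iff)
    then show False by presburger
  qed
  note simps = FT0_refl(2)[OF FT0_ep(1)] ip_refl
  have pnk: "ip (FT0 (ep (real k + 1))) (FT0 (refl (ep (real j + 1 + 1 / 2)))) = ip (ep (real k + 1)) (refl (ep (real j + 1 + 1 / 2)))" for k j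
    by (subst pn, simp, simp, rule ne, subst ip_ep_refl) auto
  show ?thesis
    using assms unfolding Dpos_def Dneg_def
  proof (elim UnE rangeE)
    fix k j assume "x = ep (real k + 1)" "y = ep (real j + 1)"
    then show ?thesis by (simp add: pp)
  next
    fix k j assume "x = ep (real k + 1)" "y = refl (ep (real j + 1 + 1 / 2))"
    then show ?thesis by (simp only: pnk)
  next
    fix k j assume *: "x = refl (ep (real k + 1 + 1 / 2))" "y = ep (real j + 1)"
    have "ip (FT0 y) (FT0 x) = ip y x" unfolding * by (rule pnk)
    then show ?thesis by (metis ip_cnj)
  next
    fix k j assume "x = refl (ep (real k + 1 + 1 / 2))" "y = refl (ep (real j + 1 + 1 / 2))"
    then show ?thesis by (simp add: simps pp)
  qed
qed

lemma FTdom_generators: "x \<in> Dpos \<union> Dneg \<Longrightarrow> FTdom x"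
  by (auto simp: Dpos_def Dneg_def intro!: FT0_refl(1) FT0_ep(1))

lemma FTdom_0: "FTdom 0" "FT0 0 = 0"
  using FT0_cmul[OF FT0_ep(1)[of 1], of 0] by auto

lemma FTdom_span: "x \<in> cspan (Dpos \<union> Dneg) \<Longrightarrow> FTdom x"
  by (induction rule: cspan_induct) (auto intro: FTdom_0 FT0_add FT0_cmul FTdom_generators)

lemma FT0_ip_span:
  assumes "x \<in> cspan (Dpos \<union> Dneg)" "y \<in> cspan (Dpos \<union> Dneg)"
  shows "ip (FT0 x) (FT0 y) = ip x y"
proof -
  note simps = FT0_add(2) FT0_cmul FTdom_generators FTdom_span FTdom_0 ip_add_left ip_add_right
    ip_cmul_left ip_cmul_right
  have *: "ip (FT0 x) (FT0 y) = ip x y" if "x \<in> Dpos \<union> Dneg" for x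
    using assms(2)
  proof (induction rule: cspan_induct)
    case (add c z w)
    then show ?case using FT0_ip_generators[OF that add(1)] FTdom_generators[OF add(1)]
      by (simp add: simps)
  qed (simp add: FTdom_0)
  show ?thesis
    using assms(1)
  proof (induction rule: cspan_induct)
    case (add c z w)
    then show ?case using *[OF add(1)] FTdom_generators[OF add(1)] by (simp add: simps)
  qed (simp add: FTdom_0)
qed

text \<open>The Plancherel transform, obtained by isometric extension from a dense span. The choice
  is harmless, since two bounded operators that agree on a dense span are equal.\<close>

definition FT :: "l2 \<Rightarrow> l2" where
  "FT = (SOME U. bclin U \<and> (\<forall>x. norm (U x) = norm x) \<and> (\<forall>x \<in> cspan (Dpos \<union> Dneg). U x = FT0 x))"

lemma FT: "bclin FT" "norm (FT x) = norm x" "x \<in> cspan (Dpos \<union> Dneg) \<Longrightarrow> FT x = FT0 x"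
proof -
  have "norm (FT0 x) = norm x" if "x \<in> cspan (Dpos \<union> Dneg)" for x
    using FT0_ip_span[OF that that] by (simp add: ip_norm power2_eq_iff_nonneg flip: of_real_power)
  then obtain U where "bclin U" "\<And>x. norm (U x) = norm x" "\<And>x. x \<in> cspan (Dpos \<union> Dneg) \<Longrightarrow> U x = FT0 x"
    using isometric_extension[OF exponentials_dense, of FT0] FT0_add(2) FT0_cmul(2) FTdom_span by metis
  then have "bclin U \<and> (\<forall>x. norm (U x) = norm x) \<and> (\<forall>x \<in> cspan (Dpos \<union> Dneg). U x = FT0 x)"
    by blast
  then have *: "bclin FT \<and> (\<forall>x. norm (FT x) = norm x) \<and> (\<forall>x \<in> cspan (Dpos \<union> Dneg). FT x = FT0 x)"
    unfolding FT_def
    by (rule someI[where P = "\<lambda>U. bclin U \<and> (\<forall>x. norm (U x) = norm x) \<and> (\<forall>x \<in> cspan (Dpos \<union> Dneg). U x = FT0 x)"])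
  then show "bclin FT" "norm (FT x) = norm x" "x \<in> cspan (Dpos \<union> Dneg) \<Longrightarrow> FT x = FT0 x"
    by auto
qed

lemma FT_generators: "x \<in> Dpos \<union> Dneg \<Longrightarrow> FT x = FT0 x"
  by (intro FT cspan_base)

lemma FT_ip: "ip (FT x) (FT y) = ip x y"
  by (rule bclin_isometry_ip[OF FT(1,2)])

lemma closed_ip_eq:
  assumes "bclin S" "bclin T" "bclin U" "bclin V"
  shows "closed {x. ip (S x) (T y) = ip (U x) (V y)}" "closed {y. ip (S x) (T y) = ip (U x) (V y)}"
  using assms
  by (auto intro!: closed_Collect_eq linear_continuous_on bounded_linear_compose[OF bounded_linear_ip_left]
      bounded_linear_compose[OF bounded_linear_ip_right] bclin_bounded_linear)

text \<open>The multiplication formula \<open>fhat_adjoint\<close> gives this on generators, where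
  all integrals converge; both sides are continuous in each argument, so density extends it one
  argument at a time.\<close>

lemma FT_adjoint: "ip (FT x) y = ip x (refl (FT y))"
proof -
  have gen: "ip (FT x) y = ip x (refl (FT y))" if "x \<in> Dpos \<union> Dneg" "y \<in> Dpos \<union> Dneg" for x y
  proof -
    have dom: "FTdom x" "FTdom y" using that FTdom_generators by auto
    have "ip (FT x) y = ip (cls (fhat (rep x))) (cls (rep y))"
      using that by (simp add: FT_generators FT0_def)
    also have "\<dots> = (LINT t|lborel. fhat (rep x) t * cnj (rep y t))"
      using dom by (subst ip_cls) (auto simp: FTdom_def)
    also have "\<dots> = (LINT s|lborel. rep x s * cnj (fhat (rep y) (- s)))"
      using dom by (intro fhat_adjoint) (auto simp: FTdom_def)
    also have "\<dots> = ip (cls (rep x)) (refl (cls (fhat (rep y))))"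
      using dom by (subst refl_cls, simp add: FTdom_def, subst ip_cls) (auto simp: FTdom_def L2_fun_refl)
    finally show ?thesis
      using that by (simp add: FT_generators FT0_def)
  qed
  note lin = bclin_add[OF FT(1)] bclin_cmul[OF FT(1)] bclin_0[OF FT(1)]
    bclin_add[OF bclin_refl] bclin_cmul[OF bclin_refl] bclin_0[OF bclin_refl]
    ip_add_left ip_add_right ip_cmul_left ip_cmul_right
  note closed = closed_ip_eq[OF FT(1) bclin_id bclin_id bclin_compose[OF bclin_refl FT(1)]]
  have *: "ip (FT x) y = ip x (refl (FT y))" if x: "x \<in> Dpos \<union> Dneg" for x
  proof (rule dense_closed_induct[where P = "\<lambda>y. ip (FT x) y = ip x (refl (FT y))", OF exponentials_dense closed(2)])
    fix c z w assume "z \<in> Dpos \<union> Dneg" "ip (FT x) w = ip x (refl (FT w))"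
    with gen[OF x this(1)] show "ip (FT x) (cmul c z + w) = ip x (refl (FT (cmul c z + w)))"
      by (simp add: lin)
  qed (simp add: lin)
  show ?thesis
  proof (rule dense_closed_induct[where P = "\<lambda>x. ip (FT x) y = ip x (refl (FT y))", OF exponentials_dense closed(1)])
    fix c z w assume "z \<in> Dpos \<union> Dneg" "ip (FT w) y = ip w (refl (FT y))"
    with *[OF this(1)] show "ip (FT (cmul c z + w)) y = ip (cmul c z + w) (refl (FT y))"
      by (simp add: lin)
  qed (simp add: lin)
qed

text \<open>The extension agrees with the integral on every integrable member of L2, not only on the
  span that defined it. The difference is tested against a dense set by moving the transform to the
  test function, where it is known.\<close>

lemma FT_cls:
  assumes f2: "f \<in> L2_fun lborel" and f1: "integrable lborel f"
  shows "FT (cls f) = cls (fhat f)" "fhat f \<in> L2_fun lborel"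
proof -
  have [measurable]: "f \<in> borel_measurable borel" "fhat f \<in> borel_measurable borel"
    using L2_fun_measurable[OF f2] fhat_measurable[OF f1] by auto
  \<comment> \<open>\<open>fhat f\<close> is so far only known to be bounded, so the difference is
    multiplied by exp (- |t|) to become square integrable. This factor raises the exponent of a
    generator by 1 and so maps generators to generators.\<close>
  define e where "e t = complex_of_real (exp (- \<bar>t\<bar>))" for t
  define C where "C = cmod cF * (LINT y|lborel. cmod (f y))"
  define w where "w t = (rep (FT (cls f)) t - fhat f t) * e t" for t
  have [measurable]: "e \<in> borel_measurable borel" unfolding e_def by measurable
  have e1: "cmod (e t) \<le> 1" for t by (simp add: e_def)
  have ee: "e t = epf 1 t + epf 1 (- t)" if "t \<noteq> 0" for t
    using that by (auto simp: e_def epf_def)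
  have e_epf: "e t * epf a t = epf (1 + a) t" for a t
    unfolding epf_mult[symmetric] by (auto simp: e_def epf_def)
  have e_epf': "e t * epf a (- t) = epf (1 + a) (- t)" for a t
    using e_epf[of "- t" a] by (simp add: e_def)
  have e2: "e \<in> L2_fun lborel"
  proof (rule L2_fun_cong)
    show "(\<lambda>t. epf 1 t + epf 1 (- t)) \<in> L2_fun lborel"
      by (intro L2_fun_add L2_fun_refl L2_epf) auto
    show "AE t in lborel. e t = epf 1 t + epf 1 (- t)"
      using AE_lborel_singleton[of "0 :: real"] by eventually_elim (rule ee)
  qed measurable
  have fe: "(\<lambda>t. fhat f t * e t) \<in> L2_fun lborel"
    by (rule L2_fun_bound[OF e2, where C = C])
       (auto simp: norm_mult C_def intro!: mult_right_mono fhat_bound[OF f1])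
  have re: "(\<lambda>t. rep (FT (cls f)) t * e t) \<in> L2_fun lborel"
    by (rule L2_fun_bound[OF rep_L2[of "FT (cls f)"], where C = 1])
       (auto simp: norm_mult intro!: mult_right_le_one_le e1)
  have w2: "w \<in> L2_fun lborel"
    using L2_fun_diff[OF re fe] by (simp add: w_def[abs_def] left_diff_distrib)
  have key: "(LINT t|lborel. (rep (FT (cls f)) t - fhat f t) * cnj (g t)) = 0"
    if g2: "g \<in> L2_fun lborel" and g1: "integrable lborel g" and gg: "FT (cls g) = cls (fhat g)"
      "fhat g \<in> L2_fun lborel" for g
  proof -
    have "integrable lborel (\<lambda>t. fhat f t * cnj (g t))"
    proof (rule Bochner_Integration.integrable_bound)
      show "integrable lborel (\<lambda>t. C * cmod (g t))" using g1 by simp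
      show "AE t in lborel. norm (fhat f t * cnj (g t)) \<le> norm (C * cmod (g t))"
        using fhat_bound[OF f1] by (intro AE_I2) (auto simp: norm_mult C_def abs_mult intro!: mult_right_mono)
    qed (use L2_fun_measurable[OF g2] in measurable)
    then have "(LINT t|lborel. (rep (FT (cls f)) t - fhat f t) * cnj (g t))
        = (LINT t|lborel. rep (FT (cls f)) t * cnj (g t)) - (LINT t|lborel. fhat f t * cnj (g t))"
      unfolding left_diff_distrib
      by (intro Bochner_Integration.integral_diff) (auto intro: L2_fun_integrable_mult_cnj g2)
    also have "(LINT t|lborel. rep (FT (cls f)) t * cnj (g t)) = ip (FT (cls f)) (cls g)"
      using ip_cls[OF rep_L2[of "FT (cls f)"] g2] by simp
    also have "\<dots> = ip (cls f) (refl (cls (fhat g)))"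
      by (simp add: FT_adjoint gg)
    also have "\<dots> = (LINT s|lborel. f s * cnj (fhat g (- s)))"
      using f2 gg by (simp add: refl_cls ip_cls L2_fun_refl)
    also have "\<dots> = (LINT t|lborel. fhat f t * cnj (g t))"
      by (rule fhat_adjoint[OF f1 g1, symmetric])
    finally show ?thesis by simp
  qed
  have gen: "\<exists>h. x = cls h \<and> h \<in> L2_fun lborel \<and> (\<exists>g. cls g \<in> Dpos \<union> Dneg \<and> g \<in> L2_fun lborel \<and>
      integrable lborel g \<and> (\<forall>t. t \<noteq> 0 \<longrightarrow> e t * h t = g t))" if "x \<in> Dpos \<union> Dneg" for x
    using that
  proof
    assume "x \<in> Dpos"
    then obtain k :: nat where x: "x = ep (real k + 1)" by (auto simp: Dpos_def)
    have "e t * epf (real k + 1) t = epf (real (Suc k) + 1) t" for t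
      unfolding e_epf by (simp add: add.commute)
    moreover have "cls (epf (real (Suc k) + 1)) \<in> Dpos"
      unfolding Dpos_def ep_def[symmetric] by (rule rangeI)
    ultimately show ?thesis
      by (intro exI[of _ "epf (real k + 1)"] conjI exI[of _ "epf (real (Suc k) + 1)"])
         (auto simp: x ep_def integrable_epf)
  next
    assume "x \<in> Dneg"
    then obtain k :: nat where x: "x = refl (ep (real k + 1 + 1 / 2))" by (auto simp: Dneg_def)
    have "e t * epf (real k + 1 + 1 / 2) (- t) = epf (real (Suc k) + 1 + 1 / 2) (- t)" for t
      unfolding e_epf' by (simp add: algebra_simps)
    moreover have "cls (\<lambda>t. epf (real (Suc k) + 1 + 1 / 2) (- t)) \<in> Dneg"
    proof -
      have "cls (\<lambda>t. epf (real (Suc k) + 1 + 1 / 2) (- t)) = refl (ep (real (Suc k) + 1 + 1 / 2))"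
        by (simp add: ep_def refl_cls)
      then show ?thesis unfolding Dneg_def by blast
    qed
    ultimately show ?thesis
      by (intro exI[of _ "\<lambda>t. epf (real k + 1 + 1 / 2) (- t)"] conjI exI[of _ "\<lambda>t. epf (real (Suc k) + 1 + 1 / 2) (- t)"])
         (auto simp: x ep_def refl_cls L2_fun_refl integrable_refl integrable_epf)
  qed
  have "cls w = 0"
  proof (rule closure_cspan_orthogonal_zero[of _ "Dpos \<union> Dneg"])
    fix x assume "x \<in> Dpos \<union> Dneg"
    then obtain h g where x: "x = cls h" "h \<in> L2_fun lborel" and g: "cls g \<in> Dpos \<union> Dneg" "g \<in> L2_fun lborel"
      "integrable lborel g" and eq: "\<And>t. t \<noteq> 0 \<Longrightarrow> e t * h t = g t"
      using gen[of x] by blast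
    have dom: "FTdom (cls g)" by (rule FTdom_generators[OF g(1)])
    have fg: "fhat (rep (cls g)) = fhat g"
      using L2_fun_measurable[OF g(2)] by (intro fhat_cong rep_cls g) auto
    have [measurable]: "h \<in> borel_measurable borel" "g \<in> borel_measurable borel"
      using L2_fun_measurable[OF x(2)] L2_fun_measurable[OF g(2)] by auto
    have "ip (cls w) x = (LINT t|lborel. w t * cnj (h t))"
      by (simp add: x ip_cls w2)
    also have "\<dots> = (LINT t|lborel. (rep (FT (cls f)) t - fhat f t) * cnj (g t))"
    proof (rule integral_cong_AE)
      show "AE t in lborel. w t * cnj (h t) = (rep (FT (cls f)) t - fhat f t) * cnj (g t)"
        using AE_lborel_singleton[of "0 :: real"]
      proof eventually_elim
        case (elim t)
        have "cnj (e t) = e t" by (simp add: e_def)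
        then show ?case unfolding eq[OF elim, symmetric] by (simp add: w_def mult.assoc)
      qed
    qed (auto simp: w_def)
    also have "\<dots> = 0"
      using dom FT_generators[OF g(1)] by (intro key g) (auto simp: FT0_def FTdom_def fg)
    finally show "ip (cls w) x = 0" .
  qed (simp add: exponentials_dense)
  then have "AE t in lborel. w t = 0"
    unfolding zero_cls[symmetric] by (subst (asm) cls_eq_iff[OF w2 L2_fun_zero])
  then have AE: "AE t in lborel. rep (FT (cls f)) t = fhat f t"
    by eventually_elim (simp add: w_def e_def)
  show "fhat f \<in> L2_fun lborel"
    by (rule L2_fun_cong[OF rep_L2[of "FT (cls f)"]]) (use AE in auto)
  show "FT (cls f) = cls (fhat f)"
    using cls_cong[OF AE] by simp
qed

lemma FT_refl: "FT (refl x) = refl (FT x)"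
proof (rule closure_cspan_eqI[of x "Dpos \<union> Dneg"])
  fix y assume y: "y \<in> Dpos \<union> Dneg"
  have *: "FT z = FT0 z" if "FTdom z" for z
    using FT_cls[OF rep_L2[of z]] that by (simp add: FTdom_def FT0_def)
  show "FT (refl y) = refl (FT y)"
    using FTdom_generators[OF y] by (simp add: * FT0_refl)
qed (auto simp: exponentials_dense bclin_compose bclin_refl FT(1))

definition FTi :: "l2 \<Rightarrow> l2" where "FTi x = refl (FT x)"

lemma bclin_FTi: "bclin FTi"
  unfolding FTi_def[abs_def] by (rule bclin_compose[OF bclin_refl FT(1)])

lemma FTi_FT: "FTi (FT x) = x"
proof -
  have "ip (FTi (FT x) - x) y = 0" for y
    using FT_adjoint[of y "FT x"] ip_cnj[of "FT y" "FT x"] ip_cnj[of y "refl (FT (FT x))"] FT_ip[of x y]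
    unfolding ip_diff_left FTi_def by simp
  from this[of "FTi (FT x) - x"] show ?thesis by (simp add: ip_norm)
qed

text \<open>Surjectivity of the transform: because \<open>FT\<close> commutes with the reflection,
  the left inverse \<open>FTi\<close> is also a right inverse.\<close>

lemma FT_FTi: "FT (FTi x) = x"
  using FTi_FT[of x] by (simp add: FTi_def FT_refl)

lemma ip_FTi: "ip (FTi x) y = ip x (FT y)"
  using FT_ip[of "FTi x" y] by (simp add: FT_FTi)

lemma FTi_cls:
  assumes "f \<in> L2_fun lborel" "integrable lborel f"
  shows "FTi (cls f) = cls (\<lambda>x. fhat f (- x))"
  using FT_cls[OF assms] by (simp add: FTi_def refl_cls)

section \<open>Fourier transforms of one analytic function on the two edges of a strip\<close>

section \<open>A contour shift\<close>

text \<open>This is b cosh (pi z) - \<i> sinh (pi z), that is (b + \<i> u) cosh (pi z) for u = -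
  tanh (pi z): the denominator of \<open>rsv b\<close> in the logarithmic coordinate.\<close>

definition Dk :: "real \<Rightarrow> complex \<Rightarrow> complex" where
  "Dk b z = ((complex_of_real b - \<i>) * exp (complex_of_real pi * z)
     + (complex_of_real b + \<i>) * exp (- (complex_of_real pi * z))) / 2"

lemma Re_Dk: "Re (Dk b z) = cosh (pi * Re z) * (b * cos (pi * Im z) + sin (pi * Im z))"
  by (simp add: Dk_def Re_exp Im_exp cosh_def algebra_simps)

lemma Im_Dk: "Im (Dk b z) = sinh (pi * Re z) * (b * sin (pi * Im z) - cos (pi * Im z))"
  by (simp add: Dk_def Re_exp Im_exp sinh_def field_simps)

lemma Dk_real: "Dk b (complex_of_real w) = Complex (b * cosh (pi * w)) (- sinh (pi * w))"
  by (simp add: complex_eq_iff Re_Dk Im_Dk mult.commute)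

lemma Dk_real_half: "Dk b (complex_of_real w + \<i> / 2) = Complex (cosh (pi * w)) (b * sinh (pi * w))"
  by (simp add: complex_eq_iff Re_Dk Im_Dk mult.commute)

text \<open>The real part is cosh (pi Re z) times b cos y + sin y with y = pi Im z between 0 and
  pi/2, a positive number. Geometrically, the open strip is the image of the lower half-plane, while
  the pole of \<open>rsv b\<close> lies in the upper one.\<close>

lemma Dk_nonzero:
  assumes "0 < b" "0 \<le> Im z" "Im z \<le> 1 / 2"
  shows "Dk b z \<noteq> 0"
proof -
  have "0 < b * cos (pi * Im z) + sin (pi * Im z)"
  proof (cases "Im z = 1 / 2")
    case False
    with assms have z: "pi * Im z < pi / 2" by simp
    have "0 < cos (pi * Im z)"
      using assms(2) z by (intro cos_gt_zero_pi) (auto intro: less_le_trans[of _ 0])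
    moreover have "0 \<le> sin (pi * Im z)"
      using assms(2) z by (intro sin_ge_zero) auto
    ultimately show ?thesis using assms(1) by (simp add: add_pos_nonneg)
  next
    case True
    then have "pi * Im z = pi / 2" by simp
    then show ?thesis by (simp only: sin_pi_half cos_pi_half)
  qed
  then have "0 < Re (Dk b z)" unfolding Re_Dk by simp
  then show ?thesis by auto
qed

text \<open>The squared modulus is at least sinh^2 times (b c + s)^2 + (b s - c)^2, and this sum is
  (1 + b^2) (c^2 + s^2), with \<open>c\<close> and \<open>s\<close> the cosine and sine of pi Im z.
  The bound controls the vertical sides in the contour shift.\<close>

lemma Dk_ge_sinh: "\<bar>sinh (pi * Re z)\<bar> \<le> cmod (Dk b z)"
proof -
  define c where "c = cos (pi * Im z)"
  define s where "s = sin (pi * Im z)"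
  have cs: "c\<^sup>2 + s\<^sup>2 = 1" by (simp add: c_def s_def)
  have "(sinh (pi * Re z))\<^sup>2 * 1 \<le> (sinh (pi * Re z))\<^sup>2 * ((1 + b\<^sup>2) * (c\<^sup>2 + s\<^sup>2))"
    by (intro mult_left_mono) (auto simp: cs)
  also have "\<dots> = (sinh (pi * Re z))\<^sup>2 * (b * c + s)\<^sup>2 + (sinh (pi * Re z))\<^sup>2 * (b * s - c)\<^sup>2"
    by (simp add: algebra_simps power2_eq_square)
  also have "\<dots> \<le> (cosh (pi * Re z))\<^sup>2 * (b * c + s)\<^sup>2 + (sinh (pi * Re z))\<^sup>2 * (b * s - c)\<^sup>2"
    by (intro add_right_mono mult_right_mono) (auto simp: cosh_square_eq)
  also have "\<dots> = (cmod (Dk b z))\<^sup>2"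
    by (simp add: cmod_power2 Re_Dk Im_Dk c_def s_def power_mult_distrib)
  finally have "\<bar>sinh (pi * Re z)\<bar>\<^sup>2 \<le> (cmod (Dk b z))\<^sup>2" by simp
  then show ?thesis by (rule power2_le_imp_le) simp
qed

lemma integrable_inverse_cosh: "integrable lborel (\<lambda>w. 1 / cosh (pi * w))"
proof (rule Bochner_Integration.integrable_bound)
  show "integrable lborel (\<lambda>w. 2 * (epf pi w + epf pi (- w)))"
    by (intro integrable_mult_right Bochner_Integration.integrable_add integrable_refl integrable_epf) auto
  show "AE w in lborel. norm (1 / cosh (pi * w)) \<le> norm (2 * (epf pi w + epf pi (- w)))"
    using AE_lborel_singleton[of "0 :: real"]
  proof eventually_elim
    case (elim w)
    have "exp \<bar>pi * w\<bar> / 2 \<le> cosh \<bar>pi * w\<bar>"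
      by (simp add: cosh_def)
    then have "1 / cosh (pi * w) \<le> 1 / (exp \<bar>pi * w\<bar> / 2)"
      by (intro divide_left_mono) auto
    also have "\<dots> = 2 * exp (- (pi * \<bar>w\<bar>))" by (simp add: exp_minus abs_mult inverse_eq_divide)
    also have "\<dots> = norm (2 * (epf pi w + epf pi (- w)))"
      using elim by (cases "0 < w") (auto simp: epf_def norm_mult)
    finally show ?case by simp
  qed
qed (auto simp: cosh_def)

text \<open>\<open>h1\<close> and \<open>h2\<close> are the pieces of \<open>rsv b\<close> inside
  and outside [-1, 1] (see \<open>K1_rsv\<close>, \<open>K2_rsv\<close>), both read off from sqrt pi
  / \<open>Dk b\<close> on the edges of the strip. The sign of \<open>h2\<close> arises because
  \<open>J2\<close> continues \<open>J1\<close> through the upper half-plane, whereas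
  \<open>rsv b\<close> is analytic in the lower one.\<close>

definition h1 :: "real \<Rightarrow> real \<Rightarrow> complex" where
  "h1 b w = complex_of_real (sqrt pi) / Dk b (complex_of_real w)"
definition h2 :: "real \<Rightarrow> real \<Rightarrow> complex" where
  "h2 b w = - complex_of_real (sqrt pi) / Dk b (complex_of_real w + \<i> / 2)"

lemma h_measurable [measurable]: "h1 b \<in> borel_measurable borel" "h2 b \<in> borel_measurable borel"
  unfolding h1_def[abs_def] h2_def[abs_def] Dk_def by measurable

lemma integrable_h:
  assumes "0 < b"
  shows "integrable lborel (h1 b)" "integrable lborel (h2 b)"
proof -
  have 1: "integrable lborel (\<lambda>w. (sqrt pi / min b 1) * (1 / cosh (pi * w)))"
    by (intro integrable_mult_right integrable_inverse_cosh)
  have m: "0 < min b 1" using assms by simp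
  have D1: "min b 1 * cosh (pi * w) \<le> cmod (Dk b (complex_of_real w))" for w
  proof -
    have "min b 1 * cosh (pi * w) \<le> \<bar>Re (Dk b (complex_of_real w))\<bar>"
      unfolding Dk_real using assms by (auto simp: abs_mult intro!: mult_right_mono)
    then show ?thesis using abs_Re_le_cmod order_trans by blast
  qed
  have D2: "min b 1 * cosh (pi * w) \<le> cmod (Dk b (complex_of_real w + \<i> / 2))" for w
  proof -
    have "min b 1 * cosh (pi * w) \<le> 1 * cosh (pi * w)"
      by (intro mult_right_mono) auto
    also have "\<dots> = \<bar>Re (Dk b (complex_of_real w + \<i> / 2))\<bar>"
      unfolding Dk_real_half by simp
    finally show ?thesis using abs_Re_le_cmod order_trans by blast
  qed
  have le: "sqrt pi / d \<le> (sqrt pi / min b 1) * (1 / cosh (pi * w))" if "min b 1 * cosh (pi * w) \<le> d" for d w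
  proof -
    have pos: "0 < min b 1 * cosh (pi * w)" using m by (intro mult_pos_pos) auto
    then have "0 < d" using that by linarith
    then have "sqrt pi / d \<le> sqrt pi / (min b 1 * cosh (pi * w))"
      using that pos by (intro divide_left_mono) auto
    then show ?thesis by simp
  qed
  show "integrable lborel (h1 b)" "integrable lborel (h2 b)"
    by (rule Bochner_Integration.integrable_bound[OF 1];
        use le[OF D1] le[OF D2] m in \<open>force simp: h1_def h2_def norm_divide\<close>)+
qed

lemma integral_Icc_limit:
  fixes f :: "real \<Rightarrow> complex"
  assumes "integrable lborel f"
  shows "(\<lambda>n. LINT x|lborel. indicator {-real n..real n} x *\<^sub>R f x) \<longlonglongrightarrow> (LINT x|lborel. f x)"
proof (rule integral_dominated_convergence[where w = "\<lambda>x. norm (f x)"])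
  show "AE x in lborel. (\<lambda>n. indicator {-real n..real n} x *\<^sub>R f x) \<longlonglongrightarrow> f x"
  proof (rule AE_I2)
    fix x :: real
    obtain N :: nat where N: "\<bar>x\<bar> \<le> real N" using real_arch_simple by blast
    have "\<forall>\<^sub>F n in sequentially. indicator {-real n..real n} x *\<^sub>R f x = f x"
      using eventually_ge_at_top[of N] by eventually_elim (use N in \<open>auto simp: indicator_def abs_le_iff\<close>)
    then show "(\<lambda>n. indicator {-real n..real n} x *\<^sub>R f x) \<longlonglongrightarrow> f x"
      by (rule tendsto_eventually)
  qed
qed (use borel_measurable_integrable[OF assms] assms in \<open>auto simp: indicator_def\<close>)

text \<open>A primitive on the convex strip replaces the integral around a rectangle: each
  horizontal integral is a difference of end values, and the differences along the vertical sides
  are bounded by \<open>B\<close> times the height 1/2, so they vanish in the limit.\<close>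

lemma contour_shift:
  fixes f :: "complex \<Rightarrow> complex"
  defines "S \<equiv> {z. 0 \<le> Im z \<and> Im z \<le> 1 / 2}"
  assumes cont: "continuous_on S f" and hol: "\<And>z. z \<in> S \<Longrightarrow> f field_differentiable at z"
    and int: "integrable lborel (\<lambda>w. f (complex_of_real w))"
      "integrable lborel (\<lambda>w. f (complex_of_real w + \<i> / 2))"
    and bound: "\<And>z. z \<in> S \<Longrightarrow> 1 \<le> \<bar>Re z\<bar> \<Longrightarrow> cmod (f z) \<le> B \<bar>Re z\<bar>"
    and B: "(\<lambda>n. B (real n)) \<longlonglongrightarrow> 0"
  shows "(LINT w|lborel. f (complex_of_real w)) = (LINT w|lborel. f (complex_of_real w + \<i> / 2))"
proof -
  have "convex S"
  proof -
    have "S = {z. 0 \<le> Im z} \<inter> {z. Im z \<le> 1 / 2}" by (auto simp: S_def)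
    then show ?thesis by (simp only: convex_Int convex_halfspace_Im_ge convex_halfspace_Im_le)
  qed
  obtain g where g: "\<And>z. z \<in> S \<Longrightarrow> (g has_field_derivative f z) (at z within S)"
  proof (rule holomorphic_convex_primitive[OF \<open>convex S\<close> finite.emptyI cont])
    show "f field_differentiable at z" if "z \<in> interior S - {}" for z
      using that interior_subset[of S] by (intro hol) auto
  qed blast
  have line: "(LINT w|lborel. indicator {-real n..real n} w *\<^sub>R f (complex_of_real w + z))
      = g (complex_of_real (real n) + z) - g (complex_of_real (- real n) + z)"
    if z: "Re z = 0" "z \<in> S" for z n
  proof (rule integral_FTC_atLeastAtMost)
    have zS: "complex_of_real w + z \<in> S" for w using z by (auto simp: S_def)
    fix w :: real
    have "((\<lambda>w. complex_of_real w + z) has_vector_derivative 1) (at w)"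
      by (auto intro!: derivative_eq_intros)
    moreover have "(g has_field_derivative f (complex_of_real w + z))
        (at (complex_of_real w + z) within range (\<lambda>w. complex_of_real w + z))"
      by (rule DERIV_subset[OF g[OF zS]]) (use zS in auto)
    ultimately have "(g \<circ> (\<lambda>w. complex_of_real w + z) has_vector_derivative 1 * f (complex_of_real w + z)) (at w within UNIV)"
      by (rule field_vector_diff_chain_within)
    then show "((\<lambda>w. g (complex_of_real w + z)) has_vector_derivative f (complex_of_real w + z)) (at w within {- real n..real n})"
      by (auto simp: o_def intro: has_vector_derivative_at_within)
    show "continuous_on {- real n..real n} (\<lambda>w. f (complex_of_real w + z))"
      by (rule continuous_on_compose2[OF cont]) (auto intro!: continuous_intros zS)
  qed simp
  have side: "cmod (g (complex_of_real x + \<i> / 2) - g (complex_of_real x)) \<le> B \<bar>x\<bar> * (1 / 2)" if x: "1 \<le> \<bar>x\<bar>" for x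
  proof -
    let ?L = "closed_segment (complex_of_real x) (complex_of_real x + \<i> / 2)"
    have L: "Re z = x \<and> z \<in> S" if zL: "z \<in> ?L" for z
    proof -
      obtain u where "0 \<le> u" "u \<le> 1" "z = (1 - u) *\<^sub>R complex_of_real x + u *\<^sub>R (complex_of_real x + \<i> / 2)"
        using zL unfolding in_segment(1) by metis
      then show ?thesis by (simp add: S_def left_diff_distrib)
    qed
    have "cmod (g (complex_of_real x + \<i> / 2) - g (complex_of_real x))
        \<le> B \<bar>x\<bar> * cmod ((complex_of_real x + \<i> / 2) - complex_of_real x)"
    proof (rule field_differentiable_bound[of ?L])
      fix z assume "z \<in> ?L"
      with L have z: "Re z = x" "z \<in> S" by auto
      show "(g has_field_derivative f z) (at z within ?L)"
        by (rule DERIV_subset[OF g[OF z(2)]]) (use L in auto)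
      show "cmod (f z) \<le> B \<bar>x\<bar>"
        using bound[OF z(2)] z(1) x by simp
    qed auto
    then show ?thesis by (simp add: norm_divide)
  qed
  define I0 where "I0 n = (LINT w|lborel. indicator {-real n..real n} w *\<^sub>R f (complex_of_real w))" for n
  define I1 where "I1 n = (LINT w|lborel. indicator {-real n..real n} w *\<^sub>R f (complex_of_real w + \<i> / 2))" for n
  have "cmod (I1 n - I0 n) \<le> B (real n)" if "1 \<le> n" for n
  proof -
    have n: "1 \<le> \<bar>real n\<bar>" "1 \<le> \<bar>- real n\<bar>" using that by auto
    have "I1 n - I0 n = (g (complex_of_real (real n) + \<i> / 2) - g (complex_of_real (real n)))
        - (g (complex_of_real (- real n) + \<i> / 2) - g (complex_of_real (- real n)))"
      using line[of "\<i> / 2" n] line[of 0 n] unfolding I0_def I1_def by (simp add: S_def)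
    also have "cmod \<dots> \<le> B (real n) * (1 / 2) + B (real n) * (1 / 2)"
      by (rule order_trans[OF norm_triangle_ineq4]) (use side[OF n(1)] side[OF n(2)] in simp)
    finally show ?thesis by simp
  qed
  then have A: "(\<lambda>n. I1 n - I0 n) \<longlonglongrightarrow> 0"
    by (intro Lim_null_comparison[OF eventually_mono[OF eventually_ge_at_top[of 1]] B])
  have "(\<lambda>n. I1 n - I0 n) \<longlonglongrightarrow>
      (LINT w|lborel. f (complex_of_real w + \<i> / 2)) - (LINT w|lborel. f (complex_of_real w))"
    unfolding I0_def I1_def by (intro tendsto_diff integral_Icc_limit int)
  from LIMSEQ_unique[OF this A] show ?thesis by simp
qed

lemma exp_over_sinh_tendsto: "(\<lambda>n. C / sinh (pi * real n)) \<longlonglongrightarrow> 0"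
proof (rule tendsto_divide_0[OF tendsto_const])
  have "filterlim (\<lambda>n. pi * real n) at_top sequentially"
    by (rule filterlim_tendsto_pos_mult_at_top[OF tendsto_const]) (auto simp: filterlim_real_sequentially)
  then have "filterlim (\<lambda>n. sinh (pi * real n)) at_top sequentially"
    by (rule filterlim_compose[OF sinh_real_at_top])
  then show "filterlim (\<lambda>n. sinh (pi * real n)) at_infinity sequentially"
    by (rule filterlim_at_top_imp_at_infinity)
qed

text \<open>On the edge z = w + \<i>/2 the factor exp (- \<i> l z) contributes exp (l/2); the minus
  sign is the one in \<open>h2\<close>.\<close>

lemma fhat_h:
  assumes b: "0 < b"
  shows "fhat (h1 b) l = - (exp (complex_of_real (l / 2)) * fhat (h2 b) l)"
proof -
  define f where "f z = exp (- \<i> * complex_of_real l * z) * (complex_of_real (sqrt pi) / Dk b z)" for z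
  define C where "C = exp (\<bar>l\<bar> / 2) * sqrt pi"
  have f0: "f (complex_of_real w) = exp (- \<i> * complex_of_real (l * w)) * h1 b w" for w
    by (simp add: f_def h1_def mult.assoc)
  have f1: "f (complex_of_real w + \<i> / 2) = - exp (complex_of_real (l / 2)) * (exp (- \<i> * complex_of_real (l * w)) * h2 b w)" for w
  proof -
    have "- \<i> * complex_of_real l * (complex_of_real w + \<i> / 2) = complex_of_real (l / 2) + - \<i> * complex_of_real (l * w)"
      by (simp add: algebra_simps)
    then show ?thesis
      unfolding f_def h2_def by (simp only: exp_add) simp
  qed
  have "(LINT w|lborel. f (complex_of_real w)) = (LINT w|lborel. f (complex_of_real w + \<i> / 2))"
  proof (rule contour_shift[where B = "\<lambda>r. C / sinh (pi * r)"])
    have diff: "f field_differentiable at z" if "z \<in> {z. 0 \<le> Im z \<and> Im z \<le> 1 / 2}" for z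
      unfolding f_def field_differentiable_def Dk_def using Dk_nonzero[OF b, of z] that
      by (intro exI) (auto intro!: derivative_eq_intros simp: Dk_def)
    then show "f field_differentiable at z" if "z \<in> {z. 0 \<le> Im z \<and> Im z \<le> 1 / 2}" for z
      using that .
    show "continuous_on {z. 0 \<le> Im z \<and> Im z \<le> 1 / 2} f"
      using diff by (intro continuous_at_imp_continuous_on ballI field_differentiable_imp_continuous_at)
    show "integrable lborel (\<lambda>w. f (complex_of_real w))"
      unfolding f0 by (intro fhat_integrable integrable_h b)
    show "integrable lborel (\<lambda>w. f (complex_of_real w + \<i> / 2))"
      unfolding f1 by (intro integrable_mult_right fhat_integrable integrable_h b)
    fix z assume z: "z \<in> {z. 0 \<le> Im z \<and> Im z \<le> 1 / 2}" "1 \<le> \<bar>Re z\<bar>"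
    have "l * Im z \<le> \<bar>l\<bar> * Im z"
      by (rule mult_right_mono) (use z in auto)
    also have "\<dots> \<le> \<bar>l\<bar> * (1 / 2)"
      by (rule mult_left_mono) (use z in auto)
    finally have e: "cmod (exp (- \<i> * complex_of_real l * z)) \<le> exp (\<bar>l\<bar> / 2)"
      by (simp add: norm_exp_eq_Re)
    have sh: "sinh (pi * \<bar>Re z\<bar>) = \<bar>sinh (pi * Re z)\<bar>"
    proof (cases "Re z < 0")
      case True
      then have "pi * Re z < 0" by (simp add: mult_pos_neg)
      then show ?thesis using True by simp
    next
      case False
      then have "0 \<le> pi * Re z" by simp
      then show ?thesis using False by (simp add: abs_of_nonneg)
    qed
    have "0 < sinh (pi * \<bar>Re z\<bar>)" using z by simp
    then have "sqrt pi / cmod (Dk b z) \<le> sqrt pi / sinh (pi * \<bar>Re z\<bar>)"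
      using Dk_ge_sinh[of z b] unfolding sh by (intro divide_left_mono mult_pos_pos) (auto intro: less_le_trans)
    with e have "exp (\<bar>l\<bar> / 2) * (sqrt pi / sinh (pi * \<bar>Re z\<bar>)) \<ge> cmod (f z)"
      unfolding f_def norm_mult norm_divide by (intro mult_mono) auto
    then show "cmod (f z) \<le> C / sinh (pi * \<bar>Re z\<bar>)"
      by (simp add: C_def)
  qed (rule exp_over_sinh_tendsto)
  then show ?thesis
    unfolding f0 f1 fhat_def integral_mult_right_zero by simp
qed

section \<open>Orthogonal splitting of L2 of the line in spectral coordinates, and the cut to
  [-1, 1]\<close>

section \<open>The spectral representation on the real line\<close>

definition ss :: "real \<Rightarrow> complex" where "ss l = complex_of_real (sqrt (sig l))"
definition cc :: "real \<Rightarrow> complex" where "cc l = complex_of_real (sqrt (1 - sig l))"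

lemma ss_cc_bdd [simp]: "bdd_meas ss" "bdd_meas cc"
proof -
  have "ss \<in> borel_measurable borel" "cc \<in> borel_measurable borel"
    unfolding ss_def[abs_def] cc_def[abs_def] by measurable
  moreover have "cmod (ss t) \<le> 1" "cmod (cc t) \<le> 1" for t
    using sig_bounds[of t] by (auto simp: ss_def cc_def)
  ultimately show "bdd_meas ss" "bdd_meas cc"
    by (auto simp: bdd_meas_def)
qed

lemma ss_cc: "ss t * ss t + cc t * cc t = 1" "cnj (ss t) = ss t" "cnj (cc t) = cc t"
  "ss t * ss t = complex_of_real (sig t)" "cc t * cc t = complex_of_real (1 - sig t)"
  using sig_bounds[of t] by (auto simp: ss_def cc_def simp flip: of_real_mult)

text \<open>The reason for s = 1 / (1 + exp l): this choice makes sqrt (1 - s) / sqrt s equal to exp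
  (l/2), the factor produced by \<open>fhat_h\<close>.\<close>

lemma cc_eq: "cc l = exp (complex_of_real (l / 2)) * ss l"
proof -
  have "sqrt (1 - sig l) = sqrt (exp l) * sqrt (sig l)"
    unfolding one_minus_sig by (simp add: real_sqrt_mult)
  also have "sqrt (exp l) = exp (l / 2)"
    by (simp add: real_sqrt_unique flip: exp_of_nat_mult)
  finally have "sqrt (1 - sig l) = exp (l / 2) * sqrt (sig l)" .
  then show ?thesis
    unfolding cc_def ss_def exp_of_real by simp
qed

definition Gp :: "l2 \<Rightarrow> l2" where
  "Gp x = wc J1 logw (FTi (mlt ss x)) + wc J2 logw (FTi (mlt cc x))"
definition Gm :: "l2 \<Rightarrow> l2" where
  "Gm x = wc J1 logw (FTi (mlt cc x)) - wc J2 logw (FTi (mlt ss x))"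

text \<open>With u = - tanh (pi w) the weight \<open>kap u\<close> is sqrt pi / cosh (pi w), and the
  cosh completes b + \<i> u to \<open>Dk\<close>.\<close>

lemma K1_rsv: "K1 w * rsv b (u1 w) = h1 b w"
proof -
  have k: "kap (u1 w) = sqrt pi / cosh (pi * w)"
  proof -
    have "(sinh (pi * w))\<^sup>2 + 1 \<noteq> 0" using zero_le_power2[of "sinh (pi * w)"] by linarith
    then have "1 - (tanh (pi * w))\<^sup>2 = (1 / cosh (pi * w))\<^sup>2"
      by (simp add: tanh_def power_divide divide_simps cosh_square_eq)
    then show ?thesis
      by (simp add: kap_def u1_def real_sqrt_mult real_sqrt_divide power_divide)
  qed
  have "(complex_of_real b + \<i> * complex_of_real (u1 w)) * complex_of_real (cosh (pi * w)) = Dk b (complex_of_real w)"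
    unfolding Dk_real by (simp add: complex_eq_iff u1_def tanh_def)
  then show ?thesis
    unfolding K1_def k rsv_def h1_def by (simp add: mult.commute flip: \<open>_ = Dk b (complex_of_real w)\<close>)
qed

lemma K2_rsv: 
  assumes "w \<noteq> 0"
  shows "K2 w * rsv b (u2 w) = h2 b w"
proof -
  have s0: "sinh (pi * w) \<noteq> 0" using assms by simp
  have k: "sgn (u2 w) * kap (u2 w) = - (sqrt pi / sinh (pi * w))"
  proof -
    have "(u2 w)\<^sup>2 = 1 + (1 / sinh (pi * w))\<^sup>2"
      using s0 by (simp add: u2_def tanh_def power_divide divide_simps cosh_square_eq)
    then have "kap (u2 w) = sqrt pi / \<bar>sinh (pi * w)\<bar>"
      by (simp add: kap_def real_sqrt_mult real_sqrt_divide power_divide)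
    moreover have "sgn (u2 w) = - sgn w"
      using assms by (auto simp: u2_def sgn_if tanh_real_pos_iff mult_less_0_iff zero_less_mult_iff)
    moreover have "\<bar>sinh (pi * w)\<bar> = sgn w * sinh (pi * w)"
    proof (cases "0 < w")
      case False
      with assms have "pi * w < 0" by (simp add: mult_pos_neg)
      then show ?thesis using assms False by simp
    qed simp
    ultimately show ?thesis using assms by (auto simp: sgn_if)
  qed
  have "\<i> * ((complex_of_real b + \<i> * complex_of_real (u2 w)) * complex_of_real (sinh (pi * w))) = Dk b (complex_of_real w + \<i> / 2)"
    unfolding Dk_real_half using s0 by (simp add: complex_eq_iff u2_def tanh_def)
  then have D: "Dk b (complex_of_real w + \<i> / 2)
      = \<i> * ((complex_of_real b + \<i> * complex_of_real (u2 w)) * complex_of_real (sinh (pi * w)))" ..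
  show ?thesis
    unfolding K2_def k rsv_def h2_def D by (simp add: divide_divide_eq_left[symmetric] del: divide_divide_eq_left) (simp add: mult.commute)
qed

lemma cnj_indicator [simp]: "cnj (indicator A t) = indicator A t"
  by (simp add: indicator_def)

lemma wc_J1_adjoint: "ip (wc J1 logw x) y = ip x (wc K1 u1 y)"
proof -
  have "ip (wc J1 logw x) y = ip (mlt (indicator {-1<..<1}) (wc J1 logw x)) y"
    by (simp only: J1_K1[symmetric] K1_J1)
  also have "\<dots> = ip (wc J1 logw x) (wc J1 logw (wc K1 u1 y))"
    by (simp add: ip_mlt J1_K1)
  also have "\<dots> = ip x (wc K1 u1 y)"
    by (rule bclin_isometry_ip[OF bclin_wc[OF wcomp_J1] norm_wc_J1])
  finally show ?thesis .
qed

lemma wc_J2_adjoint: "ip (wc J2 logw x) y = ip x (wc K2 u2 y)"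
proof -
  have m: "bdd_meas (indicator {u :: real. 1 < \<bar>u\<bar>})" by simp
  have "ip (wc J2 logw x) y = ip (mlt (indicator {u. 1 < \<bar>u\<bar>}) (wc J2 logw x)) y"
    by (simp only: J2_K2[symmetric] K2_J2)
  also have "\<dots> = ip (wc J2 logw x) (wc J2 logw (wc K2 u2 y))"
    by (simp only: ip_mlt[OF m] J2_K2 cnj_indicator)
  also have "\<dots> = ip x (wc K2 u2 y)"
    by (rule bclin_isometry_ip[OF bclin_wc[OF wcomp_J2] norm_wc_J2])
  finally show ?thesis .
qed

lemma K1_J2: "wc K1 u1 (wc J2 logw x) = 0"
proof -
  have "\<not> 1 < \<bar>u1 w\<bar>" for w using u1_bounds[of w] by simp
  then have "wc K1 u1 (wc J2 logw x) = mlt (indicator {}) x"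
    by (intro wc_inverse[OF wcomp_K1 wcomp_J2]) (auto simp: J2_def)
  then show ?thesis by (simp add: mlt_def zero_cls)
qed

lemma FT_ep: "0 < b \<Longrightarrow> FT (ep b) = cmul cF (cls (rsv b))"
proof -
  assume b: "0 < b"
  have "fhat (epf b) = (\<lambda>x. cF * rsv b x)" by (intro ext fhat_epf b)
  then show ?thesis
    using FT_cls[of "epf b"] b by (simp add: ep_def integrable_epf cmul_cls)
qed

lemma FTi_ep: "0 < b \<Longrightarrow> FTi (ep b) = cmul cF (refl (cls (rsv b)))"
  by (simp add: FTi_def FT_ep bclin_cmul[OF bclin_refl])

lemma FTi_refl_ep: "0 < b \<Longrightarrow> FTi (refl (ep b)) = cmul cF (cls (rsv b))"
  by (simp add: FTi_def FT_refl FT_ep)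

lemma K1_rsv_cls: "0 < b \<Longrightarrow> wc K1 u1 (cls (rsv b)) = cls (h1 b)"
  by (simp add: wc_cls[OF wcomp_K1] K1_rsv[abs_def])

lemma K2_rsv_cls:
  assumes "0 < b"
  shows "wc K2 u2 (cls (rsv b)) = cls (h2 b)"
  unfolding wc_cls[OF wcomp_K2 L2_rsv[OF assms]]
  by (rule cls_cong) (use AE_lborel_singleton[of "0 :: real"] in eventually_elim, rule K2_rsv)

lemma L2_h:
  assumes "0 < b"
  shows "h1 b \<in> L2_fun lborel" "h2 b \<in> L2_fun lborel"
proof -
  show "h1 b \<in> L2_fun lborel"
    using weighted_comp_L2(1)[OF wcomp_K1 L2_rsv[OF assms]] by (simp add: K1_rsv)
  show "h2 b \<in> L2_fun lborel"
    by (rule L2_fun_cong[OF weighted_comp_L2(1)[OF wcomp_K2 L2_rsv[OF assms]]], simp)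
       (use AE_lborel_singleton[of "0 :: real"] in eventually_elim, rule K2_rsv[symmetric])
qed

text \<open>\<open>u1\<close> and \<open>u2\<close> are odd and \<open>K2\<close> contains the sign
  of \<open>u2\<close>. The resulting factor -1 reconciles the plus sign in
  \<open>shift_identity\<close> with the minus sign in \<open>Gm\<close>.\<close>

lemma wc_K_refl:
  "wc K1 u1 (refl x) = refl (wc K1 u1 x)" "wc K2 u2 (refl x) = cmul (- 1) (refl (wc K2 u2 x))"
proof -
  have u: "u1 (- w) = - u1 w" "u2 (- w) = - u2 w" for w by (auto simp: u1_def u2_def)
  have K: "K1 (- w) = K1 w" "K2 (- w) = - K2 w" for w
    unfolding K1_def K2_def u by (auto simp: kap_def sgn_minus)
  obtain f where f: "f \<in> L2_fun lborel" "x = cls f" by (rule l2_cases)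
  show "wc K1 u1 (refl x) = refl (wc K1 u1 x)"
    using f by (simp add: refl_cls wc_cls[OF wcomp_K1] L2_fun_refl weighted_comp_L2(1)[OF wcomp_K1] u K)
  show "wc K2 u2 (refl x) = cmul (- 1) (refl (wc K2 u2 x))"
    using f L2_fun_refl[OF weighted_comp_L2(1)[OF wcomp_K2 f(1)]]
    by (simp add: refl_cls wc_cls[OF wcomp_K2] L2_fun_refl weighted_comp_L2(1)[OF wcomp_K2] u K cmul_cls)
qed

text \<open>The first identity is \<open>fhat_h\<close> at l times \<open>ss l\<close>; the second,
  for the reflected kernels, is \<open>fhat_h\<close> at -l times \<open>cc l\<close>. Both use
  \<open>cc_eq\<close>.\<close>

lemma shift_identity:
  assumes b: "0 < b"
  shows "mlt ss (FT (cls (h1 b))) + mlt cc (FT (cls (h2 b))) = 0"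
    "mlt cc (FT (refl (cls (h1 b)))) + mlt ss (FT (refl (cls (h2 b)))) = 0"
proof -
  note F = FT_cls[OF L2_h(1)[OF b] integrable_h(1)[OF b]] FT_cls[OF L2_h(2)[OF b] integrable_h(2)[OF b]]
  have "ss l * fhat (h1 b) l + cc l * fhat (h2 b) l = 0" for l
    unfolding fhat_h[OF b] cc_eq by simp
  then show "mlt ss (FT (cls (h1 b))) + mlt cc (FT (cls (h2 b))) = 0"
    by (simp add: F mlt_cls plus_cls L2_fun_mlt zero_cls)
  have "cc l * fhat (h1 b) (- l) + ss l * fhat (h2 b) (- l) = 0" for l
    unfolding fhat_h[OF b] cc_eq by (simp add: exp_minus)
  then show "mlt cc (FT (refl (cls (h1 b)))) + mlt ss (FT (refl (cls (h2 b)))) = 0"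
    by (simp add: FT_refl F refl_cls L2_fun_refl mlt_cls plus_cls L2_fun_mlt zero_cls)
qed

lemma bclin_Gp: "bclin Gp"
  unfolding Gp_def[abs_def]
  by (rule bclin_plus[OF bclin_compose[OF bclin_wc[OF wcomp_J1] bclin_compose[OF bclin_FTi bclin_mlt[OF ss_cc_bdd(1)]]]
        bclin_compose[OF bclin_wc[OF wcomp_J2] bclin_compose[OF bclin_FTi bclin_mlt[OF ss_cc_bdd(2)]]]])

lemma ip_Gp: "ip (Gp x) y = ip x (mlt ss (FT (wc K1 u1 y)) + mlt cc (FT (wc K2 u2 y)))"
  by (simp add: Gp_def ip_add_left ip_add_right wc_J1_adjoint wc_J2_adjoint ip_FTi ip_mlt ss_cc)

lemma ip_Gm: "ip (Gm x) y = ip x (mlt cc (FT (wc K1 u1 y)) - mlt ss (FT (wc K2 u2 y)))"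
  by (simp add: Gm_def ip_diff_left ip_diff_right wc_J1_adjoint wc_J2_adjoint ip_FTi ip_mlt ss_cc)

text \<open>Boundary values of functions in the Hardy space of the upper half-plane.\<close>

definition hardy :: "l2 set" where "hardy = {x. mlt (indicator {..<0}) (FT x) = 0}"

lemma mlt_neg_refl_ep: "0 < b \<Longrightarrow> mlt (indicator {..<0}) (refl (ep b)) = refl (ep b)"
  by (simp add: ep_def refl_cls mlt_cls L2_fun_refl, rule cls_cong) (auto simp: epf_def indicator_def)

lemma mlt_pos_ep: "0 < b \<Longrightarrow> mlt (indicator half_line) (ep b) = ep b"
  unfolding ep_def by (subst mlt_cls, simp, rule cls_cong) (auto simp: epf_def indicator_def)

text \<open>Vanishing of the transform on the negative half-line is tested on reflected
  exponentials, whose inverse transforms are multiples of the kernels \<open>rsv b\<close>; the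
  adjoint of \<open>Gp\<close> kills these by \<open>shift_identity\<close>.\<close>

lemma Gp_hardy: "Gp x \<in> hardy"
proof -
  have "mlt (indicator {..<0}) (FT (Gp x)) = 0"
  proof (rule closure_cspan_orthogonal_zero[OF Dneg_dense])
    fix y assume "y \<in> Dneg"
    then obtain k :: nat where "y = refl (ep (real k + 1 + 1 / 2))" unfolding Dneg_def by blast
    moreover have "0 < real k + 1 + 1 / 2" by simp
    ultimately obtain b where b: "0 < b" "y = refl (ep b)" by blast
    have "ip (mlt (indicator {..<0}) (FT (Gp x))) y = ip (FT (Gp x)) y"
      by (simp add: ip_mlt b mlt_neg_refl_ep)
    also have "\<dots> = ip (Gp x) (cmul cF (cls (rsv b)))"
      using b by (simp add: FT_adjoint FTi_refl_ep flip: FTi_def)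
    also have "\<dots> = 0"
      by (simp add: ip_cmul_right ip_Gp K1_rsv_cls K2_rsv_cls b shift_identity)
    finally show "ip (mlt (indicator {..<0}) (FT (Gp x))) y = 0" .
  qed
  then show ?thesis by (simp add: hardy_def)
qed

text \<open>The same test on the positive half-line: the inverse transforms are now the reflected
  kernels, and the adjoint of \<open>Gm\<close> kills them.\<close>

lemma Gm_hardy: "mlt (indicator half_line) (FT (Gm x)) = 0"
proof (rule closure_cspan_orthogonal_zero[OF Dpos_dense])
  fix y assume "y \<in> Dpos"
  then obtain k :: nat where "y = ep (real k + 1)" unfolding Dpos_def by blast
  moreover have "0 < real k + 1" by simp
  ultimately obtain b where b: "0 < b" "y = ep b" by blast
  have "ip (mlt (indicator half_line) (FT (Gm x))) y = ip (FT (Gm x)) y"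
    by (simp add: ip_mlt b mlt_pos_ep)
  also have "\<dots> = ip (Gm x) (cmul cF (refl (cls (rsv b))))"
    using b by (simp add: FT_adjoint FTi_ep flip: FTi_def)
  also have "\<dots> = 0"
    by (simp add: ip_cmul_right ip_Gm wc_K_refl K1_rsv_cls K2_rsv_cls b bclin_cmul[OF FT(1)]
        bclin_cmul[OF bclin_mlt] diff_eq_cmul shift_identity)
  finally show "ip (mlt (indicator half_line) (FT (Gm x))) y = 0" .
qed

text \<open>\<open>wc K1 u1\<close> and \<open>wc K2 u2\<close> recover the two pieces, so the
  adjoint of \<open>Gp\<close> takes \<open>Gp x\<close> back to (ss^2 + cc^2) x = x.\<close>

lemma Gp_isometry: "norm (Gp x) = norm x"
proof -
  have "wc K1 u1 (Gp x) = FTi (mlt ss x)"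
    by (simp add: Gp_def bclin_add[OF bclin_wc[OF wcomp_K1]] K1_J1 K1_J2)
  moreover have "wc K2 u2 (Gp x) = FTi (mlt cc x)"
  proof -
    have "K2 w * J1 (u2 w) = 0" for w
    proof (cases "w = 0")
      case False
      from u2_bounds[OF this] show ?thesis by (simp add: J1_def)
    qed (simp add: K2_def u2_def)
    then have "wc K2 u2 (wc J1 logw y) = mlt (indicator {}) y" for y
      by (intro wc_inverse[OF wcomp_K2 wcomp_J1]) auto
    then have "wc K2 u2 (wc J1 logw y) = 0" for y by (simp add: mlt_def zero_cls)
    then show ?thesis by (simp add: Gp_def bclin_add[OF bclin_wc[OF wcomp_K2]] K2_J2)
  qed
  ultimately have "ip (Gp x) (Gp x) = ip x (mlt ss (mlt ss x) + mlt cc (mlt cc x))"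
    by (simp add: ip_Gp FT_FTi)
  also have "\<dots> = ip x x"
    by (simp add: mlt_mlt mlt_add_mlt bdd_meas_mult ss_cc(1))
  finally show ?thesis
    by (simp add: ip_norm power2_eq_iff_nonneg flip: of_real_power)
qed

text \<open>The matrix with rows (ss, cc) and (cc, -ss) is symmetric and its own inverse, so
  \<open>y\<close> and \<open>z\<close> come from applying it to the transforms \<open>p\<close> and
  \<open>q\<close> of the two pieces of \<open>x\<close>.\<close>

lemma Gp_Gm_decomposition: "\<exists>y z. x = Gp y + Gm z"
proof -
  define p where "p = FT (wc K1 u1 x)"
  define q where "q = FT (wc K2 u2 x)"
  have a: "mlt ss (mlt ss p + mlt cc q) + mlt cc (mlt cc p - mlt ss q) = p"
    and b: "mlt cc (mlt ss p + mlt cc q) - mlt ss (mlt cc p - mlt ss q) = q"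
  proof -
    have e: "mlt ss (mlt ss r) + mlt cc (mlt cc r) = r" "mlt ss (mlt cc r) = mlt cc (mlt ss r)" for r
      by (simp_all add: mlt_mlt mlt_add_mlt bdd_meas_mult ss_cc(1)) (simp add: mult.commute)
    show "mlt ss (mlt ss p + mlt cc q) + mlt cc (mlt cc p - mlt ss q) = p"
      using e(1)[of p] by (simp add: bclin_add[OF bclin_mlt] bclin_diff[OF bclin_mlt] e(2))
    show "mlt cc (mlt ss p + mlt cc q) - mlt ss (mlt cc p - mlt ss q) = q"
      using e(1)[of q] by (simp add: bclin_add[OF bclin_mlt] bclin_diff[OF bclin_mlt] e(2) add.commute)
  qed
  have "Gp (mlt ss p + mlt cc q) + Gm (mlt cc p - mlt ss q)
      = wc J1 logw (FTi (mlt ss (mlt ss p + mlt cc q) + mlt cc (mlt cc p - mlt ss q)))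
      + wc J2 logw (FTi (mlt cc (mlt ss p + mlt cc q) - mlt ss (mlt cc p - mlt ss q)))"
    unfolding Gp_def Gm_def
    by (simp only: bclin_add[OF bclin_FTi] bclin_diff[OF bclin_FTi] bclin_add[OF bclin_wc[OF wcomp_J1]]
        bclin_diff[OF bclin_wc[OF wcomp_J2]]) (simp add: algebra_simps)
  also have "\<dots> = mlt (indicator {-1<..<1}) x + mlt (indicator {u. 1 < \<bar>u\<bar>}) x"
    unfolding a b by (simp add: p_def q_def FTi_FT J1_K1 J2_K2)
  also have "\<dots> = mlt (\<lambda>u. indicator {-1<..<1} u + indicator {u. 1 < \<bar>u\<bar>} u) x"
    by (rule mlt_add_mlt) auto
  also have "\<dots> = cls (rep x)"
    unfolding mlt_def
  proof (rule cls_cong)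
    show "AE u in lborel. (indicator {-1<..<1} u + indicator {u. 1 < \<bar>u\<bar>} u) * rep x u = rep x u"
      using AE_lborel_singleton[of "1 :: real"] AE_lborel_singleton[of "- 1 :: real"]
      by eventually_elim (auto simp: indicator_def abs_if split: if_splits)
  qed
  finally show ?thesis by (metis cls_rep)
qed

text \<open>When a member of \<open>hardy\<close> is decomposed as \<open>Gp y + Gm z\<close>, the
  transform of \<open>Gm z\<close> vanishes on both half-lines.\<close>

lemma Gp_surj:
  assumes "x \<in> hardy"
  obtains y where "x = Gp y"
proof -
  obtain y z where x: "x = Gp y + Gm z" using Gp_Gm_decomposition by blast
  have "mlt (indicator {..<0}) (FT (Gm z)) = 0"
    using assms Gp_hardy[of y] unfolding hardy_def x
    by (simp add: bclin_add[OF FT(1)] bclin_add[OF bclin_mlt])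
  then have "FT (Gm z) = 0"
    using mlt_pos_neg[of "FT (Gm z)"] Gm_hardy[of z] by simp
  then have "Gm z = 0"
    using FTi_FT[of "Gm z"] by (simp add: bclin_0[OF bclin_FTi])
  then show ?thesis using that x by simp
qed

definition sg :: "real \<Rightarrow> complex" where "sg l = complex_of_real (sig l)"

lemma sg_bdd [simp]: "bdd_meas sg"
proof -
  have "(\<lambda>l. ss l * ss l) = sg" by (simp add: sg_def ss_cc fun_eq_iff)
  then show ?thesis using bdd_meas_mult[OF ss_cc_bdd(1) ss_cc_bdd(1)] by simp
qed

lemma cut_Gp:
  "wc J1 logw (FTi (mlt ss x)) = Gp (mlt sg x) + Gm (mlt (\<lambda>l. ss l * cc l) x)"
proof -
  have sc: "bdd_meas (\<lambda>l. ss l * cc l)" by (intro bdd_meas_mult ss_cc_bdd)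
  have "(\<lambda>l. ss l * sg l + cc l * (ss l * cc l)) = ss"
  proof
    fix l
    have "ss l * sg l + cc l * (ss l * cc l) = ss l * (ss l * ss l + cc l * cc l)"
      by (simp add: sg_def ss_cc(4)[symmetric] algebra_simps)
    then show "ss l * sg l + cc l * (ss l * cc l) = ss l" by (simp add: ss_cc(1))
  qed
  then have 1: "mlt ss (mlt sg x) + mlt cc (mlt (\<lambda>l. ss l * cc l) x) = mlt ss x"
    by (simp add: mlt_mlt sc mlt_add_mlt bdd_meas_mult)
  \<comment> \<open>Outside [-1, 1] the \<open>Gp\<close> term and the \<open>Gm\<close> term
    cancel; this is the equality of their multipliers.\<close>
  have "(\<lambda>l. cc l * sg l) = (\<lambda>l. ss l * (ss l * cc l))"
    by (simp add: sg_def ss_cc(4)[symmetric] fun_eq_iff)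
  then have 2: "mlt cc (mlt sg x) = mlt ss (mlt (\<lambda>l. ss l * cc l) x)"
    by (simp add: mlt_mlt sc)
  show ?thesis
    unfolding Gp_def Gm_def 1[symmetric] 2
    by (simp add: bclin_add[OF bclin_FTi] bclin_add[OF bclin_wc[OF wcomp_J1]])
qed

lemma mlt_cut_Gp: "mlt (indicator {-1..1}) (Gp x) = wc J1 logw (FTi (mlt ss x))"
proof -
  have a: "mlt (indicator {-1..1}) (wc J1 logw y) = wc J1 logw y" for y
    unfolding wc_def mlt_cls[OF weighted_comp_L2(1)[OF wcomp_J1 rep_L2]]
    by (rule cls_cong) (auto simp: J1_def indicator_def abs_less_iff)
  have b: "mlt (indicator {-1..1}) (wc J2 logw y) = 0" for y
    unfolding wc_def mlt_cls[OF weighted_comp_L2(1)[OF wcomp_J2 rep_L2]] zero_cls[symmetric]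
    by (rule cls_cong) (auto simp: J2_def indicator_def abs_if)
  show ?thesis
    unfolding Gp_def by (simp add: bclin_add[OF bclin_mlt] a b)
qed

section \<open>Transfer between classes on an arbitrary measure space and \<open>l2\<close>\<close>

section \<open>Realising \<open>L\<^sup>2\<close> spaces inside \<open>L\<^sup>2\<close> of the line\<close>

text \<open>A weighted composition on classes, with values in \<open>l2\<close>. Under
  \<open>model\<close> the set \<open>S\<close> is the whole space, so nothing is lost and the
  embedding is isometric.\<close>

definition emb :: "(real \<Rightarrow> complex) \<Rightarrow> (real \<Rightarrow> 'a) \<Rightarrow> ('a \<Rightarrow> complex) set \<Rightarrow> l2" where
  "emb J \<phi> F = cls (\<lambda>x. J x * L2_rep F (\<phi> x))"

abbreviation model :: "'a measure \<Rightarrow> (real \<Rightarrow> complex) \<Rightarrow> (real \<Rightarrow> 'a) \<Rightarrow> bool" where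
  "model M J \<phi> \<equiv> weighted_comp lborel M J \<phi> (space M)"

lemma emb_class:
  assumes "model M J \<phi>" "f \<in> L2_fun M"
  shows "emb J \<phi> (L2_class M f) = cls (\<lambda>x. J x * f (\<phi> x))"
  unfolding emb_def by (rule cls_cong, rule weighted_comp_cong[OF assms(1)], rule L2_rep_class(2)[OF assms(2)])

lemma L2_op_in:
  assumes "F \<in> L2 M" "G \<in> L2 M"
  shows "L2_add M F G \<in> L2 M" "L2_diff M F G \<in> L2 M" "L2_scale M c F \<in> L2 M"
  unfolding L2_add_def L2_diff_def L2_scale_def mult_op_def
  using assms by (auto intro!: L2_class_in L2_fun_add L2_fun_diff L2_fun_cmult L2_rep_in)

context
  fixes M :: "'a measure" and J :: "real \<Rightarrow> complex" and \<phi> :: "real \<Rightarrow> 'a"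
  assumes W: "model M J \<phi>"
begin

lemma emb_add: "F \<in> L2 M \<Longrightarrow> G \<in> L2 M \<Longrightarrow> emb J \<phi> (L2_add M F G) = emb J \<phi> F + emb J \<phi> G"
  unfolding L2_add_def
  by (subst emb_class[OF W]) (auto simp: emb_def plus_cls weighted_comp_L2(1)[OF W] L2_rep_in L2_fun_add distrib_left)

lemma emb_diff: "F \<in> L2 M \<Longrightarrow> G \<in> L2 M \<Longrightarrow> emb J \<phi> (L2_diff M F G) = emb J \<phi> F - emb J \<phi> G"
  unfolding L2_diff_def
  by (subst emb_class[OF W]) (auto simp: emb_def minus_cls weighted_comp_L2(1)[OF W] L2_rep_in L2_fun_diff right_diff_distrib)

lemma emb_scale: "F \<in> L2 M \<Longrightarrow> emb J \<phi> (L2_scale M c F) = cmul c (emb J \<phi> F)"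
  unfolding L2_scale_def mult_op_def
  by (subst emb_class[OF W]) (auto simp: emb_def cmul_cls weighted_comp_L2(1)[OF W] L2_rep_in L2_fun_cmult mult.left_commute)

lemma emb_inner:
  assumes "F \<in> L2 M" "G \<in> L2 M"
  shows "ip (emb J \<phi> F) (emb J \<phi> G) = L2_inner M F G"
proof -
  note [measurable] = L2_fun_measurable[OF L2_rep_in[OF assms(1)]] L2_fun_measurable[OF L2_rep_in[OF assms(2)]]
  have "ip (emb J \<phi> F) (emb J \<phi> G) = (LINT x|lborel. (J x * cnj (J x)) * (L2_rep F (\<phi> x) * cnj (L2_rep G (\<phi> x))))"
    unfolding emb_def using assms by (subst ip_cls) (auto simp: weighted_comp_L2(1)[OF W] L2_rep_in mult_ac)
  also have "\<dots> = (LINT x|M. indicator (space M) x * (L2_rep F x * cnj (L2_rep G x)))"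
    by (rule weighted_comp_integral[OF W, of "\<lambda>x. L2_rep F x * cnj (L2_rep G x)"]) measurable
  also have "\<dots> = L2_inner M F G"
    unfolding L2_inner_def by (intro Bochner_Integration.integral_cong) auto
  finally show ?thesis .
qed

lemma L2_norm_inner: "(L2_norm M F)\<^sup>2 = Re (L2_inner M F F)"
proof -
  have "L2_inner M F F = complex_of_real (LINT x|M. (cmod (L2_rep F x))\<^sup>2)"
    unfolding L2_inner_def integral_complex_of_real[symmetric] by (simp only: complex_norm_square)
  then show ?thesis by (simp add: L2_norm_def)
qed

lemma norm_emb: "F \<in> L2 M \<Longrightarrow> norm (emb J \<phi> F) = L2_norm M F"
proof -
  assume F: "F \<in> L2 M"
  have "(norm (emb J \<phi> F))\<^sup>2 = (L2_norm M F)\<^sup>2"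
    unfolding L2_norm_inner emb_inner[OF F F, symmetric] ip_norm by simp
  then show ?thesis by (rule power2_eq_imp_eq) (auto simp: L2_norm_def)
qed

lemma L2_norm_diff: "F \<in> L2 M \<Longrightarrow> G \<in> L2 M \<Longrightarrow> L2_norm M (L2_diff M F G) = norm (emb J \<phi> F - emb J \<phi> G)"
  by (simp add: norm_emb[symmetric] L2_op_in emb_diff)

lemma emb_inj: 
  assumes "F \<in> L2 M" "G \<in> L2 M" "emb J \<phi> F = emb J \<phi> G"
  shows "F = G"
proof -
  let ?d = "\<lambda>x. L2_rep F x - L2_rep G x"
  have d: "?d \<in> L2_fun M" using assms by (intro L2_fun_diff L2_rep_in)
  have "L2_norm M (L2_diff M F G) = 0"
    using assms by (simp add: L2_norm_diff)
  then have "(LINT x|M. (cmod (L2_rep (L2_diff M F G) x))\<^sup>2) = 0"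
    by (simp add: L2_norm_def)
  then have "AE x in M. (cmod (L2_rep (L2_diff M F G) x))\<^sup>2 = 0"
    using L2_rep_in[OF L2_op_in(2)[OF assms(1,2)]]
    by (subst (asm) integral_nonneg_eq_0_iff_AE) (auto simp: L2_fun_def)
  moreover have "AE x in M. L2_rep (L2_diff M F G) x = ?d x"
    unfolding L2_diff_def by (rule L2_rep_class(2)[OF d])
  ultimately have "AE x in M. L2_rep F x = L2_rep G x"
    by eventually_elim simp
  then have "L2_class M (L2_rep F) = L2_class M (L2_rep G)"
    by (rule L2_class_cong)
  then show ?thesis using assms by (simp add: L2_class_rep)
qed

end

subsection \<open>Subsets of the line\<close>

text \<open>The substitution has to send the whole line into \<open>S\<close>; points outside
  \<open>S\<close>, where the weight is 0, go to the default value \<open>c\<close>.\<close>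

lemma model_restrict:
  fixes S :: "real set"
  assumes [measurable]: "S \<in> sets borel" and c: "c \<in> S"
  shows "model (restrict_space lborel S) (indicator S) (\<lambda>x. if x \<in> S then x else c)"
  unfolding weighted_comp_def
proof (intro conjI)
  let ?M = "restrict_space lborel S" and ?\<phi> = "\<lambda>x. if x \<in> S then x else c"
  show m: "?\<phi> \<in> measurable lborel ?M"
    by (rule measurable_restrict_space2) (use c in auto)
  show "distr (density lborel (\<lambda>u. ennreal ((cmod (indicator S u))\<^sup>2))) ?M ?\<phi> = density ?M (indicator (space ?M))"
  proof (rule measure_eqI)
    fix A assume "A \<in> sets (distr (density lborel (\<lambda>u. ennreal ((cmod (indicator S u))\<^sup>2))) ?M ?\<phi>)"
    then have A: "A \<in> sets ?M" by simp
    then have A': "A \<subseteq> S" "A \<in> sets borel"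
      by (auto simp: sets_restrict_space)
    have "emeasure (distr (density lborel (\<lambda>u. ennreal ((cmod (indicator S u))\<^sup>2))) ?M ?\<phi>) A
        = (\<integral>\<^sup>+x. ennreal ((cmod (indicator S x))\<^sup>2) * indicator (?\<phi> -` A) x \<partial>lborel)"
      using measurable_sets[OF m A] m A by (subst emeasure_distr, simp, simp, subst emeasure_density) auto
    also have "\<dots> = (\<integral>\<^sup>+x. indicator A x \<partial>lborel)"
      using A' by (intro nn_integral_cong) (auto simp: indicator_def)
    also have "\<dots> = emeasure lborel A" using A' by simp
    also have "\<dots> = emeasure ?M A"
      using A' by (subst emeasure_restrict_space) auto
    also have "\<dots> = emeasure (density ?M (indicator (space ?M))) A"
    proof (subst emeasure_density)
      have "(\<integral>\<^sup>+x. indicator (space ?M) x * indicator A x \<partial>?M) = (\<integral>\<^sup>+x. indicator A x \<partial>?M)"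
        by (intro nn_integral_cong) auto
      then show "emeasure ?M A = (\<integral>\<^sup>+x. indicator (space ?M) x * indicator A x \<partial>?M)"
        using A by simp
      show "indicator (space ?M) \<in> borel_measurable ?M"
        by (rule borel_measurable_indicator[OF sets.top])
    qed (use A in simp)
    finally show "emeasure (distr (density lborel (\<lambda>u. ennreal ((cmod (indicator S u))\<^sup>2))) ?M ?\<phi>) A
        = emeasure (density ?M (indicator (space ?M))) A" .
  qed simp
  show "space ?M \<in> sets ?M" by (rule sets.top)
qed simp

lemma L2_fun_restrict:
  assumes [measurable]: "S \<in> sets borel" and f: "f \<in> L2_fun lborel"
  shows "f \<in> L2_fun (restrict_space lborel S)"
proof -
  have [measurable]: "f \<in> borel_measurable borel" using L2_fun_measurable[OF f] by simp
  have "integrable lborel (\<lambda>x. indicator S x *\<^sub>R (cmod (f x))\<^sup>2)"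
    using f by (intro integrable_mult_indicator) (auto simp: L2_fun_def)
  then show ?thesis
    unfolding L2_fun_def
    by (simp add: integrable_restrict_space measurable_restrict_space1 set_integrable_def)
qed

lemma emb_restrict:
  assumes "S \<in> sets borel" "c \<in> S" "f \<in> L2_fun lborel"
  shows "emb (indicator S) (\<lambda>x. if x \<in> S then x else c) (L2_class (restrict_space lborel S) f) = mlt (indicator S) (cls f)"
  by (simp add: emb_class[OF model_restrict] assms L2_fun_restrict mlt_cls)
     (auto intro!: cls_cong simp: indicator_def)

lemma mlt_emb_restrict:
  assumes "S \<in> sets borel" "c \<in> S" "F \<in> L2 (restrict_space lborel S)"
  shows "mlt (indicator S) (emb (indicator S) (\<lambda>x. if x \<in> S then x else c) F) = emb (indicator S) (\<lambda>x. if x \<in> S then x else c) F"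
  unfolding emb_def
  by (subst mlt_cls, rule weighted_comp_L2(1)[OF model_restrict L2_rep_in]) (use assms in \<open>auto intro!: cls_cong simp: indicator_def\<close>)

lemma model_lborel: "model lborel (\<lambda>x. 1) (\<lambda>x. x)"
  unfolding weighted_comp_def
  by (auto intro!: measure_eqI simp: emeasure_distr emeasure_density)

lemma emb_lborel: "F \<in> L2 lborel \<Longrightarrow> set_of (emb (\<lambda>x. 1) (\<lambda>x. x) F) = F"
  by (simp add: emb_def set_of_cls L2_rep_in L2_class_rep)

lemma emb_set_of: "emb (\<lambda>x. 1) (\<lambda>x. x) (set_of x) = x"
  by (simp add: emb_def flip: rep_def)

section \<open>The Cayley transform between the circle and the line\<close>

subsection \<open>The circle\<close>

lemma space_circle [simp]: "space circle_measure = sphere 0 1"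
  by (simp add: circle_measure_def space_restrict_space)

lemma sets_circle: "sets circle_measure = sets (restrict_space borel (sphere 0 1))"
  by (simp add: circle_measure_def)

lemma measurable_circle_iff: "f \<in> measurable lborel circle_measure \<longleftrightarrow> f \<in> borel_measurable borel \<and> (\<forall>x::real. cmod (f x) = 1)"
proof -
  have "f \<in> measurable lborel circle_measure \<longleftrightarrow> f \<in> measurable borel (restrict_space borel (sphere 0 1))"
    unfolding measurable_cong_sets[OF sets_lborel sets_circle] ..
  then show ?thesis
    by (auto simp: measurable_restrict_space2_iff dist_norm)
qed

lemma measurable_from_circle: "f \<in> borel_measurable borel \<Longrightarrow> f \<in> borel_measurable circle_measure"
  unfolding measurable_cong_sets[OF sets_circle refl] by (rule measurable_restrict_space1)

text \<open>The window from a to a + 2 pi is cut at 2 pi, and its second part is moved back by one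
  period.\<close>

lemma nn_integral_periodic_shift:
  fixes h :: "real \<Rightarrow> ennreal"
  assumes [measurable]: "h \<in> borel_measurable borel" and per: "\<And>x. h (x + 2 * pi) = h x"
    and a: "0 \<le> a" "a < 2 * pi"
  shows "(\<integral>\<^sup>+x. h (a + x) * indicator {0..<2 * pi} x \<partial>lborel) = (\<integral>\<^sup>+x. h x * indicator {0..<2 * pi} x \<partial>lborel)"
proof -
  have "(\<integral>\<^sup>+x. h x * indicator {a..<a + 2 * pi} x \<partial>lborel)
      = (\<integral>\<^sup>+x. h (a + 1 * x) * indicator {a..<a + 2 * pi} (a + 1 * x) \<partial>lborel)"
    using nn_integral_real_affine[of "\<lambda>x. h x * indicator {a..<a + 2 * pi} x" 1 a] by simp
  then have "(\<integral>\<^sup>+x. h (a + x) * indicator {0..<2 * pi} x \<partial>lborel) = (\<integral>\<^sup>+x. h x * indicator {a..<a + 2 * pi} x \<partial>lborel)"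
    by (simp add: indicator_def)
  also have "\<dots> = (\<integral>\<^sup>+x. h x * indicator {a..<2 * pi} x + h x * indicator {2 * pi..<a + 2 * pi} x \<partial>lborel)"
    using a by (intro nn_integral_cong) (auto simp: indicator_def)
  also have "\<dots> = (\<integral>\<^sup>+x. h x * indicator {a..<2 * pi} x \<partial>lborel) + (\<integral>\<^sup>+x. h x * indicator {2 * pi..<a + 2 * pi} x \<partial>lborel)"
    by (rule nn_integral_add) auto
  also have "(\<integral>\<^sup>+x. h x * indicator {2 * pi..<a + 2 * pi} x \<partial>lborel)
      = (\<integral>\<^sup>+x. h (2 * pi + 1 * x) * indicator {2 * pi..<a + 2 * pi} (2 * pi + 1 * x) \<partial>lborel)"
    using nn_integral_real_affine[of "\<lambda>x. h x * indicator {2 * pi..<a + 2 * pi} x" 1 "2 * pi"] by simp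
  also have "\<dots> = (\<integral>\<^sup>+x. h x * indicator {0..<a} x \<partial>lborel)"
    using per by (intro nn_integral_cong) (auto simp: indicator_def add.commute)
  also have "(\<integral>\<^sup>+x. h x * indicator {a..<2 * pi} x \<partial>lborel) + (\<integral>\<^sup>+x. h x * indicator {0..<a} x \<partial>lborel)
      = (\<integral>\<^sup>+x. h x * indicator {a..<2 * pi} x + h x * indicator {0..<a} x \<partial>lborel)"
    by (rule nn_integral_add[symmetric]) auto
  also have "\<dots> = (\<integral>\<^sup>+x. h x * indicator {0..<2 * pi} x \<partial>lborel)"
    using a by (intro nn_integral_cong) (auto simp: indicator_def)
  finally show ?thesis .
qed

locale circle_arc =
  fixes \<alpha> \<beta> t :: real
  assumes \<alpha>: "0 \<le> \<alpha>" "\<alpha> < 2 * pi" and \<beta>: "0 < \<beta>" "\<beta> < pi" and t_def: "t = tan (\<beta> / 2)"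
begin

lemma t_pos: "0 < t"
  unfolding t_def using \<beta> by (intro tan_gt_zero) auto

text \<open>The angle of \<open>zet x\<close>. It increases from 0 to 2 pi along the line, so
  \<open>zet\<close> covers the circle except the point 1, which belongs to infinity.\<close>

definition psi :: "real \<Rightarrow> real" where "psi x = pi + 2 * arctan (x / t)"

definition zet :: "real \<Rightarrow> complex" where
  "zet x = (complex_of_real x - \<i> * complex_of_real t) / (complex_of_real x + \<i> * complex_of_real t)"

text \<open>The reciprocal of the weight \<open>Xw\<close> of \<open>X_op\<close> along
  \<open>chi\<close> (see \<open>Jc_Xw\<close>). Its squared modulus is the derivative of
  \<open>psi\<close> over 2 pi, the density of normalized Lebesgue measure in the coordinate
  x.\<close>

definition Jc :: "real \<Rightarrow> complex" where
  "Jc x = \<i> * complex_of_real (sqrt (2 * t)) / (complex_of_real (sqrt (2 * pi)) * (complex_of_real x + \<i> * complex_of_real t))"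

definition Xw :: "complex \<Rightarrow> complex" where
  "Xw z = complex_of_real (sqrt (2 * pi)) * cis \<alpha> * (complex_of_real (sqrt (2 * t)) / (- z + cis \<alpha>))"

lemma xit_nz: "complex_of_real x + \<i> * complex_of_real t \<noteq> 0"
  using t_pos by (auto simp: complex_eq_iff)

lemma chi_zet: "chi \<alpha> \<beta> x = cis \<alpha> * zet x"
  by (simp add: chi_def zet_def t_def[symmetric])

text \<open>With y = x / t one has zet x = - (1 + \<i> y)^2 / (1 + y^2), and 1 + \<i> y has the
  argument arctan y.\<close>

lemma zet_psi: "zet x = cis (psi x)"
proof -
  define y where "y = x / t"
  have x: "x = t * y" using t_pos by (simp add: y_def)
  have s: "cos (arctan y) = 1 / sqrt (1 + y\<^sup>2)" "sin (arctan y) = y / sqrt (1 + y\<^sup>2)"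
    by (simp_all add: cos_arctan sin_arctan)
  have pos: "0 < 1 + y\<^sup>2" by (simp add: add_pos_nonneg)
  have "cis (psi x) = - (cis (arctan y))\<^sup>2"
  proof -
    have "cis (psi x) = cis pi * (cis (arctan y) * cis (arctan y))"
      by (simp only: cis_mult psi_def y_def mult_2)
    then show ?thesis by (simp add: power2_eq_square)
  qed
  also have "(cis (arctan y))\<^sup>2 = (Complex 1 y)\<^sup>2 / complex_of_real (1 + y\<^sup>2)"
  proof -
    have "cis (arctan y) = Complex 1 y / complex_of_real (sqrt (1 + y\<^sup>2))"
      by (simp add: complex_eq_iff s)
    then show ?thesis using pos by (simp add: power_divide flip: of_real_power)
  qed
  also have "- ((Complex 1 y)\<^sup>2 / complex_of_real (1 + y\<^sup>2)) = zet x"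
  proof -
    have n: "complex_of_real (1 + y\<^sup>2) = Complex 1 y * Complex 1 (- y)"
      by (simp add: complex_eq_iff power2_eq_square)
    have nz: "Complex 1 y \<noteq> 0" "Complex 1 (- y) \<noteq> 0" by (auto simp: complex_eq_iff)
    have z: "complex_of_real x - \<i> * complex_of_real t = - (\<i> * t) * Complex 1 y"
      "complex_of_real x + \<i> * complex_of_real t = \<i> * t * Complex 1 (- y)"
      by (simp_all add: complex_eq_iff x)
    show ?thesis
      unfolding zet_def n z using nz t_pos by (simp add: power2_eq_square)
  qed
  finally show ?thesis by simp
qed

lemma norm_zet [simp]: "cmod (zet x) = 1"
  by (simp add: zet_psi)

lemma psi_bounds: "0 < psi x" "psi x < 2 * pi"
  using arctan_bounded[of "x / t"] by (auto simp: psi_def)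

lemma cmod_Jc: "(cmod (Jc x))\<^sup>2 = (1 / (2 * pi)) * (2 * t / (t\<^sup>2 + x\<^sup>2))"
  using t_pos
  by (simp add: Jc_def norm_divide norm_mult power_divide power_mult_distrib cmod_power2[of "_ + \<i> * _"] add.commute)

lemma wcomp_psi: "wcomp (\<lambda>x. complex_of_real (sqrt (2 * pi)) * Jc x) psi {0<..<2 * pi}"
proof (rule weighted_comp_change_of_variables[where g' = "\<lambda>x. 2 * t / (t\<^sup>2 + x\<^sup>2)" and S = UNIV])
  show "(psi has_real_derivative 2 * t / (t\<^sup>2 + x\<^sup>2)) (at x)" for x
  proof -
    have "(psi has_real_derivative 2 * ((1 / (1 + (x / t)\<^sup>2)) * (1 / t))) (at x)"
      unfolding psi_def[abs_def] using t_pos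
      by (auto intro!: derivative_eq_intros simp: inverse_eq_divide)
    also have "2 * ((1 / (1 + (x / t)\<^sup>2)) * (1 / t)) = 2 * t / (t\<^sup>2 + x\<^sup>2)"
    proof -
      have "1 + (x / t)\<^sup>2 = (t\<^sup>2 + x\<^sup>2) / t\<^sup>2"
        using t_pos by (simp add: power_divide add_divide_distrib)
      then show ?thesis using t_pos by (simp add: power2_eq_square)
    qed
    finally show ?thesis .
  qed
  show "inj_on psi UNIV" using t_pos by (auto simp: inj_on_def psi_def arctan_eq_iff)
  show "range psi = {0<..<2 * pi}"
  proof (rule image_eq_of_inverse[where h = "\<lambda>y. t * tan ((y - pi) / 2)"])
    show "psi x \<in> {0<..<2 * pi}" for x using psi_bounds by simp
    fix y assume "y \<in> {0<..<2 * pi}"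
    then show "t * tan ((y - pi) / 2) \<in> UNIV \<and> psi (t * tan ((y - pi) / 2)) = y"
      using t_pos by (auto simp: psi_def arctan_tan field_simps)
  qed
  show "(cmod (complex_of_real (sqrt (2 * pi)) * Jc x))\<^sup>2 = indicator UNIV x * \<bar>2 * t / (t\<^sup>2 + x\<^sup>2)\<bar>" for x
    using t_pos by (simp add: norm_mult power_mult_distrib cmod_Jc)
  show "psi \<in> borel_measurable borel"
    unfolding psi_def[abs_def]
    by (intro borel_measurable_continuous_onI continuous_intros) (use t_pos in auto)
qed (auto simp: Jc_def[abs_def])

lemma Jc_measurable [measurable]: "Jc \<in> borel_measurable borel"
  unfolding Jc_def[abs_def] by measurable

lemma zet_measurable [measurable]: "zet \<in> borel_measurable borel"
  unfolding zet_def[abs_def] by measurable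

lemma chi_measurable: "chi \<alpha> \<beta> \<in> measurable lborel circle_measure"
  unfolding measurable_circle_iff chi_zet[abs_def] by (auto simp: norm_mult)

lemma emeasure_circle:
  assumes A: "A \<in> sets circle_measure"
  shows "emeasure circle_measure A = (\<integral>\<^sup>+x. indicator A (cis x) * indicator {0..<2 * pi} x \<partial>lborel) / ennreal (2 * pi)"
proof -
  have A': "A \<in> sets (restrict_space borel (sphere 0 1))" using A by (simp add: sets_circle)
  have m: "cis \<in> measurable borel (restrict_space borel (sphere 0 1))"
    by (rule measurable_restrict_space2) (auto intro!: borel_measurable_continuous_onI continuous_intros)
  have m': "cis \<in> measurable (uniform_measure lborel {0..<2 * pi}) (restrict_space borel (sphere 0 1))"
    using m by simp
  have [measurable]: "cis -` A \<in> sets borel"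
    using measurable_sets[OF m A'] by simp
  have "emeasure circle_measure A = emeasure lborel ({0..<2 * pi} \<inter> cis -` A) / emeasure lborel {0..<2 * pi}"
    unfolding circle_measure_def using A' m'
    by (subst emeasure_distr) (auto simp: emeasure_uniform_measure)
  also have "emeasure lborel ({0..<2 * pi} \<inter> cis -` A) = (\<integral>\<^sup>+x. indicator ({0..<2 * pi} \<inter> cis -` A) x \<partial>lborel)"
    by (rule nn_integral_indicator[symmetric]) auto
  also have "\<dots> = (\<integral>\<^sup>+x. indicator A (cis x) * indicator {0..<2 * pi} x \<partial>lborel)"
    by (intro nn_integral_cong) (auto simp: indicator_def)
  finally show ?thesis by simp
qed

text \<open>\<open>wcomp_psi\<close> carries |Jc|^2 dx to the uniform measure of the angle; the
  rotation by \<alpha> is absorbed by \<open>nn_integral_periodic_shift\<close>. The angle 0, which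
  \<open>psi\<close> does not attain, is a null set.\<close>

lemma model_circle: "model circle_measure Jc (chi \<alpha> \<beta>)"
  unfolding weighted_comp_def
proof (intro conjI)
  let ?M = circle_measure
  show "distr (density lborel (\<lambda>u. ennreal ((cmod (Jc u))\<^sup>2))) ?M (chi \<alpha> \<beta>) = density ?M (indicator (space ?M))"
  proof (rule measure_eqI)
    fix A assume "A \<in> sets (distr (density lborel (\<lambda>u. ennreal ((cmod (Jc u))\<^sup>2))) ?M (chi \<alpha> \<beta>))"
    then have A: "A \<in> sets ?M" by simp
    define g where "g x = (indicator A (cis x) :: ennreal)" for x
    have "A \<in> sets borel"
      using A unfolding sets_circle by (auto simp: sets_restrict_space)
    then have [measurable]: "g \<in> borel_measurable borel"
      unfolding g_def
      by (intro measurable_compose[OF borel_measurable_continuous_onI borel_measurable_indicator] continuous_intros)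
    have chi: "chi \<alpha> \<beta> x = cis (\<alpha> + psi x)" for x
      by (simp add: chi_zet zet_psi cis_mult)
    have per: "g (x + 2 * pi) = g x" for x
      by (simp add: g_def cis.ctr)
    have "emeasure (distr (density lborel (\<lambda>u. ennreal ((cmod (Jc u))\<^sup>2))) ?M (chi \<alpha> \<beta>)) A
        = (\<integral>\<^sup>+x. ennreal ((cmod (Jc x))\<^sup>2) * indicator (chi \<alpha> \<beta> -` A) x \<partial>lborel)"
      using measurable_sets[OF chi_measurable A] chi_measurable A
      by (subst emeasure_distr, simp, simp, subst emeasure_density) auto
    also have "\<dots> = (\<integral>\<^sup>+x. (ennreal ((cmod (complex_of_real (sqrt (2 * pi)) * Jc x))\<^sup>2) * g (\<alpha> + psi x)) / ennreal (2 * pi) \<partial>lborel)"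
    proof (intro nn_integral_cong)
      fix x
      have "ennreal ((cmod (Jc x))\<^sup>2) = ennreal ((cmod (complex_of_real (sqrt (2 * pi)) * Jc x))\<^sup>2) / ennreal (2 * pi)"
        by (subst divide_ennreal) (auto simp: norm_mult power_mult_distrib)
      moreover have "indicator (chi \<alpha> \<beta> -` A) x = g (\<alpha> + psi x)"
        by (simp add: g_def chi indicator_def)
      ultimately show "ennreal ((cmod (Jc x))\<^sup>2) * indicator (chi \<alpha> \<beta> -` A) x
          = (ennreal ((cmod (complex_of_real (sqrt (2 * pi)) * Jc x))\<^sup>2) * g (\<alpha> + psi x)) / ennreal (2 * pi)"
        by (simp add: divide_ennreal_def mult_ac)
    qed
    also have "\<dots> = (\<integral>\<^sup>+x. (ennreal ((cmod (complex_of_real (sqrt (2 * pi)) * Jc x))\<^sup>2) * g (\<alpha> + psi x)) \<partial>lborel) / ennreal (2 * pi)"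
      using weighted_compD(2)[OF wcomp_psi] by (intro nn_integral_divide) auto
    also have "(\<integral>\<^sup>+x. (ennreal ((cmod (complex_of_real (sqrt (2 * pi)) * Jc x))\<^sup>2) * g (\<alpha> + psi x)) \<partial>lborel)
        = (\<integral>\<^sup>+x. indicator {0<..<2 * pi} x * g (\<alpha> + x) \<partial>lborel)"
      by (rule weighted_comp_nn_integral[OF wcomp_psi, of "\<lambda>x. g (\<alpha> + x)"]) measurable
    also have "\<dots> = (\<integral>\<^sup>+x. g (\<alpha> + x) * indicator {0..<2 * pi} x \<partial>lborel)"
      by (rule nn_integral_cong_AE) (use AE_lborel_singleton[of "0 :: real"] in eventually_elim, auto simp: indicator_def)
    also have "\<dots> = (\<integral>\<^sup>+x. g x * indicator {0..<2 * pi} x \<partial>lborel)"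
      by (rule nn_integral_periodic_shift) (use \<alpha> per in auto)
    also have "\<dots> / ennreal (2 * pi) = emeasure ?M A"
      unfolding g_def by (rule emeasure_circle[OF A, symmetric])
    also have "\<dots> = emeasure (density ?M (indicator (space ?M))) A"
    proof (subst emeasure_density)
      have "(\<integral>\<^sup>+x. indicator (space ?M) x * indicator A x \<partial>?M) = (\<integral>\<^sup>+x. indicator A x \<partial>?M)"
        by (intro nn_integral_cong) auto
      then show "emeasure ?M A = (\<integral>\<^sup>+x. indicator (space ?M) x * indicator A x \<partial>?M)"
        using A by simp
      show "indicator (space ?M) \<in> borel_measurable ?M"
        by (rule borel_measurable_indicator[OF sets.top])
    qed (use A in simp)
    finally show "emeasure (distr (density lborel (\<lambda>u. ennreal ((cmod (Jc u))\<^sup>2))) ?M (chi \<alpha> \<beta>)) A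
        = emeasure (density ?M (indicator (space ?M))) A" .
  qed simp
  show "space ?M \<in> sets ?M" by (rule sets.top)
  show "Jc \<in> borel_measurable lborel" by simp
qed (rule chi_measurable)

lemma Jc_Xw: "Jc x * Xw (chi \<alpha> \<beta> x) = 1"
proof -
  have z: "- chi \<alpha> \<beta> x + cis \<alpha> = cis \<alpha> * (2 * \<i> * t) / (complex_of_real x + \<i> * t)"
    unfolding chi_zet zet_def using xit_nz[of x] by (simp add: field_simps)
  have r: "complex_of_real (sqrt (2 * t)) * complex_of_real (sqrt (2 * t)) = 2 * t"
    using t_pos by (simp flip: of_real_mult)
  have "Jc x * Xw (chi \<alpha> \<beta> x) = (complex_of_real (sqrt (2 * t)) * complex_of_real (sqrt (2 * t))) / (2 * t)"
    unfolding Jc_def Xw_def z using xit_nz[of x] t_pos by (simp add: divide_simps)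
  then show ?thesis unfolding r using t_pos by simp
qed

lemma Re_chi_inv_chi: "Re (chi_inv \<alpha> \<beta> (chi \<alpha> \<beta> x)) = x"
  by (simp add: chi_inv_chi \<beta>)

lemma Xw_measurable: "Xw \<in> borel_measurable circle_measure"
  "(\<lambda>z. Re (chi_inv \<alpha> \<beta> z)) \<in> borel_measurable circle_measure"
proof -
  show "Xw \<in> borel_measurable circle_measure"
    by (rule measurable_from_circle) (unfold Xw_def[abs_def], measurable)
  show "(\<lambda>z. Re (chi_inv \<alpha> \<beta> z)) \<in> borel_measurable circle_measure"
    by (rule measurable_from_circle) (unfold chi_inv_def, measurable)
qed

text \<open>Read off from \<open>model_circle\<close>: along \<open>chi\<close> the weights
  \<open>Xw\<close> and \<open>Jc\<close> are reciprocal and \<open>chi_inv\<close> undoes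
  \<open>chi\<close>, so integrals over the circle become plain integrals over the line.\<close>

lemma weighted_comp_X: "weighted_comp circle_measure lborel Xw (\<lambda>z. Re (chi_inv \<alpha> \<beta> z)) UNIV"
  unfolding weighted_comp_def
proof (intro conjI)
  note [measurable] = Xw_measurable
  let ?f = "\<lambda>z. Re (chi_inv \<alpha> \<beta> z)"
  show m: "?f \<in> measurable circle_measure lborel"
    using Xw_measurable(2) by simp
  show "distr (density circle_measure (\<lambda>u. ennreal ((cmod (Xw u))\<^sup>2))) lborel ?f = density lborel (indicator UNIV)"
  proof (rule measure_eqI)
    fix B assume "B \<in> sets (distr (density circle_measure (\<lambda>u. ennreal ((cmod (Xw u))\<^sup>2))) lborel ?f)"
    then have [measurable]: "B \<in> sets borel" by simp
    have "emeasure (distr (density circle_measure (\<lambda>u. ennreal ((cmod (Xw u))\<^sup>2))) lborel ?f) B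
        = (\<integral>\<^sup>+z. ennreal ((cmod (Xw z))\<^sup>2) * indicator (?f -` B \<inter> space circle_measure) z \<partial>circle_measure)"
      using measurable_sets[OF m, of B] m
      by (subst emeasure_distr, simp, simp, subst emeasure_density) (auto simp del: space_circle)
    also have "\<dots> = (\<integral>\<^sup>+z. indicator (space circle_measure) z * (ennreal ((cmod (Xw z))\<^sup>2) * indicator B (?f z)) \<partial>circle_measure)"
      by (intro nn_integral_cong) (auto simp: indicator_def)
    also have "\<dots> = (\<integral>\<^sup>+x. ennreal ((cmod (Jc x))\<^sup>2) * (ennreal ((cmod (Xw (chi \<alpha> \<beta> x)))\<^sup>2) * indicator B (?f (chi \<alpha> \<beta> x))) \<partial>lborel)"
      by (rule weighted_comp_nn_integral[OF model_circle, symmetric]) measurable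
    also have "\<dots> = (\<integral>\<^sup>+x. indicator B x \<partial>lborel)"
    proof (intro nn_integral_cong)
      fix x
      have "(cmod (Jc x))\<^sup>2 * (cmod (Xw (chi \<alpha> \<beta> x)))\<^sup>2 = 1"
        unfolding power_mult_distrib[symmetric] norm_mult[symmetric] Jc_Xw by simp
      then show "ennreal ((cmod (Jc x))\<^sup>2) * (ennreal ((cmod (Xw (chi \<alpha> \<beta> x)))\<^sup>2) * indicator B (?f (chi \<alpha> \<beta> x))) = indicator B x"
        unfolding Re_chi_inv_chi by (simp flip: mult.assoc ennreal_mult)
    qed
    also have "\<dots> = emeasure (density lborel (indicator UNIV)) B"
      by (simp add: emeasure_density)
    finally show "emeasure (distr (density circle_measure (\<lambda>u. ennreal ((cmod (Xw u))\<^sup>2))) lborel ?f) B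
        = emeasure (density lborel (indicator UNIV)) B" .
  qed simp
qed (use Xw_measurable in auto)

lemma X_op_set_of: "X_op \<alpha> \<beta> (set_of x) = L2_class circle_measure (\<lambda>z. Xw z * rep x (Re (chi_inv \<alpha> \<beta> z)))"
  by (simp add: X_op_def Xw_def rep_def t_def[symmetric])

lemma X_op_in: "X_op \<alpha> \<beta> (set_of x) \<in> L2 circle_measure"
  unfolding X_op_set_of by (intro L2_class_in weighted_comp_L2(1)[OF weighted_comp_X] rep_L2)

abbreviation embc :: "(complex \<Rightarrow> complex) set \<Rightarrow> l2" where "embc \<equiv> emb Jc (chi \<alpha> \<beta>)"

text \<open>Pulling back by \<open>chi\<close> undoes \<open>X_op\<close>, so the circle side can be
  computed with \<open>embc\<close> on the line.\<close>

lemma embc_X_op: "embc (X_op \<alpha> \<beta> (set_of x)) = x"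
  unfolding X_op_set_of emb_class[OF model_circle weighted_comp_L2(1)[OF weighted_comp_X rep_L2]]
  by (simp add: Re_chi_inv_chi Jc_Xw mult.assoc[symmetric])

section \<open>\<open>H2\<close> of the circle as the functions with one-sided Fourier
  transform\<close>

subsection \<open>The Hardy space\<close>

lemma L2_Jc: 
  assumes [measurable]: "g \<in> borel_measurable borel" and "\<And>x. cmod (g x) \<le> C"
  shows "(\<lambda>x. Jc x * g x) \<in> L2_fun lborel"
proof -
  have "(\<lambda>x. 1 :: complex) \<in> L2_fun circle_measure"
    unfolding L2_fun_def using emeasure_circle[OF sets.top]
    by (auto intro!: finite_measure.integrable_const finite_measureI
        simp: circle_measure_def emeasure_distr[OF _ sets.top])
  from weighted_comp_L2(1)[OF model_circle this] have "Jc \<in> L2_fun lborel" by simp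
  then show ?thesis
    by (rule L2_fun_bound[where C = C])
       (auto simp: norm_mult mult.commute[of "cmod (Jc _)"] intro!: mult_right_mono assms(2))
qed

lemma cls_Jc_tendsto:
  assumes [measurable]: "\<And>n. g n \<in> borel_measurable borel" "h \<in> borel_measurable borel"
    and le: "\<And>n x. cmod (g n x) \<le> C" and lim: "\<And>x. (\<lambda>n::nat. g n x) \<longlonglongrightarrow> h x"
  shows "(\<lambda>n. cls (\<lambda>x. Jc x * g n x)) \<longlonglongrightarrow> cls (\<lambda>x. Jc x * h x)"
proof (rule l2_dominated_convergence(1))
  have C: "0 \<le> C" using le[of 0 0] norm_ge_zero order_trans by blast
  show "(\<lambda>x. Jc x * complex_of_real C) \<in> L2_fun lborel"
    by (rule L2_Jc[where C = C]) (use C in auto)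
  show "AE x in lborel. cmod (Jc x * g n x) \<le> cmod (Jc x * complex_of_real C)" for n
    using le C by (intro AE_I2) (auto simp: norm_mult intro!: mult_left_mono)
  show "AE x in lborel. (\<lambda>n. Jc x * g n x) \<longlonglongrightarrow> Jc x * h x"
    by (intro AE_I2 tendsto_mult_left lim)
qed measurable

text \<open>Up to the phase \<open>cis \<alpha> ^ n\<close> the embedded monomials (see
  \<open>embc_poly\<close>).\<close>

definition qn :: "nat \<Rightarrow> l2" where "qn n = cls (\<lambda>x. Jc x * zet x ^ n)"

text \<open>The closed form of the series with terms r^k qn (n + k); for n = 0 these are the
  Cauchy-Szego kernels of the circle.\<close>

definition kn :: "nat \<Rightarrow> real \<Rightarrow> l2" where
  "kn n r = cls (\<lambda>x. Jc x * (zet x ^ n / (1 - complex_of_real r * zet x)))"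

lemma kernel_bound:
  assumes "\<bar>r\<bar> < 1"
  shows "cmod (zet x ^ n / (1 - complex_of_real r * zet x)) \<le> 1 / (1 - \<bar>r\<bar>)"
    "1 - complex_of_real r * zet x \<noteq> 0"
proof -
  have "1 - \<bar>r\<bar> \<le> cmod (1 - complex_of_real r * zet x)"
    using norm_triangle_ineq2[of 1 "complex_of_real r * zet x"] by (simp add: norm_mult)
  then show "cmod (zet x ^ n / (1 - complex_of_real r * zet x)) \<le> 1 / (1 - \<bar>r\<bar>)"
    using assms by (auto simp: norm_divide norm_power intro!: divide_left_mono mult_pos_pos)
  show "1 - complex_of_real r * zet x \<noteq> 0"
    using \<open>1 - \<bar>r\<bar> \<le> _\<close> assms by auto
qed

text \<open>The conjugate of \<open>rsv a\<close> is a Cauchy kernel with its pole at x = - \<i> a,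
  where \<open>zet\<close> takes the value (a + t) / (a - t) = 1 / r. Hence it is a constant times
  the circle kernel with parameter \<open>r\<close>, and the factor x + \<i> t is supplied by
  \<open>Jc\<close>.\<close>

lemma cnj_rsv_zet:
  assumes a: "0 < a"
  defines "r \<equiv> (a - t) / (a + t)"
  shows "\<exists>C. C \<noteq> 0 \<and> (\<forall>x. cnj (rsv a x) = C * (Jc x * (1 / (1 - complex_of_real r * zet x))))"
proof -
  have at: "a + t > 0" using a t_pos by simp
  have d: "1 - complex_of_real r * zet x = (2 * t / (a + t)) * ((complex_of_real x + \<i> * a) / (complex_of_real x + \<i> * t))" for x
  proof -
    have r: "complex_of_real r = (complex_of_real a - t) / (complex_of_real a + t)" by (simp add: r_def)
    have "complex_of_real a + t \<noteq> 0" using at by (metis of_real_add of_real_eq_0_iff less_irrefl)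
    then show ?thesis
      unfolding r zet_def using xit_nz[of x] by (simp add: divide_simps) (simp add: algebra_simps)
  qed
  define C where "C = (complex_of_real (sqrt (2 * pi)) * (2 * t / (a + t))) / complex_of_real (sqrt (2 * t))"
  have "cnj (rsv a x) = C * (Jc x * (1 / (1 - complex_of_real r * zet x)))" for x
  proof -
    have nz: "complex_of_real x + \<i> * a \<noteq> 0" using a by (auto simp: complex_eq_iff)
    have at': "complex_of_real a + t \<noteq> 0" using at by (metis of_real_add of_real_eq_0_iff less_irrefl)
    have "C * (Jc x * (1 / (1 - complex_of_real r * zet x))) = \<i> / (complex_of_real x + \<i> * a)"
      unfolding d C_def Jc_def using xit_nz[of x] t_pos nz at' by (simp add: divide_simps)
    also have "\<dots> = cnj (rsv a x)"
    proof -
      have "\<i> * (complex_of_real a - \<i> * complex_of_real x) = complex_of_real x + \<i> * a"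
        by (simp add: algebra_simps)
      moreover have "complex_of_real a - \<i> * complex_of_real x \<noteq> 0" using a by (auto simp: complex_eq_iff)
      ultimately show ?thesis
        by (simp add: rsv_def flip: \<open>_ = complex_of_real x + \<i> * a\<close>)
    qed
    finally show ?thesis by simp
  qed
  moreover have "C \<noteq> 0" using t_pos at by (auto simp: C_def simp flip: of_real_add)
  ultimately show ?thesis by blast
qed

lemma FTi_ep_kn:
  assumes a: "0 < a"
  obtains C where "C \<noteq> 0" "FTi (ep a) = cmul C (kn 0 ((a - t) / (a + t)))"
proof -
  obtain C where C: "C \<noteq> 0" "\<And>x. cnj (rsv a x) = C * (Jc x * (1 / (1 - complex_of_real ((a - t) / (a + t)) * zet x)))"
    using cnj_rsv_zet[OF a] by blast
  have r: "\<bar>(a - t) / (a + t)\<bar> < 1"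
    using a t_pos by (auto simp: abs_if field_simps)
  have L: "(\<lambda>x. Jc x * (1 / (1 - complex_of_real ((a - t) / (a + t)) * zet x))) \<in> L2_fun lborel"
    by (rule L2_Jc[where C = "1 / (1 - \<bar>(a - t) / (a + t)\<bar>)"], measurable) (use kernel_bound(1)[OF r, of _ 0] in simp)
  have "FTi (ep a) = cmul cF (cls (\<lambda>x. cnj (rsv a x)))"
    using a by (simp add: FTi_ep refl_cls rsv_minus)
  also have "\<dots> = cmul (cF * C) (kn 0 ((a - t) / (a + t)))"
    unfolding C(2) kn_def power_0 cmul_cls[OF L] cmul_cls[OF L2_fun_cmult[OF L]] by (simp only: mult.assoc)
  finally show ?thesis using that[of "cF * C"] C(1) by simp
qed

lemma hardy_add: "x \<in> hardy \<Longrightarrow> y \<in> hardy \<Longrightarrow> x + y \<in> hardy"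
  and hardy_diff: "x \<in> hardy \<Longrightarrow> y \<in> hardy \<Longrightarrow> x - y \<in> hardy"
  and hardy_cmul: "x \<in> hardy \<Longrightarrow> cmul c x \<in> hardy"
  and hardy_0: "0 \<in> hardy"
  by (simp_all add: hardy_def bclin_add[OF FT(1)] bclin_add[OF bclin_mlt] bclin_diff[OF FT(1)]
      bclin_diff[OF bclin_mlt] bclin_cmul[OF FT(1)] bclin_cmul[OF bclin_mlt] bclin_0[OF FT(1)] bclin_0[OF bclin_mlt])

lemma closed_hardy: "closed hardy"
  unfolding hardy_def
  by (intro closed_Collect_eq bclin_continuous bclin_compose[OF bclin_mlt FT(1)] continuous_on_const) simp

lemma hardy_tendsto: "(\<And>n::nat. f n \<in> hardy) \<Longrightarrow> f \<longlonglongrightarrow> x \<Longrightarrow> x \<in> hardy"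
  by (rule closed_sequentially[OF closed_hardy]) auto

lemma kn_0_hardy:
  assumes r: "\<bar>r\<bar> < 1"
  shows "kn 0 r \<in> hardy"
proof -
  \<comment> \<open>This solves r = (a - t) / (a + t) for a.\<close>
  define a where "a = t * (1 + r) / (1 - r)"
  have a: "0 < a" using r t_pos by (simp add: a_def abs_less_iff)
  have "(a - t) / (a + t) = r"
  proof -
    have "a - t = 2 * t * r / (1 - r)" "a + t = 2 * t / (1 - r)"
      using r by (simp_all add: a_def field_simps)
    then show ?thesis using r t_pos by simp
  qed
  then obtain C where C: "C \<noteq> 0" "FTi (ep a) = cmul C (kn 0 r)"
    using FTi_ep_kn[OF a] by metis
  have "mlt (indicator {..<0}) (ep a) = 0"
    using a unfolding ep_def zero_cls[symmetric]
    by (simp add: mlt_cls) (rule cls_cong, auto simp: epf_def indicator_def)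
  then have "FTi (ep a) \<in> hardy"
    by (simp add: hardy_def FT_FTi)
  then have "cmul (1 / C) (FTi (ep a)) \<in> hardy" by (rule hardy_cmul)
  then show ?thesis using C by simp
qed

lemma L2_qn: "(\<lambda>x. Jc x * zet x ^ n) \<in> L2_fun lborel"
  by (rule L2_Jc[where C = 1]) (auto simp: norm_power)

lemma L2_kn: "\<bar>r\<bar> < 1 \<Longrightarrow> (\<lambda>x. Jc x * (zet x ^ n / (1 - complex_of_real r * zet x))) \<in> L2_fun lborel"
  by (rule L2_Jc[where C = "1 / (1 - \<bar>r\<bar>)"], measurable) (rule kernel_bound(1))

lemma kn_Suc:
  assumes r: "\<bar>r\<bar> < 1"
  shows "kn n r = qn n + cmul (complex_of_real r) (kn (Suc n) r)"
proof -
  have "Jc x * (zet x ^ n / (1 - complex_of_real r * zet x))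
      = Jc x * zet x ^ n + complex_of_real r * (Jc x * (zet x ^ Suc n / (1 - complex_of_real r * zet x)))" for x
    using kernel_bound(2)[OF r, of x] by (simp add: field_simps)
  then show ?thesis
    using L2_qn[of n] L2_kn[OF r, of "Suc n"] L2_fun_cmult[OF L2_kn[OF r, of "Suc n"], of "complex_of_real r"]
    by (simp add: kn_def qn_def cmul_cls plus_cls)
qed

text \<open>Membership climbs from the kernels: \<open>qn n\<close> is the limit of
  \<open>kn n r\<close> as r tends to 0, and \<open>kn (Suc n) r\<close> is (kn n r - qn n) / r by
  \<open>kn_Suc\<close>.\<close>

lemma qn_hardy: "qn n \<in> hardy"
proof -
  \<comment> \<open>Nonzero parameters tending to 0; the bound 1/2 gives the common bound 2 for all
    the kernels.\<close>
  define rr where "rr m = 1 / real (m + 2)" for m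
  have rr: "\<bar>rr m\<bar> < 1" "\<bar>rr m\<bar> \<le> 1 / 2" "rr m \<noteq> 0" for m by (auto simp: rr_def field_simps)
  have "rr \<longlonglongrightarrow> 0"
    unfolding rr_def[abs_def]
    using LIMSEQ_ignore_initial_segment[OF lim_1_over_n, of 2] by simp
  then have lim: "(\<lambda>m. complex_of_real (rr m)) \<longlonglongrightarrow> 0"
    using tendsto_of_real by fastforce
  have q: "qn n \<in> hardy" if k: "\<And>r. \<bar>r\<bar> < 1 \<Longrightarrow> kn n r \<in> hardy" for n
  proof (rule hardy_tendsto)
    show "kn n (rr m) \<in> hardy" for m by (rule k) (rule rr)
    show "(\<lambda>m. kn n (rr m)) \<longlonglongrightarrow> qn n"
      unfolding kn_def qn_def
    proof (rule cls_Jc_tendsto[where C = 2])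
      show "cmod (zet x ^ n / (1 - complex_of_real (rr m) * zet x)) \<le> 2" for m x
      proof -
        have "1 / (1 - \<bar>rr m\<bar>) \<le> 1 / (1 - 1 / 2)"
          using rr[of m] by (intro divide_left_mono) auto
        then show ?thesis using kernel_bound(1)[OF rr(1)[of m], of x n] by simp
      qed
      have "(\<lambda>m. zet x ^ n / (1 - complex_of_real (rr m) * zet x)) \<longlonglongrightarrow> zet x ^ n / (1 - 0 * zet x)" for x
        by (intro tendsto_intros lim) simp
      then show "(\<lambda>m. zet x ^ n / (1 - complex_of_real (rr m) * zet x)) \<longlonglongrightarrow> zet x ^ n" for x by simp
    qed measurable
  qed
  have "kn n r \<in> hardy" if "\<bar>r\<bar> < 1" for r
    using that
  proof (induction n arbitrary: r)
    case 0
    then show ?case by (rule kn_0_hardy)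
  next
    case (Suc n)
    have *: "kn (Suc n) r \<in> hardy" if r: "\<bar>r\<bar> < 1" "r \<noteq> 0" for r
    proof -
      have "cmul (complex_of_real (1 / r)) (kn n r - qn n) \<in> hardy"
        by (intro hardy_cmul hardy_diff Suc.IH q r)
      then show ?thesis
        using r(2) unfolding kn_Suc[OF r(1), of n] by simp
    qed
    show ?case
    \<comment> \<open>Division by r fails at r = 0; that case is the limit of the nonzero
      ones.\<close>
    proof (cases "r = 0")
      case True
      have "(\<lambda>m. kn (Suc n) (rr m)) \<longlonglongrightarrow> kn (Suc n) 0"
        unfolding kn_def
      proof (rule cls_Jc_tendsto[where C = 2])
        show "cmod (zet x ^ Suc n / (1 - complex_of_real (rr m) * zet x)) \<le> 2" for m x
        proof -
          have "1 / (1 - \<bar>rr m\<bar>) \<le> 1 / (1 - 1 / 2)"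
            using rr[of m] by (intro divide_left_mono) auto
          then show ?thesis using kernel_bound(1)[OF rr(1)[of m], of x "Suc n"] by simp
        qed
        have "(\<lambda>m. zet x ^ Suc n / (1 - complex_of_real (rr m) * zet x)) \<longlonglongrightarrow> zet x ^ Suc n / (1 - 0 * zet x)" for x
          by (intro tendsto_intros lim) simp
        then show "(\<lambda>m. zet x ^ Suc n / (1 - complex_of_real (rr m) * zet x)) \<longlonglongrightarrow> zet x ^ Suc n / (1 - complex_of_real 0 * zet x)" for x
          by simp
      qed measurable
      then show ?thesis unfolding True by (rule hardy_tendsto[rotated]) (intro * rr)
    qed (use Suc.prems * in blast)
  qed
  then show ?thesis by (rule q)
qed

text \<open>The geometric series in r \<open>zet\<close>, with its partial sums bounded by 1 / (1 -
  |r|), converges in norm by domination.\<close>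

lemma kn_0_closure:
  assumes r: "\<bar>r\<bar> < 1"
  shows "kn 0 r \<in> closure (cspan (range qn))"
proof (rule closure_cspan_tendsto)
  let ?s = "\<lambda>N x. \<Sum>n<N. (complex_of_real r * zet x) ^ n"
  have e: "cls (\<lambda>x. Jc x * ?s N x) = (\<Sum>n<N. cmul (complex_of_real r ^ n) (qn n))" for N
  proof -
    have "(\<lambda>x. Jc x * ?s N x) = (\<lambda>x. \<Sum>n<N. complex_of_real r ^ n * (Jc x * zet x ^ n))"
      by (simp add: sum_distrib_left power_mult_distrib mult_ac)
    then show ?thesis
      by (simp add: qn_def cmul_cls L2_qn sum_cls(2) L2_fun_cmult)
  qed
  show "cls (\<lambda>x. Jc x * ?s N x) \<in> closure (cspan (range qn))" for N
    unfolding e by (intro closure_cspan_sum closure_cspan_cmul closure_cspan_base rangeI)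
  have n: "cmod (complex_of_real r * zet x) = \<bar>r\<bar>" for x by (simp add: norm_mult)
  show "(\<lambda>N. cls (\<lambda>x. Jc x * ?s N x)) \<longlonglongrightarrow> kn 0 r"
    unfolding kn_def
  proof (rule cls_Jc_tendsto[where C = "1 / (1 - \<bar>r\<bar>)"])
    fix x
    show "cmod (?s N x) \<le> 1 / (1 - \<bar>r\<bar>)" for N
    proof -
      have "cmod (?s N x) \<le> (\<Sum>n<N. \<bar>r\<bar> ^ n)"
        by (rule order_trans[OF norm_sum]) (simp add: norm_power n)
      also have "\<dots> \<le> (\<Sum>n. \<bar>r\<bar> ^ n)"
        using r by (intro sum_le_suminf summable_geometric) auto
      also have "\<dots> = 1 / (1 - \<bar>r\<bar>)" using r by (intro suminf_geometric) auto
      finally show ?thesis .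
    qed
    have "(\<lambda>n. (complex_of_real r * zet x) ^ n) sums (1 / (1 - complex_of_real r * zet x))"
      using r n[of x] by (intro geometric_sums) simp
    then show "(\<lambda>N. ?s N x) \<longlonglongrightarrow> zet x ^ 0 / (1 - complex_of_real r * zet x)"
      by (simp add: sums_def)
  qed measurable
qed

text \<open>For the inclusion from left to right, \<open>FTi\<close> maps the exponentials that span
  the positive half-line to multiples of kernels \<open>kn 0 r\<close>, and these are limits of
  combinations of the \<open>qn n\<close>.\<close>

lemma hardy_eq_closure: "hardy = closure (cspan (range qn))"
proof
  show "closure (cspan (range qn)) \<subseteq> hardy"
  proof (rule closure_minimal[OF _ closed_hardy], rule subsetI)
    fix x assume "x \<in> cspan (range qn)"
    then show "x \<in> hardy"
      by (induction rule: cspan_induct) (auto simp: hardy_0 hardy_add hardy_cmul qn_hardy)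
  qed
  show "hardy \<subseteq> closure (cspan (range qn))"
  proof
    fix x assume "x \<in> hardy"
    then have "mlt (indicator half_line) (FT x) = FT x"
      using mlt_pos_neg[of "FT x"] by (simp add: hardy_def)
    then have "FT x \<in> closure (cspan Dpos)"
      using Dpos_dense[of "FT x"] by simp
    then have "FTi (FT x) \<in> closure (cspan (range qn))"
    proof (rule closure_cspan_image[OF _ bclin_FTi])
      fix y assume "y \<in> Dpos"
      then obtain k :: nat where y: "y = ep (real k + 1)" unfolding Dpos_def by blast
      have a: "0 < real k + 1" by simp
      obtain C where "FTi y = cmul C (kn 0 ((real k + 1 - t) / (real k + 1 + t)))"
        using FTi_ep_kn[OF a] y by metis
      moreover have "\<bar>(real k + 1 - t) / (real k + 1 + t)\<bar> < 1"
        using t_pos by (auto simp: abs_if field_simps)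
      ultimately show "FTi y \<in> closure (cspan (range qn))"
        by (simp add: closure_cspan_cmul kn_0_closure)
    qed
    then show "x \<in> closure (cspan (range qn))" by (simp add: FTi_FT)
  qed
qed

lemma cspan_qn: "x \<in> cspan (range qn) \<longleftrightarrow> (\<exists>N c. x = (\<Sum>n\<le>N. cmul (c n) (qn n)))"
proof
  assume "x \<in> cspan (range qn)"
  then show "\<exists>N c. x = (\<Sum>n\<le>N. cmul (c n) (qn n))"
  proof (induction rule: cspan_induct)
    case zero
    show ?case by (intro exI[of _ 0] exI[of _ "\<lambda>n. 0"]) simp
  next
    case (add d z y)
    then obtain N c m where y: "y = (\<Sum>n\<le>N. cmul (c n) (qn n))" and z: "z = qn m" by blast
    define K where "K = max N m"
    have "(\<Sum>n\<le>N. cmul (c n) (qn n)) = (\<Sum>n\<le>K. cmul (if n \<le> N then c n else 0) (qn n))"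
      by (rule sum.mono_neutral_cong_left) (auto simp: K_def)
    moreover have "cmul d (qn m) = (\<Sum>n\<le>K. cmul (if n = m then d else 0) (qn n))"
      by (subst sum.mono_neutral_cong_right[of _ "{m}" _ "\<lambda>n. cmul d (qn n)"]) (auto simp: K_def)
    ultimately have "cmul d z + y = (\<Sum>n\<le>K. cmul ((if n = m then d else 0) + (if n \<le> N then c n else 0)) (qn n))"
      unfolding y z by (simp only: cmul_add_left sum.distrib)
    then show ?case
      by (intro exI[of _ K] exI[of _ "\<lambda>n. (if n = m then d else 0) + (if n \<le> N then c n else 0)"])
  qed
next
  assume "\<exists>N c. x = (\<Sum>n\<le>N. cmul (c n) (qn n))"
  then obtain N c where "x = (\<Sum>n\<le>N. cmul (c n) (qn n))" by blast
  moreover have "(\<Sum>n\<in>I. cmul (c n) (qn n)) \<in> cspan (range qn)" for I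
    by (induction I rule: infinite_finite_induct)
       (auto intro: cspan_0 intro!: cspan_add[OF cspan_cmul[OF cspan_base]])
  ultimately show "x \<in> cspan (range qn)" by simp
qed

lemma L2_monomial: "(\<lambda>z. z ^ n) \<in> L2_fun circle_measure"
proof -
  have "(\<lambda>x. 1 :: complex) \<in> L2_fun circle_measure"
    unfolding L2_fun_def using emeasure_circle[OF sets.top]
    by (auto intro!: finite_measure.integrable_const finite_measureI
        simp: circle_measure_def emeasure_distr[OF _ sets.top])
  then show ?thesis
    by (rule L2_fun_bound[where C = 1])
       (auto intro!: measurable_from_circle AE_I2 simp: norm_power)
qed

lemma L2_poly: "(\<lambda>z. \<Sum>n\<le>(N::nat). c n * z ^ n) \<in> L2_fun circle_measure"
proof (induction N)
  case 0
  show ?case using L2_fun_cmult[OF L2_monomial[of 0], of "c 0"] by simp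
next
  case (Suc N)
  show ?case
    using L2_fun_add[OF Suc L2_fun_cmult[OF L2_monomial[of "Suc N"], of "c (Suc N)"]] by simp
qed

lemma embc_poly: "embc (L2_class circle_measure (\<lambda>z. \<Sum>n\<le>N. c n * z ^ n)) = (\<Sum>n\<le>N. cmul (c n * cis \<alpha> ^ n) (qn n))"
proof -
  have "(\<lambda>x. Jc x * (\<Sum>n\<le>N. c n * chi \<alpha> \<beta> x ^ n)) = (\<lambda>x. \<Sum>n\<le>N. (c n * cis \<alpha> ^ n) * (Jc x * zet x ^ n))"
    by (simp add: chi_zet power_mult_distrib sum_distrib_left mult_ac)
  then show ?thesis
    by (simp add: emb_class[OF model_circle L2_poly] qn_def cmul_cls L2_qn sum_cls(2) L2_fun_cmult)
qed

text \<open>\<open>embc\<close> is isometric and sends polynomials to combinations of the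
  \<open>qn n\<close>, so the approximation property in \<open>H2\<close> becomes membership in a
  closed span. The phases \<open>cis \<alpha> ^ n\<close> are absorbed by the coefficients.\<close>

lemma H2_iff: "F \<in> H2 \<longleftrightarrow> F \<in> L2 circle_measure \<and> embc F \<in> hardy"
proof -
  have "(\<forall>\<epsilon>>0. \<exists>N::nat. \<exists>c. L2_norm circle_measure (L2_diff circle_measure F
      (L2_class circle_measure (\<lambda>z. \<Sum>n\<le>N. c n * z ^ n))) < \<epsilon>) \<longleftrightarrow> embc F \<in> closure (cspan (range qn))"
    if F: "F \<in> L2 circle_measure"
  proof -
    have "(\<exists>N::nat. \<exists>c. L2_norm circle_measure (L2_diff circle_measure F
      (L2_class circle_measure (\<lambda>z. \<Sum>n\<le>N. c n * z ^ n))) < \<epsilon>) \<longleftrightarrow> (\<exists>y\<in>cspan (range qn). dist y (embc F) < \<epsilon>)" for \<epsilon>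
    proof
      assume "\<exists>N::nat. \<exists>c. L2_norm circle_measure (L2_diff circle_measure F
        (L2_class circle_measure (\<lambda>z. \<Sum>n\<le>N. c n * z ^ n))) < \<epsilon>"
      then obtain N c where *: "L2_norm circle_measure (L2_diff circle_measure F
        (L2_class circle_measure (\<lambda>z. \<Sum>n\<le>N. c n * z ^ n))) < \<epsilon>" by blast
      show "\<exists>y\<in>cspan (range qn). dist y (embc F) < \<epsilon>"
      proof (rule bexI)
        show "dist (\<Sum>n\<le>N. cmul (c n * cis \<alpha> ^ n) (qn n)) (embc F) < \<epsilon>"
          using * by (simp add: L2_norm_diff[OF model_circle F L2_class_in[OF L2_poly]] embc_poly dist_norm norm_minus_commute)
        show "(\<Sum>n\<le>N. cmul (c n * cis \<alpha> ^ n) (qn n)) \<in> cspan (range qn)"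
          unfolding cspan_qn by (intro exI[of _ N] exI[of _ "\<lambda>n. c n * cis \<alpha> ^ n"] refl)
      qed
    next
      assume "\<exists>y\<in>cspan (range qn). dist y (embc F) < \<epsilon>"
      then obtain y where y: "y \<in> cspan (range qn)" "dist y (embc F) < \<epsilon>" by blast
      then obtain N c where "y = (\<Sum>n\<le>N. cmul (c n) (qn n))"
        unfolding cspan_qn by blast
      with y(2) have *: "dist (\<Sum>n\<le>N. cmul (c n) (qn n)) (embc F) < \<epsilon>" by simp
      have "embc (L2_class circle_measure (\<lambda>z. \<Sum>n\<le>N. (c n / cis \<alpha> ^ n) * z ^ n)) = (\<Sum>n\<le>N. cmul (c n) (qn n))"
        unfolding embc_poly by simp
      then have "L2_norm circle_measure (L2_diff circle_measure F
        (L2_class circle_measure (\<lambda>z. \<Sum>n\<le>N. (c n / cis \<alpha> ^ n) * z ^ n))) < \<epsilon>"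
        using * by (simp only: L2_norm_diff[OF model_circle F L2_class_in[OF L2_poly]] dist_norm norm_minus_commute)
      then show "\<exists>N::nat. \<exists>c. L2_norm circle_measure (L2_diff circle_measure F
        (L2_class circle_measure (\<lambda>z. \<Sum>n\<le>N. c n * z ^ n))) < \<epsilon>"
        by (intro exI[of _ N] exI[of _ "\<lambda>n. c n / cis \<alpha> ^ n"])
    qed
    then show ?thesis by (simp add: closure_approachable)
  qed
  then show ?thesis
    unfolding H2_def hardy_eq_closure by blast
qed

text \<open>The orthogonal projection onto \<open>hardy\<close>.\<close>

definition proj :: "l2 \<Rightarrow> l2" where "proj x = FTi (mlt (indicator half_line) (FT x))"

lemma proj_orthogonal:
  assumes "g \<in> hardy"
  shows "ip (x - proj x) g = 0"
proof -
  have "ip (x - proj x) g = ip (FT x - FT (proj x)) (FT g)"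
    by (simp add: FT_ip flip: bclin_diff[OF FT(1)])
  also have "FT x - FT (proj x) = mlt (indicator {..<0}) (FT x)"
    using mlt_pos_neg[of "FT x"] by (simp add: proj_def FT_FTi algebra_simps)
  also have "ip (mlt (indicator {..<0}) (FT x)) (FT g) = 0"
    using assms by (simp add: ip_mlt hardy_def)
  finally show ?thesis .
qed

text \<open>Uniqueness: any other \<open>K\<close> with the defining property makes
  \<open>embc H - embc K\<close> orthogonal to itself. The test vector is the member of
  \<open>H2\<close> that embeds to this difference, supplied by \<open>X_op\<close>.\<close>

lemma Q_plus_eq:
  assumes F: "F \<in> L2 circle_measure" and H: "H \<in> H2" and p: "embc H = proj (embc F)"
  shows "Q_plus F = H"
  unfolding Q_plus_def
proof (rule the_equality)
  note ip = emb_inner[OF model_circle L2_op_in(2)] emb_diff[OF model_circle]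
  have HL: "H \<in> L2 circle_measure" using H by (simp add: H2_iff)
  have orth: "L2_inner circle_measure (L2_diff circle_measure F K) G = ip (embc F - embc K) (embc G)"
    if "K \<in> H2" "G \<in> H2" for K G
    using that F by (simp add: ip[symmetric] H2_iff)
  show "H \<in> H2 \<and> (\<forall>G\<in>H2. L2_inner circle_measure (L2_diff circle_measure F H) G = 0)"
    using H by (auto simp: orth p H2_iff intro: proj_orthogonal)
  fix K assume K: "K \<in> H2 \<and> (\<forall>G\<in>H2. L2_inner circle_measure (L2_diff circle_measure F K) G = 0)"
  have d: "embc H - embc K \<in> hardy" using H K by (auto simp: H2_iff intro: hardy_diff)
  define G where "G = X_op \<alpha> \<beta> (set_of (embc H - embc K))"
  have G: "G \<in> H2" "embc G = embc H - embc K"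
    using d by (auto simp: G_def H2_iff X_op_in embc_X_op)
  have "ip (embc F - embc K) (embc G) = 0"
    using K orth[of K G] G(1) by auto
  moreover have "ip (embc F - embc H) (embc G) = 0"
    unfolding p G(2) by (rule proj_orthogonal) (use d p in simp)
  ultimately have "ip (embc H - embc K) (embc G) = 0"
    by (simp add: ip_diff_left)
  then have "embc H = embc K" by (simp add: G(2) ip_norm)
  then show "K = H"
    using K HL by (intro emb_inj[OF model_circle]) (auto simp: H2_iff)
qed

end

section \<open>Existence and uniqueness in the definition of \<open>fourier\<close>\<close>

section \<open>The Fourier transformation on classes\<close>

lemma ip_wc:
  assumes W: "wcomp J \<phi> S"
  shows "ip (wc J \<phi> x) (wc J \<phi> y) = ip (mlt (indicator S) x) y"
proof -
  have S: "S \<in> sets borel" using weighted_compD(3)[OF W] by simp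
  have "ip (wc J \<phi> x) (wc J \<phi> y) = (LINT u|lborel. (J u * cnj (J u)) * (rep x (\<phi> u) * cnj (rep y (\<phi> u))))"
    unfolding wc_def by (subst ip_cls) (auto simp: weighted_comp_L2(1)[OF W] mult_ac)
  also have "\<dots> = (LINT u|lborel. indicator S u * (rep x u * cnj (rep y u)))"
    by (rule weighted_comp_integral[OF W, of "\<lambda>u. rep x u * cnj (rep y u)"]) measurable
  also have "\<dots> = ip (mlt (indicator S) x) (cls (rep y))"
    unfolding mlt_def by (subst ip_cls) (auto simp: L2_fun_mlt S mult.assoc)
  finally show ?thesis by simp
qed

text \<open>\<open>T\<close> has to preserve \<open>ip\<close> only between embedded vectors,
  because \<open>Asig\<close> is an isometry only on functions supported in (0, 1).\<close>

lemma hilbert_isomorphismI: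
  assumes M: "model M J \<phi>" and N: "model N K \<psi>" and T: "bclin T"
    and ip: "\<And>F G. F \<in> L2 M \<Longrightarrow> G \<in> L2 M \<Longrightarrow> ip (T (emb J \<phi> F)) (T (emb J \<phi> G)) = ip (emb J \<phi> F) (emb J \<phi> G)"
    and U: "\<And>F. F \<in> L2 M \<Longrightarrow> emb K \<psi> (U F) = T (emb J \<phi> F)" "\<And>F. F \<in> L2 M \<Longrightarrow> U F \<in> B"
    and B: "B \<subseteq> L2 N" and surj: "\<And>G. G \<in> B \<Longrightarrow> \<exists>F\<in>L2 M. U F = G"
  shows "hilbert_isomorphism M (L2 M) N B U"
proof -
  have UN: "U F \<in> L2 N" if "F \<in> L2 M" for F using U(2)[OF that] B by blast
  have inner: "L2_inner N (U F) (U G) = L2_inner M F G" if "F \<in> L2 M" "G \<in> L2 M" for F G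
    using that by (simp add: emb_inner[OF N, symmetric] emb_inner[OF M, symmetric] UN U(1) ip)
  have "inj_on U (L2 M)"
  proof (rule inj_onI)
    fix F G assume FG: "F \<in> L2 M" "G \<in> L2 M" "U F = U G"
    then have "T (emb J \<phi> (L2_diff M F G)) = 0"
      by (simp add: emb_diff[OF M] bclin_diff[OF T] U(1)[symmetric])
    then have "ip (emb J \<phi> (L2_diff M F G)) (emb J \<phi> (L2_diff M F G)) = 0"
      using ip[OF L2_op_in(2)[OF FG(1,2)] L2_op_in(2)[OF FG(1,2)]] by simp
    then have "emb J \<phi> F = emb J \<phi> G"
      using FG by (simp add: emb_diff[OF M] ip_norm)
    then show "F = G" by (rule emb_inj[OF M FG(1,2)])
  qed
  moreover have "U ` L2 M = B" using U(2) surj by blast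
  moreover have "U (L2_add M F G) = L2_add N (U F) (U G)" if "F \<in> L2 M" "G \<in> L2 M" for F G
    by (rule emb_inj[OF N]) (use that in \<open>auto simp: L2_op_in UN U(1) emb_add[OF M] emb_add[OF N] bclin_add[OF T]\<close>)
  moreover have "U (L2_scale M c F) = L2_scale N c (U F)" if "F \<in> L2 M" for F c
    by (rule emb_inj[OF N]) (use that in \<open>auto simp: L2_op_in(3)[OF that that] L2_op_in(3)[OF UN UN]
        UN U(1) emb_scale[OF M] emb_scale[OF N] bclin_cmul[OF T]\<close>)
  ultimately show ?thesis
    using inner by (simp add: hilbert_isomorphism_def bij_betw_def)
qed

abbreviation emb1 :: "(real \<Rightarrow> complex) set \<Rightarrow> l2" where "emb1 \<equiv> emb (\<lambda>x. 1) (\<lambda>x. x)"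

text \<open>Restricted to \<open>L2 lborel\<close> because the description of \<open>fourier\<close>
  asks for an extensional map, which fixes the values off that set.\<close>

definition fourier_class :: "(real \<Rightarrow> complex) set \<Rightarrow> (real \<Rightarrow> complex) set" where
  "fourier_class = restrict (\<lambda>F. set_of (FT (emb1 F))) (L2 lborel)"

lemma fourier_class_iso: "hilbert_isomorphism lborel (L2 lborel) lborel (L2 lborel) fourier_class"
proof (rule hilbert_isomorphismI[OF model_lborel model_lborel FT(1)])
  fix G :: "(real \<Rightarrow> complex) set" assume G: "G \<in> L2 lborel"
  have "fourier_class (set_of (FTi (emb1 G))) = G"
    using G set_of[of "FTi (emb1 G)"] by (simp add: fourier_class_def emb_set_of FT_FTi emb_lborel)
  then show "\<exists>F\<in>L2 lborel. fourier_class F = G" using set_of by blast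
qed (auto simp: FT_ip fourier_class_def emb_set_of set_of)

lemma set_of_plus: "set_of (x + y) = L2_add lborel (set_of x) (set_of y)"
  using emb_add[OF model_lborel set_of set_of, of x y] L2_op_in(1)[OF set_of set_of, of x y]
  by (metis emb_lborel emb_set_of)

lemma indicator_Icc_L2: "(indicator {a..b} :: real \<Rightarrow> complex) \<in> L2_fun lborel"
proof -
  have "integrable lborel (indicator {a..b} :: real \<Rightarrow> real)"
    by (rule integrable_real_indicator) (auto simp: emeasure_lborel_Icc_eq)
  moreover have "(cmod (indicator {a..b} t))\<^sup>2 = indicator {a..b} t" for t :: real
    by (simp split: split_indicator)
  ultimately show ?thesis by (simp add: L2_fun_def)
qed

text \<open>Truncation to [-n, n] makes a square-integrable function integrable, and there both maps
  are given by the integral. The truncations converge and both maps preserve norms.\<close>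

lemma fourier_unique:
  assumes U: "hilbert_isomorphism lborel (L2 lborel) lborel (L2 lborel) U"
    and L1: "\<And>f. f \<in> L2_fun lborel \<Longrightarrow> integrable lborel f \<Longrightarrow> U (L2_class lborel f) = L2_class lborel (fhat f)"
  shows "U (set_of x) = set_of (FT x)"
proof -
  define T where "T x = emb1 (U (set_of x))" for x
  have UL: "U (set_of x) \<in> L2 lborel" for x
    using U set_of[of x] by (auto simp: hilbert_isomorphism_def bij_betw_def)
  have add: "T (x + y) = T x + T y" for x y
    using U set_of[of x] set_of[of y]
    by (simp add: T_def set_of_plus hilbert_isomorphism_def emb_add[OF model_lborel UL UL])
  have norm: "norm (T x) = norm x" for x
  proof -
    have "ip (T x) (T x) = ip x x"
      using U set_of[of x] emb_inner[OF model_lborel set_of set_of, of x x]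
      by (simp add: T_def emb_inner[OF model_lborel UL UL] hilbert_isomorphism_def emb_set_of)
    then show ?thesis by (simp add: ip_norm power2_eq_iff_nonneg flip: of_real_power)
  qed
  define X where "X n = mlt (indicator {- real n..real n}) x" for n
  have "T (X n) = FT (X n)" for n
  proof -
    let ?f = "\<lambda>t. indicator {- real n..real n} t * rep x t"
    have f2: "?f \<in> L2_fun lborel" by (intro L2_fun_mlt) auto
    have f1: "integrable lborel ?f"
      by (rule L2_fun_integrable_mult[OF indicator_Icc_L2 rep_L2])
    show ?thesis
      unfolding X_def T_def mlt_def set_of_cls[OF f2] L1[OF f2 f1] FT_cls(1)[OF f2 f1]
        set_of_cls[OF FT_cls(2)[OF f2 f1], symmetric] emb_set_of ..
  qed
  moreover have "X \<longlonglongrightarrow> x"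
  proof -
    have "(\<lambda>n. cls (\<lambda>t. indicator {- real n..real n} t * rep x t)) \<longlonglongrightarrow> cls (rep x)"
    proof (rule l2_dominated_convergence(1)[OF rep_L2[of x]])
      show "AE t in lborel. (\<lambda>n. indicator {- real n..real n} t * rep x t) \<longlonglongrightarrow> rep x t"
      proof (rule AE_I2)
        fix t :: real
        obtain N :: nat where N: "\<bar>t\<bar> \<le> real N" using real_arch_simple by blast
        have "\<forall>\<^sub>F n in sequentially. indicator {- real n..real n} t * rep x t = rep x t"
          using eventually_ge_at_top[of N] by eventually_elim (use N in \<open>auto simp: indicator_def abs_le_iff\<close>)
        then show "(\<lambda>n. indicator {- real n..real n} t * rep x t) \<longlonglongrightarrow> rep x t"
          by (rule tendsto_eventually)
      qed
    qed (auto simp: indicator_def)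
    then show ?thesis by (simp add: X_def[abs_def] mlt_def)
  qed
  moreover have "norm (T x - FT x) \<le> 2 * norm (X n - x)" if "T (X n) = FT (X n)" for n
  proof -
    have "T x - T (X n) = T (x - X n)" using add[of "x - X n" "X n"] by simp
    moreover have "FT (X n) - FT x = FT (X n - x)" by (simp add: bclin_diff[OF FT(1)])
    moreover have "T x - FT x = (T x - T (X n)) + (FT (X n) - FT x)" using that by simp
    ultimately have "norm (T x - FT x) \<le> norm (T (x - X n)) + norm (FT (X n - x))"
      using norm_triangle_ineq by metis
    then show ?thesis by (simp add: norm FT(2) norm_minus_commute)
  qed
  ultimately have "norm (T x - FT x) \<le> 2 * 0"
    by (intro LIMSEQ_le_const[OF tendsto_mult_left[OF tendsto_norm_zero[OF LIM_zero]]]) auto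
  then have "T x = FT x" by simp
  then show ?thesis using emb_lborel[OF UL] by (metis T_def)
qed

lemma fourier_eq: "fourier = fourier_class"
  unfolding fourier_def fhat_def[symmetric]
proof (rule the_equality)
  have "fourier_class (L2_class lborel f) = L2_class lborel (fhat f)"
    if f: "f \<in> L2_fun lborel" "integrable lborel f" for f
    unfolding set_of_cls[OF f(1), symmetric] set_of_cls[OF FT_cls(2)[OF f], symmetric] FT_cls(1)[OF f, symmetric]
    using set_of[of "cls f"] by (simp add: fourier_class_def emb_set_of)
  then show "fourier_class \<in> extensional (L2 lborel) \<and>
    hilbert_isomorphism lborel (L2 lborel) lborel (L2 lborel) fourier_class \<and>
    (\<forall>f\<in>L2_fun lborel. integrable lborel f \<longrightarrow> fourier_class (L2_class lborel f) = L2_class lborel (\<lambda>x. fhat f x))"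
    using fourier_class_iso by (simp add: fourier_class_def)
next
  fix U assume U: "U \<in> extensional (L2 lborel) \<and>
    hilbert_isomorphism lborel (L2 lborel) lborel (L2 lborel) U \<and>
    (\<forall>f\<in>L2_fun lborel. integrable lborel f \<longrightarrow> U (L2_class lborel f) = L2_class lborel (\<lambda>x. fhat f x))"
  show "U = fourier_class"
  proof (rule extensionalityI[of _ "L2 lborel"])
    fix F :: "(real \<Rightarrow> complex) set" assume F: "F \<in> L2 lborel"
    have "U (set_of (emb1 F)) = set_of (FT (emb1 F))"
      using U by (intro fourier_unique) auto
    then show "U F = fourier_class F" using F by (simp add: emb_lborel fourier_class_def)
  qed (use U in \<open>auto simp: fourier_class_def\<close>)
qed

lemma fourier_inv_set_of: "fourier_inv (set_of x) = set_of (FTi x)"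
  unfolding fourier_inv_def
proof (rule inv_into_f_eq)
  show "inj_on fourier (L2 lborel)"
    using fourier_class_iso by (simp add: fourier_eq hilbert_isomorphism_def bij_betw_def)
  show "fourier (set_of (FTi x)) = set_of x"
    using set_of[of "FTi x"] by (simp add: fourier_eq fourier_class_def emb_set_of FT_FTi)
qed (rule set_of)

section \<open>Identification of \<open>V_op\<close> with \<open>FT o Gp o Asig\<close> through its
  kernel\<close>

section \<open>The isomorphism \<open>V\<close>\<close>

abbreviation embR :: "(real \<Rightarrow> complex) set \<Rightarrow> l2" where
  "embR \<equiv> emb (indicator half_line) (\<lambda>x. if x \<in> half_line then x else 1)"

abbreviation embI :: "(real \<Rightarrow> complex) set \<Rightarrow> l2" where
  "embI \<equiv> emb (indicator {0<..<1}) (\<lambda>x. if x \<in> {0<..<1} then x else 1 / 2)"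

lemma model_R: "model Rplus (indicator half_line) (\<lambda>x. if x \<in> half_line then x else 1)"
  by (rule model_restrict) auto

lemma model_I: "model unit_interval (indicator {0<..<1}) (\<lambda>x. if x \<in> {0<..<1} then x else 1 / 2)"
  by (rule model_restrict) auto

lemma P_plus_star_eq: "F \<in> L2 Rplus \<Longrightarrow> P_plus_star F = set_of (embR F)"
  unfolding emb_def P_plus_star_def
  by (subst set_of_cls, rule weighted_comp_L2(1)[OF model_R L2_rep_in], assumption)
     (auto intro!: L2_class_cong AE_I2 simp: indicator_def)

abbreviation Asig :: "l2 \<Rightarrow> l2" where "Asig \<equiv> wc Jsig sig"

definition lam :: "real \<Rightarrow> real" where "lam s = ln (1 / s - 1)"

definition Jlam :: "real \<Rightarrow> complex" where
  "Jlam s = (if 0 < s \<and> s < 1 then complex_of_real (1 / sqrt (s * (1 - s))) else 0)"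

lemma lam_measurable [measurable]: "lam \<in> borel_measurable borel" "Jlam \<in> borel_measurable borel"
  unfolding lam_def[abs_def] Jlam_def[abs_def] by measurable

lemma wcomp_lam: "wcomp Jlam lam UNIV"
proof (rule weighted_comp_change_of_variables[where g' = "\<lambda>s. - 1 / (s * (1 - s))" and S = "{0<..<1}"])
  show "inj_on lam {0<..<1}"
    by (rule inj_on_inverseI[of _ sig]) (simp add: lam_def sig_ln)
  show "lam ` {0<..<1} = UNIV"
    by (rule image_eq_of_inverse[where h = sig]) (auto simp: lam_def ln_sig sig_bounds)
  show "(lam has_real_derivative - 1 / (s * (1 - s))) (at s)" if s: "s \<in> {0<..<1}" for s
  proof -
    have p: "0 < 1 / s - 1" using s by (simp add: field_simps)
    have "(lam has_real_derivative (1 / (1 / s - 1)) * (- 1 / (s * s))) (at s)"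
      unfolding lam_def[abs_def] using s p by (auto intro!: derivative_eq_intros)
    also have "(1 / (1 / s - 1)) * (- 1 / (s * s)) = - 1 / (s * (1 - s))"
      using s by (simp add: field_simps)
    finally show ?thesis .
  qed
  show "(cmod (Jlam s))\<^sup>2 = indicator {0<..<1} s * \<bar>- 1 / (s * (1 - s))\<bar>" for s
    by (auto simp: Jlam_def indicator_def norm_divide power_divide abs_mult)
qed auto

lemma Asig_surj: "Asig (wc Jlam lam y) = y" "mlt (indicator {0<..<1}) (wc Jlam lam y) = wc Jlam lam y"
proof -
  have "Asig (wc Jlam lam y) = mlt (indicator UNIV) y"
    by (rule wc_inverse[OF wcomp_sig wcomp_lam])
       (use sig_bounds in \<open>auto simp: Jsig_def Jlam_def lam_def ln_sig less_imp_neq[symmetric]\<close>)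
  then show "Asig (wc Jlam lam y) = y" by simp
  show "mlt (indicator {0<..<1}) (wc Jlam lam y) = wc Jlam lam y"
    unfolding wc_def mlt_cls[OF weighted_comp_L2(1)[OF wcomp_lam rep_L2]]
    by (rule cls_cong) (auto simp: Jlam_def indicator_def)
qed

text \<open>The singularities at -1 and 1 are inverse square roots. Since |J1| is |J1|^2 times
  \<open>kap\<close>, the substitution by \<open>logw\<close> leads to the integral of sqrt pi /
  cosh (pi w).\<close>

lemma integrable_J1: "integrable lborel J1"
proof -
  have k: "kap (u1 w) = sqrt pi * (1 / cosh (pi * w))" for w
  proof -
    have "(sinh (pi * w))\<^sup>2 + 1 \<noteq> 0" using zero_le_power2[of "sinh (pi * w)"] by linarith
    then have "1 - (tanh (pi * w))\<^sup>2 = (1 / cosh (pi * w))\<^sup>2"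
      by (simp add: tanh_def power_divide divide_simps cosh_square_eq)
    then show ?thesis
      by (simp add: kap_def u1_def real_sqrt_mult real_sqrt_divide power_divide)
  qed
  have "(\<integral>\<^sup>+u. ennreal (cmod (J1 u)) \<partial>lborel) = (\<integral>\<^sup>+u. ennreal ((cmod (J1 u))\<^sup>2) * ennreal (kap (u1 (logw u))) \<partial>lborel)"
  proof (intro nn_integral_cong)
    fix u
    show "ennreal (cmod (J1 u)) = ennreal ((cmod (J1 u))\<^sup>2) * ennreal (kap (u1 (logw u)))"
    proof (cases "\<bar>u\<bar> < 1")
      case True
      then have "0 < kap u" by (intro kap_pos) auto
      then show ?thesis
        using True by (simp add: u1_logw J1_def norm_divide power2_eq_square flip: ennreal_mult)
    qed (simp add: J1_def)
  qed
  also have "\<dots> = (\<integral>\<^sup>+w. indicator UNIV w * ennreal (kap (u1 w)) \<partial>lborel)"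
    by (rule weighted_comp_nn_integral[OF wcomp_J1, of "\<lambda>w. ennreal (kap (u1 w))"]) measurable
  also have "\<dots> = (\<integral>\<^sup>+w. ennreal (norm (sqrt pi * (1 / cosh (pi * w)))) \<partial>lborel)"
    by (simp add: k)
  also have "\<dots> < \<infinity>"
    using integrable_mult_right[OF integrable_inverse_cosh, of "sqrt pi"] by (simp add: integrable_iff_bounded)
  finally show ?thesis by (simp add: integrable_iff_bounded)
qed

text \<open>The origin of the constant in \<open>q_plus\<close>: 1 / (2 pi) comes from two Fourier
  normalizations and 1 / sqrt pi from \<open>kap\<close>.\<close>

lemma cF_constants: "cF * cF * complex_of_real (1 / sqrt pi) = complex_of_real (1 / 2 * pi powr (- 3 / 2))"
proof -
  have "pi powr (- 3 / 2) = pi powr (- 1) * pi powr (- 1 / 2)" using powr_add[of pi "- 1" "- 1 / 2"] by simp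
  also have "\<dots> = (1 / pi) * (1 / sqrt pi)"
    by (simp add: powr_minus_divide powr_half_sqrt)
  finally have "1 / 2 * pi powr (- 3 / 2) = 1 / (2 * pi) * (1 / sqrt pi)" by simp
  then show ?thesis unfolding cF_sq by simp
qed

text \<open>Up to sqrt pi the algebraic factor under the integral is \<open>J1\<close>, and the
  logarithms combine to \<open>logw u * lam s\<close>. So one exponential is an inverse Fourier
  kernel in the spectral variable, the other a Fourier kernel on the line.\<close>

lemma q_plus_eq:
  assumes s: "0 < s" "s < 1"
  shows "q_plus s x = complex_of_real (1 / (s * sqrt (1 - s))) *
    (cF * cF * (LINT u|lborel. exp (- \<i> * complex_of_real (x * u)) * (J1 u * exp (\<i> * complex_of_real (logw u * lam s)))))"
proof -
  have eq: "indicator {-1<..<1} u *\<^sub>R (exp (- \<i> * complex_of_real (x * u)) * complex_of_real ((1 - u\<^sup>2) powr (- 1 / 2)) *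
      exp (\<i> / complex_of_real (2 * pi) * complex_of_real (ln (1 / s - 1) * ln ((1 - u) / (1 + u)))))
    = complex_of_real (sqrt pi) * (exp (- \<i> * complex_of_real (x * u)) * (J1 u * exp (\<i> * complex_of_real (logw u * lam s))))" for u
  proof (cases "\<bar>u\<bar> < 1")
    case True
    then have u: "-1 < u" "u < 1" by auto
    have u2: "u\<^sup>2 < 1" using True by (simp add: abs_square_less_1)
    have "0 < (1 - u) / (1 + u)" using u by simp
    then have l: "logw u = ln ((1 - u) / (1 + u)) / (2 * pi)" by (simp only: logw_def abs_of_pos)
    have "kap u = sqrt pi * sqrt (1 - u\<^sup>2)" using u2 by (simp add: kap_def real_sqrt_mult)
    then have "J1 u = complex_of_real (1 / (sqrt pi * sqrt (1 - u\<^sup>2)))" using True by (simp add: J1_def)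
    moreover have "(1 - u\<^sup>2) powr (- 1 / 2) = 1 / sqrt (1 - u\<^sup>2)"
      using u2 by (simp add: powr_minus_divide powr_half_sqrt)
    moreover have "\<i> / complex_of_real (2 * pi) * complex_of_real (ln (1 / s - 1) * ln ((1 - u) / (1 + u))) = \<i> * complex_of_real (logw u * lam s)"
      by (simp add: l lam_def)
    ultimately show ?thesis using u by (simp add: indicator_def)
  next
    case False
    then have "u \<notin> {-1<..<1}" by auto
    then show ?thesis using False by (simp add: J1_def)
  qed
  have p: "(1 - s) powr (- 1 / 2) = 1 / sqrt (1 - s)"
    using s by (simp add: powr_minus_divide powr_half_sqrt)
  show ?thesis
    unfolding q_plus_def set_lebesgue_integral_def eq integral_mult_right_zero p
    using cF_constants[symmetric] s by (simp add: divide_simps)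
qed

text \<open>Write h = s h' and apply \<open>cut_Gp\<close> to h': the function of h differs from one
  supported on [-1, 1] only by a \<open>Gm\<close> term, whose transform vanishes on the positive
  half-line. The support of h away from 0 and 1 makes all integrals absolutely convergent, and
  Fubini's theorem collects the kernel.\<close>

lemma V_kernel:
  assumes h: "h \<in> L2_fun lborel" and supp: "\<And>s. s \<notin> {a..b} \<Longrightarrow> h s = 0" and ab: "0 < a" "b < 1"
  shows "mlt (indicator half_line) (FT (Gp (Asig (cls h))))
      = mlt (indicator half_line) (cls (\<lambda>x. LINT s|lborel. q_plus s x * h s))"
    and "(\<lambda>x. LINT s|lborel. q_plus s x * h s) \<in> L2_fun lborel"
proof -
  have [measurable]: "h \<in> borel_measurable borel" using L2_fun_measurable[OF h] by simp
  have "integrable lborel (\<lambda>s. indicator {a..b} s * h s)"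
    by (rule L2_fun_integrable_mult[OF indicator_Icc_L2 h])
  moreover have "(\<lambda>s. indicator {a..b} s * h s) = h" using supp by (auto simp: indicator_def fun_eq_iff)
  ultimately have h1: "integrable lborel h" by simp
  \<comment> \<open>\<open>g\<close> is the density that appears when the integral of the spectral
    function \<open>p\<close> over l is rewritten over s; it carries the factor 1 / (s sqrt (1 - s))
    of \<open>q_plus\<close>.\<close>
  define g where "g s = h s / complex_of_real (s * sqrt (1 - s))" for s
  define h' where "h' s = h s / complex_of_real s" for s
  have [measurable]: "g \<in> borel_measurable borel" "h' \<in> borel_measurable borel"
    unfolding g_def[abs_def] h'_def[abs_def] by measurable
  have g1: "integrable lborel g"
  proof (rule Bochner_Integration.integrable_bound)
    show "integrable lborel (\<lambda>s. (1 / (a * sqrt (1 - b))) *\<^sub>R h s)" using h1 by (rule integrable_scaleR_right)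
    have "norm (g s) \<le> norm ((1 / (a * sqrt (1 - b))) *\<^sub>R h s)" for s
    proof (cases "s \<in> {a..b}")
      case True
      then have s: "a * sqrt (1 - b) \<le> s * sqrt (1 - s)" using ab by (intro mult_mono) auto
      have "0 < a * sqrt (1 - b)" using ab by simp
      moreover from this s have "0 < s * sqrt (1 - s)" by linarith
      ultimately have "cmod (h s) / (s * sqrt (1 - s)) \<le> cmod (h s) / (a * sqrt (1 - b))"
        using s by (intro divide_left_mono mult_pos_pos[of "s * sqrt (1 - s)"]) auto
      moreover have "norm (g s) = cmod (h s) / (s * sqrt (1 - s))"
        using True ab by (simp add: g_def norm_divide norm_mult)
      ultimately show ?thesis using ab by simp
    qed (simp add: g_def supp)
    then show "AE s in lborel. norm (g s) \<le> norm ((1 / (a * sqrt (1 - b))) *\<^sub>R h s)" by simp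
  qed simp
  have h': "h' \<in> L2_fun lborel"
  proof (rule L2_fun_bound[OF h])
    have "cmod (h' s) \<le> 1 / a * cmod (h s)" for s
    proof (cases "s \<in> {a..b}")
      case True
      then have "cmod (h s) / s \<le> cmod (h s) / a" using ab by (intro divide_left_mono) auto
      then show ?thesis using True ab by (simp add: h'_def norm_divide)
    qed (simp add: h'_def supp)
    then show "AE s in lborel. cmod (h' s) \<le> 1 / a * cmod (h s)" by simp
  qed simp
  define p where "p l = ss l * (Jsig l * h' (sig l))" for l
  have p_eq: "p l = (Jsig l * cnj (Jsig l)) * g (sig l)" for l
  proof -
    define s where "s = sig l"
    have s: "0 < s" "s < 1" using sig_bounds by (auto simp: s_def)
    have "sqrt s * sqrt (s * (1 - s)) / s = sqrt (1 - s)"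
      using s by (simp add: real_sqrt_mult mult.assoc[symmetric])
    moreover have "sqrt (s * (1 - s)) * sqrt (s * (1 - s)) / (s * sqrt (1 - s)) = sqrt (1 - s)"
      using s by (simp add: real_div_sqrt)
    ultimately have "complex_of_real (sqrt s * sqrt (s * (1 - s)) / s) * h s
        = complex_of_real (sqrt (s * (1 - s)) * sqrt (s * (1 - s)) / (s * sqrt (1 - s))) * h s"
      by (simp only:)
    then show ?thesis
      unfolding p_def ss_def Jsig_def h'_def g_def s_def[symmetric] complex_cnj_complex_of_real
        of_real_mult of_real_divide
      by (simp only: times_divide_eq_left times_divide_eq_right mult.assoc)
  qed
  have p2: "p \<in> L2_fun lborel"
    unfolding p_def[abs_def] by (intro L2_fun_mlt ss_cc_bdd weighted_comp_L2(1)[OF wcomp_sig h'])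
  then have [measurable]: "p \<in> borel_measurable borel" using L2_fun_measurable[OF p2] by simp
  have p1: "integrable lborel p"
  proof -
    have "(\<integral>\<^sup>+l. ennreal (cmod (p l)) \<partial>lborel) = (\<integral>\<^sup>+l. ennreal ((cmod (Jsig l))\<^sup>2) * ennreal (cmod (g (sig l))) \<partial>lborel)"
      by (intro nn_integral_cong) (simp add: p_eq norm_mult power2_eq_square ennreal_mult mult.assoc)
    also have "\<dots> = (\<integral>\<^sup>+s. indicator {0<..<1} s * ennreal (cmod (g s)) \<partial>lborel)"
      by (rule weighted_comp_nn_integral[OF wcomp_sig, of "\<lambda>s. ennreal (cmod (g s))"]) measurable
    also have "\<dots> \<le> (\<integral>\<^sup>+s. ennreal (cmod (g s)) \<partial>lborel)"
      by (intro nn_integral_mono) (auto simp: indicator_def)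
    also have "\<dots> < \<infinity>" using g1 by (simp add: integrable_iff_bounded)
    finally show ?thesis by (simp add: integrable_iff_bounded)
  qed
  define G where "G w = (LINT s|lborel. exp (\<i> * complex_of_real (w * lam s)) * g s)" for w
  have Gp: "fhat p (- w) = cF * G w" for w
  proof -
    have "(LINT l|lborel. exp (- \<i> * complex_of_real (- w * l)) * p l)
        = (LINT l|lborel. (Jsig l * cnj (Jsig l)) * (exp (\<i> * complex_of_real (w * lam (sig l))) * g (sig l)))"
      by (simp add: p_eq lam_def ln_sig mult_ac)
    also have "\<dots> = (LINT s|lborel. indicator {0<..<1} s * (exp (\<i> * complex_of_real (w * lam s)) * g s))"
      by (rule weighted_comp_integral[OF wcomp_sig, of "\<lambda>s. exp (\<i> * complex_of_real (w * lam s)) * g s"]) measurable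
    also have "\<dots> = G w"
      unfolding G_def
    proof (rule Bochner_Integration.integral_cong[OF refl])
      fix s
      show "indicator {0<..<1} s * (exp (\<i> * complex_of_real (w * lam s)) * g s) = exp (\<i> * complex_of_real (w * lam s)) * g s"
        using supp[of s] ab by (cases "s \<in> {a..b}") (auto simp: g_def)
    qed
    finally show ?thesis by (simp add: fhat_def cF_def)
  qed
  have [measurable]: "(\<lambda>w. fhat p (- w)) \<in> borel_measurable borel"
    by (rule measurable_compose[OF _ fhat_measurable[OF p1]]) measurable
  have pw: "(\<lambda>w. fhat p (- w)) \<in> L2_fun lborel"
    using FTi_cls[OF p2 p1] FT_cls(2)[OF p2 p1] L2_fun_refl by blast
  \<comment> \<open>The part on [-1, 1] of the function belonging to h'. It is integrable, so its
    transform is given by the integral formula.\<close>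
  define e where "e u = J1 u * fhat p (- logw u)" for u
  have e2: "e \<in> L2_fun lborel"
    unfolding e_def[abs_def] by (rule weighted_comp_L2(1)[OF wcomp_J1 pw])
  have J1m [measurable]: "J1 \<in> borel_measurable borel" "logw \<in> borel_measurable borel"
    using log_measurable by auto
  have e1: "integrable lborel e"
  proof (rule Bochner_Integration.integrable_bound)
    show "integrable lborel (\<lambda>u. J1 u * complex_of_real (cmod cF * (LINT y|lborel. cmod (p y))))"
      by (intro integrable_mult_left integrable_J1)
    have "norm (e u) \<le> norm (J1 u * complex_of_real (cmod cF * (LINT y|lborel. cmod (p y))))" for u
      unfolding e_def norm_mult norm_of_real
      by (intro mult_left_mono order_trans[OF fhat_bound[OF p1] abs_ge_self]) auto
    then show "AE u in lborel. norm (e u) \<le> norm (J1 u * complex_of_real (cmod cF * (LINT y|lborel. cmod (p y))))" by simp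
    show "e \<in> borel_measurable lborel" using L2_fun_measurable[OF e2] .
  qed
  have fe: "fhat e x = (LINT s|lborel. q_plus s x * h s)" for x
  proof -
    let ?k = "\<lambda>u s. exp (- \<i> * complex_of_real (x * u)) * (J1 u * exp (\<i> * complex_of_real (logw u * lam s))) * g s"
    have int: "integrable (lborel \<Otimes>\<^sub>M lborel) (\<lambda>(u, s). ?k u s)"
    proof (rule lborel_pair.Fubini_integrable)
      show "(\<lambda>(u, s). ?k u s) \<in> borel_measurable (lborel \<Otimes>\<^sub>M lborel)" by measurable
      have "integrable lborel (\<lambda>u. cmod (J1 u) * (LINT s|lborel. cmod (g s)))"
        using integrable_J1 by simp
      then show "integrable lborel (\<lambda>u. LINT s|lborel. norm (case (u, s) of (u, s) \<Rightarrow> ?k u s))"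
        by (simp add: norm_mult del: of_real_mult)
      have "integrable lborel (\<lambda>s. ?k u s)" for u
        by (rule Bochner_Integration.integrable_bound[OF integrable_mult_right[OF g1, of "J1 u"]])
           (auto simp: norm_mult simp del: of_real_mult)
      then show "AE u in lborel. integrable lborel (\<lambda>s. case (u, s) of (u, s) \<Rightarrow> ?k u s)" by simp
    qed
    have "exp (- \<i> * complex_of_real (x * u)) * e u = cF * (LINT s|lborel. ?k u s)" for u
    proof -
      have "(LINT s|lborel. ?k u s) = (LINT s|lborel. (exp (- \<i> * complex_of_real (x * u)) * J1 u) * (exp (\<i> * complex_of_real (logw u * lam s)) * g s))"
        by (simp only: mult.assoc)
      also have "\<dots> = (exp (- \<i> * complex_of_real (x * u)) * J1 u) * G (logw u)"
        unfolding G_def by (rule integral_mult_right_zero)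
      finally show ?thesis by (simp add: e_def Gp)
    qed
    then have "fhat e x = cF * cF * (LINT u|lborel. LINT s|lborel. ?k u s)"
      unfolding fhat_def cF_def[symmetric] by (simp only: integral_mult_right_zero mult.assoc)
    also have "(LINT u|lborel. LINT s|lborel. ?k u s) = (LINT s|lborel. LINT u|lborel. ?k u s)"
      using lborel_pair.Fubini_integral[OF int] by simp
    also have "cF * cF * \<dots> = (LINT s|lborel. cF * cF * (LINT u|lborel. ?k u s))"
      by (rule integral_mult_right_zero[symmetric])
    also have "\<dots> = (LINT s|lborel. q_plus s x * h s)"
    proof (rule Bochner_Integration.integral_cong[OF refl])
      fix s
      have "cF * cF * (LINT u|lborel. ?k u s) = cF * cF * (LINT u|lborel. exp (- \<i> * complex_of_real (x * u)) * (J1 u * exp (\<i> * complex_of_real (logw u * lam s)))) * g s"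
        unfolding mult.assoc[of "cF * cF"] by (subst integral_mult_left_zero) (rule refl)
      also have "\<dots> = q_plus s x * h s"
      proof (cases "s \<in> {a..b}")
        case True
        then have "0 < s" "s < 1" using ab by auto
        then show ?thesis by (simp add: q_plus_eq g_def)
      qed (simp add: g_def supp)
      finally show "cF * cF * (LINT u|lborel. ?k u s) = q_plus s x * h s" .
    qed
    finally show ?thesis .
  qed
  have "Asig (cls h) = mlt sg (Asig (cls h'))"
  proof -
    have "(\<lambda>l. Jsig l * h (sig l)) = (\<lambda>l. sg l * (Jsig l * h' (sig l)))"
      using sig_bounds(1) by (auto simp: sg_def h'_def less_imp_neq[symmetric])
    then show ?thesis
      unfolding wc_cls[OF wcomp_sig h] wc_cls[OF wcomp_sig h'] mlt_cls[OF weighted_comp_L2(1)[OF wcomp_sig h']]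
      by (rule arg_cong)
  qed
  moreover have "cls e = wc J1 logw (FTi (mlt ss (Asig (cls h'))))"
  proof -
    have "mlt ss (Asig (cls h')) = cls p"
      by (simp add: wc_cls[OF wcomp_sig] h' mlt_cls weighted_comp_L2(1)[OF wcomp_sig h'] p_def[abs_def])
    then show ?thesis
      by (simp add: FTi_cls p2 p1 wc_cls[OF wcomp_J1 pw] e_def[abs_def])
  qed
  ultimately have "mlt (indicator half_line) (FT (cls e)) = mlt (indicator half_line) (FT (Gp (Asig (cls h))))"
    by (simp add: cut_Gp bclin_add[OF FT(1)] bclin_add[OF bclin_mlt] Gm_hardy)
  then show "mlt (indicator half_line) (FT (Gp (Asig (cls h))))
      = mlt (indicator half_line) (cls (\<lambda>x. LINT s|lborel. q_plus s x * h s))"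
    by (simp add: FT_cls(1)[OF e2 e1] fe[abs_def])
  show "(\<lambda>x. LINT s|lborel. q_plus s x * h s) \<in> L2_fun lborel"
    using FT_cls(2)[OF e2 e1] by (simp add: fe[abs_def])
qed

lemma L2_tendsto_emb:
  assumes M: "model M J \<phi>" and F: "\<forall>\<^sub>F i in net. F i \<in> L2 M"
  shows "L2_tendsto M F G net \<longleftrightarrow> G \<in> L2 M \<and> ((\<lambda>i. emb J \<phi> (F i)) \<longlongrightarrow> emb J \<phi> G) net"
proof -
  have "((\<lambda>i. L2_norm M (L2_diff M (F i) G)) \<longlongrightarrow> 0) net \<longleftrightarrow> ((\<lambda>i. emb J \<phi> (F i)) \<longlongrightarrow> emb J \<phi> G) net"
    if G: "G \<in> L2 M"
  proof -
    have "((\<lambda>i. L2_norm M (L2_diff M (F i) G)) \<longlongrightarrow> 0) net \<longleftrightarrow> ((\<lambda>i. dist (emb J \<phi> (F i)) (emb J \<phi> G)) \<longlongrightarrow> 0) net"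
      by (rule tendsto_cong) (use F in eventually_elim, simp add: L2_norm_diff[OF M _ G] dist_norm)
    then show ?thesis by (simp only: tendsto_dist_iff[of _ "emb J \<phi> G"])
  qed
  then show ?thesis using F unfolding L2_tendsto_def by blast
qed

lemma mlt_hardy: "x \<in> hardy \<Longrightarrow> mlt (indicator half_line) (FT x) = FT x"
  using mlt_pos_neg[of "FT x"] by (simp add: hardy_def)

lemma embR_class: 
  assumes "f \<in> L2_fun lborel"
  shows "embR (L2_class Rplus f) = mlt (indicator half_line) (cls f)" "L2_class Rplus f \<in> L2 Rplus"
  by (rule emb_restrict[OF _ _ assms]; simp) (intro L2_class_in L2_fun_restrict assms; simp)

definition cutoff :: "real \<times> real \<Rightarrow> real \<Rightarrow> complex" where
  "cutoff = (\<lambda>(a, a'). indicator {a..1 - a'})"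

lemma bdd_cutoff [simp]: "bdd_meas (cutoff i)"
  by (auto simp: cutoff_def split: prod.split)

lemma norm_mlt_cutoff: "norm (mlt (cutoff i) x) \<le> norm x"
  using norm_mlt_le[of "cutoff i" 1 x] by (auto simp: cutoff_def indicator_def split: prod.splits)

lemma eventually_cutoff:
  assumes "0 < d"
  shows "\<forall>\<^sub>F i in at_right 0 \<times>\<^sub>F at_right 0. 0 < fst i \<and> fst i < (d :: real) \<and> 0 < snd i \<and> snd i < (d :: real)"
proof -
  have "\<forall>\<^sub>F x in at_right 0. 0 < x \<and> x < d" using eventually_at_right_real[OF assms] by simp
  then show ?thesis unfolding eventually_prod_filter by fastforce
qed

text \<open>Dominated convergence is available along sequences, so it is applied on the diagonal a =
  a' = d n. For smaller parameters the cutoff contains the diagonal one, and the error is at most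
  twice the diagonal error.\<close>

lemma mlt_cutoff_tendsto:
  assumes k: "mlt (indicator {0<..<1}) k = k"
  shows "((\<lambda>i. mlt (cutoff i) k) \<longlongrightarrow> k) (at_right 0 \<times>\<^sub>F at_right 0)"
proof (rule tendstoI)
  fix e :: real assume e: "0 < e"
  define d where "d n = 1 / real (Suc n)" for n
  have d: "0 < d n" for n by (simp add: d_def)
  have dlim: "d \<longlonglongrightarrow> 0" unfolding d_def using LIMSEQ_inverse_real_of_nat by (simp add: inverse_eq_divide)
  have "(\<lambda>n. cls (\<lambda>t. cutoff (d n, d n) t * rep k t)) \<longlonglongrightarrow> cls (\<lambda>t. indicator {0<..<1} t * rep k t)"
  proof (rule l2_dominated_convergence(1)[OF rep_L2[of k]])
    show "AE t in lborel. (\<lambda>n. cutoff (d n, d n) t * rep k t) \<longlonglongrightarrow> indicator {0<..<1} t * rep k t"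
    proof (rule AE_I2)
      fix t :: real
      have "\<forall>\<^sub>F n in sequentially. cutoff (d n, d n) t * rep k t = indicator {0<..<1} t * rep k t"
      proof (cases "t \<in> {0<..<1}")
        case True
        then have "\<forall>\<^sub>F n in sequentially. d n < min t (1 - t)"
          by (intro order_tendstoD[OF dlim]) auto
        then show ?thesis by eventually_elim (use True in \<open>auto simp: cutoff_def indicator_def\<close>)
      next
        case False
        have "cutoff (d n, d n) t = 0" for n
          using False d[of n] by (auto simp: cutoff_def indicator_def)
        then show ?thesis using False by simp
      qed
      then show "(\<lambda>n. cutoff (d n, d n) t * rep k t) \<longlonglongrightarrow> indicator {0<..<1} t * rep k t"
        by (rule tendsto_eventually)
    qed
    show "(\<lambda>t. cutoff (d n, d n) t * rep k t) \<in> borel_measurable borel" for n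
      using L2_fun_measurable[OF L2_fun_mlt[OF bdd_cutoff[of "(d n, d n)"] rep_L2[of k]]] by simp
  qed (auto simp: cutoff_def indicator_def)
  then have "(\<lambda>n. mlt (cutoff (d n, d n)) k) \<longlonglongrightarrow> k" using k by (simp add: mlt_def)
  from tendstoD[OF this, of "e / 2"] e obtain n where n: "dist (mlt (cutoff (d n, d n)) k) k < e / 2"
    using eventually_sequentially by force
  show "\<forall>\<^sub>F i in at_right 0 \<times>\<^sub>F at_right 0. dist (mlt (cutoff i) k) k < e"
    using eventually_cutoff[OF d[of n]]
  proof eventually_elim
    case (elim i)
    let ?y = "mlt (cutoff (d n, d n)) k"
    have "mlt (cutoff i) ?y = mlt (\<lambda>t. cutoff i t * cutoff (d n, d n) t) k"
      by (rule mlt_mlt) auto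
    also have "(\<lambda>t. cutoff i t * cutoff (d n, d n) t) = cutoff (d n, d n)"
      using elim by (auto simp: cutoff_def indicator_def split: prod.splits)
    finally have "mlt (cutoff i) k - k = mlt (cutoff i) (k - ?y) + (?y - k)"
      by (simp add: bclin_diff[OF bclin_mlt])
    then have "norm (mlt (cutoff i) k - k) \<le> norm (mlt (cutoff i) (k - ?y)) + norm (?y - k)"
      by (metis norm_triangle_ineq)
    also have "\<dots> \<le> norm (?y - k) + norm (?y - k)"
      using norm_mlt_cutoff[of i "k - ?y"] by (simp add: norm_minus_commute)
    also have "\<dots> < e" using n by (simp add: dist_norm)
    finally show ?case by (simp add: dist_norm)
  qed
qed

text \<open>\<open>V_kernel\<close> identifies the truncated integrals with the contraction
  \<open>FT o Gp o Asig\<close> applied to cutoffs of \<open>embI H\<close>. The limit therefore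
  exists by continuity, and it is the only one because \<open>embR\<close> is injective.\<close>

lemma V_op_eq:
  assumes H: "H \<in> L2 unit_interval"
  shows "V_op H \<in> L2 Rplus" "embR (V_op H) = FT (Gp (Asig (embI H)))"
proof -
  define k where "k = embI H"
  have k: "mlt (indicator {0<..<1}) k = k"
    unfolding k_def by (rule mlt_emb_restrict) (use H in auto)
  define U where "U x = FT (Gp (Asig x))" for x
  have U_diff: "U x - U y = U (x - y)" for x y
    by (simp add: U_def bclin_diff[OF FT(1)] bclin_diff[OF bclin_Gp] bclin_diff[OF bclin_wc[OF wcomp_sig]])
  have U_norm: "norm (U x) \<le> norm x" for x
    using norm_mlt_le[of "indicator {0<..<1}" 1 x]
    by (simp add: U_def FT(2) Gp_isometry norm_wc[OF wcomp_sig] indicator_def)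
  have U_mlt: "mlt (indicator half_line) (U x) = U x" for x
    unfolding U_def by (rule mlt_hardy[OF Gp_hardy])
  let ?F = "\<lambda>i :: real \<times> real. case i of (a, a') \<Rightarrow> L2_class Rplus (\<lambda>x. LINT s:{a..1 - a'}|lborel. q_plus s x * L2_rep H s)"
  let ?net = "at_right (0 :: real) \<times>\<^sub>F at_right (0 :: real)"
  have F: "?F i \<in> L2 Rplus \<and> embR (?F i) = U (mlt (cutoff i) k)" if i: "0 < fst i \<and> fst i < 1 \<and> 0 < snd i \<and> snd i < 1" for i
  proof -
    obtain a a' where aa: "i = (a, a')" "0 < a" "0 < a'" using i by (cases i) auto
    define \<phi> where "\<phi> s = (if s \<in> {0<..<1} then s else 1 / 2 :: real)" for s
    \<comment> \<open>The representative of \<open>H\<close> is extended by zero from (0, 1) to the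
      line and then cut off; on the interval of integration it agrees with the integrand of
      \<open>V_op\<close>.\<close>
    define h where "h s = cutoff i s * (indicator {0<..<1} s * L2_rep H (\<phi> s))" for s
    have e: "(\<lambda>s. indicator {0<..<1} s * L2_rep H (\<phi> s)) \<in> L2_fun lborel"
      unfolding \<phi>_def by (rule weighted_comp_L2(1)[OF model_I L2_rep_in[OF H]])
    have h: "h \<in> L2_fun lborel" unfolding h_def[abs_def] by (rule L2_fun_mlt[OF bdd_cutoff e])
    have hk: "cls h = mlt (cutoff i) k"
      unfolding k_def emb_def h_def[abs_def] mlt_cls[OF e, unfolded \<phi>_def] \<phi>_def ..
    have supp: "h s = 0" if "s \<notin> {a..1 - a'}" for s using that by (simp add: h_def cutoff_def aa)
    have "(LINT s:{a..1 - a'}|lborel. q_plus s x * L2_rep H s) = (LINT s|lborel. q_plus s x * h s)" for x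
      unfolding set_lebesgue_integral_def using aa
      by (intro Bochner_Integration.integral_cong) (auto simp: h_def cutoff_def \<phi>_def indicator_def)
    then have "?F i = L2_class Rplus (\<lambda>x. LINT s|lborel. q_plus s x * h s)" by (simp add: aa)
    moreover have "1 - a' < 1" using aa by simp
    note V = V_kernel[OF h supp \<open>0 < a\<close> this]
    ultimately show ?thesis
      using embR_class[OF V(2)] V(1) U_mlt[of "mlt (cutoff i) k"] by (simp add: hk U_def)
  qed
  have ev: "\<forall>\<^sub>F i in ?net. ?F i \<in> L2 Rplus \<and> embR (?F i) = U (mlt (cutoff i) k)"
    by (rule eventually_mono[OF eventually_cutoff[OF zero_less_one]]) (rule F)
  then have evL2: "\<forall>\<^sub>F i in ?net. ?F i \<in> L2 Rplus" by (rule eventually_mono) simp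
  have lim: "((\<lambda>i. embR (?F i)) \<longlongrightarrow> U k) ?net"
  proof -
    have "((\<lambda>i. U (mlt (cutoff i) k)) \<longlongrightarrow> U k) ?net"
    proof (rule metric_tendsto_imp_tendsto[OF mlt_cutoff_tendsto[OF k]])
      show "\<forall>\<^sub>F i in ?net. dist (U (mlt (cutoff i) k)) (U k) \<le> dist (mlt (cutoff i) k) k"
        by (simp add: dist_norm U_diff U_norm)
    qed
    then show ?thesis
      by (rule Lim_transform_eventually) (use ev in \<open>rule eventually_mono\<close>, simp)
  qed
  define G where "G = L2_class Rplus (rep (U k))"
  have G: "G \<in> L2 Rplus" "embR G = U k"
    using embR_class[OF rep_L2[of "U k"]] by (simp_all add: G_def U_mlt)
  have "V_op H = G"
    unfolding V_op_def
  proof (rule the_equality)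
    show "L2_tendsto Rplus ?F G ?net"
      unfolding L2_tendsto_emb[OF model_R evL2] using G lim by simp
  next
    fix G' assume "L2_tendsto Rplus ?F G' ?net"
    then have G': "G' \<in> L2 Rplus" "((\<lambda>i. embR (?F i)) \<longlongrightarrow> embR G') ?net"
      unfolding L2_tendsto_emb[OF model_R evL2] by auto
    have "embR G' = embR G"
      unfolding G(2) by (rule tendsto_unique[OF _ G'(2) lim]) (simp add: prod_filter_eq_bot)
    then show "G' = G" by (rule emb_inj[OF model_R G'(1) G(1)])
  qed
  then show "V_op H \<in> L2 Rplus" "embR (V_op H) = FT (Gp (Asig (embI H)))"
    using G by (simp_all add: U_def k_def)
qed

section \<open>Transport to the circle and the Toeplitz operator of the arc\<close>

section \<open>Diagonalisation\<close>

context circle_arc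
begin

lemma proj_eq: "x \<in> hardy \<Longrightarrow> proj x = x"
  by (simp add: proj_def mlt_hardy FTi_FT)

text \<open>\<open>P_plus_star\<close> and \<open>fourier_inv\<close> undo \<open>embR\<close> and
  \<open>FT\<close>, which leaves \<open>X_op\<close> of a member of \<open>hardy\<close>. This
  already lies in \<open>H2\<close>, so \<open>Q_plus\<close> fixes it.\<close>

lemma Y_op_eq:
  assumes H: "H \<in> L2 unit_interval"
  shows "Y_op \<alpha> \<beta> H \<in> H2" "embc (Y_op \<alpha> \<beta> H) = Gp (Asig (embI H))"
proof -
  define x where "x = Gp (Asig (embI H))"
  have x: "x \<in> hardy" by (simp add: x_def Gp_hardy)
  then have X: "X_op \<alpha> \<beta> (set_of x) \<in> H2" by (simp add: H2_iff X_op_in embc_X_op)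
  have "P_plus_star (V_op H) = set_of (FT x)"
    unfolding P_plus_star_eq[OF V_op_eq(1)[OF H]] V_op_eq(2)[OF H] x_def ..
  then have "Y_op \<alpha> \<beta> H = Q_plus (X_op \<alpha> \<beta> (set_of x))"
    by (simp add: Y_op_def X_plus_def fourier_inv_set_of FTi_FT)
  also have "\<dots> = X_op \<alpha> \<beta> (set_of x)"
    by (rule Q_plus_eq) (simp_all add: X X_op_in embc_X_op proj_eq x)
  finally show "Y_op \<alpha> \<beta> H \<in> H2" "embc (Y_op \<alpha> \<beta> H) = Gp (Asig (embI H))"
    using X by (simp_all add: embc_X_op x_def)
qed

text \<open>\<open>Gp\<close> preserves the inner product everywhere and \<open>Asig\<close> does so
  on functions supported in (0, 1). Preimages come from \<open>Gp_surj\<close> and from the inverse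
  substitution \<open>lam\<close> in \<open>Asig_surj\<close>.\<close>

lemma Y_op_isomorphism: "hilbert_isomorphism unit_interval (L2 unit_interval) circle_measure H2 (Y_op \<alpha> \<beta>)"
proof (rule hilbert_isomorphismI[OF model_I model_circle, where T = "\<lambda>x. Gp (Asig x)"])
  show "bclin (\<lambda>x. Gp (Asig x))" by (rule bclin_compose[OF bclin_Gp bclin_wc[OF wcomp_sig]])
  show "ip (Gp (Asig (embI F))) (Gp (Asig (embI G))) = ip (embI F) (embI G)"
    if FG: "F \<in> L2 unit_interval" "G \<in> L2 unit_interval" for F G
  proof -
    have "mlt (indicator {0<..<1}) (embI F) = embI F" by (rule mlt_emb_restrict) (use FG in auto)
    then show ?thesis by (simp add: bclin_isometry_ip[OF bclin_Gp Gp_isometry] ip_wc[OF wcomp_sig])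
  qed
  show "H2 \<subseteq> L2 circle_measure" by (auto simp: H2_iff)
  fix G assume G: "G \<in> H2"
  then obtain y where y: "embc G = Gp y" using Gp_surj[of "embc G"] by (auto simp: H2_iff)
  define F where "F = L2_class unit_interval (rep (wc Jlam lam y))"
  have F: "F \<in> L2 unit_interval" unfolding F_def by (intro L2_class_in L2_fun_restrict) auto
  have "embI F = mlt (indicator {0<..<1}) (cls (rep (wc Jlam lam y)))"
    unfolding F_def by (rule emb_restrict) auto
  then have "embc (Y_op \<alpha> \<beta> F) = embc G" by (simp add: Y_op_eq[OF F] Asig_surj y)
  then have "Y_op \<alpha> \<beta> F = G"
    using Y_op_eq(1)[OF F] G by (intro emb_inj[OF model_circle]) (auto simp: H2_iff)
  then show "\<exists>F\<in>L2 unit_interval. Y_op \<alpha> \<beta> F = G" using F by blast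
qed (use Y_op_eq in auto)

text \<open>The substitution s = sig l turns multiplication by s into multiplication by
  \<open>sg\<close>. On (0, 1) the factor is at most 1, which keeps the product square
  integrable.\<close>

lemma Asig_embI_mult:
  assumes H: "H \<in> L2 unit_interval"
  shows "mult_op unit_interval complex_of_real H \<in> L2 unit_interval"
    "Asig (embI (mult_op unit_interval complex_of_real H)) = mlt sg (Asig (embI H))"
proof -
  define \<phi> where "\<phi> s = (if s \<in> {0<..<1} then s else 1 / 2 :: real)" for s
  have f: "(\<lambda>s. complex_of_real s * L2_rep H s) \<in> L2_fun unit_interval"
  proof (rule L2_fun_bound[OF L2_rep_in[OF H], where C = 1])
    show "(\<lambda>s. complex_of_real s * L2_rep H s) \<in> borel_measurable unit_interval"
      by (rule borel_measurable_times[OF measurable_restrict_space1 L2_fun_measurable[OF L2_rep_in[OF H]]]) simp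
    show "AE s in unit_interval. cmod (complex_of_real s * L2_rep H s) \<le> 1 * cmod (L2_rep H s)"
      by (rule AE_I2) (auto simp: norm_mult space_restrict_space intro!: mult_left_le_one_le)
  qed
  then show "mult_op unit_interval complex_of_real H \<in> L2 unit_interval"
    unfolding mult_op_def by (rule L2_class_in)
  have e: "(\<lambda>s. indicator {0<..<1} s * f (\<phi> s)) \<in> L2_fun lborel" if "f \<in> L2_fun unit_interval" for f
    unfolding \<phi>_def by (rule weighted_comp_L2(1)[OF model_I that])
  note eH = e[OF L2_rep_in[OF H]]
  have "embI (mult_op unit_interval complex_of_real H)
      = cls (\<lambda>s. indicator {0<..<1} s * (complex_of_real (\<phi> s) * L2_rep H (\<phi> s)))"
    unfolding mult_op_def \<phi>_def by (rule emb_class[OF model_I f])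
  then have "Asig (embI (mult_op unit_interval complex_of_real H))
      = cls (\<lambda>l. Jsig l * (indicator {0<..<1} (sig l) * (complex_of_real (\<phi> (sig l)) * L2_rep H (\<phi> (sig l)))))"
    by (simp only: wc_cls[OF wcomp_sig e[OF f]])
  also have "(\<lambda>l. Jsig l * (indicator {0<..<1} (sig l) * (complex_of_real (\<phi> (sig l)) * L2_rep H (\<phi> (sig l)))))
      = (\<lambda>l. sg l * (Jsig l * (indicator {0<..<1} (sig l) * L2_rep H (\<phi> (sig l)))))"
    using sig_bounds by (auto simp: \<phi>_def sg_def)
  also have "cls \<dots> = mlt sg (Asig (embI H))"
    unfolding emb_def \<phi>_def[symmetric] wc_cls[OF wcomp_sig eH] mlt_cls[OF weighted_comp_L2(1)[OF wcomp_sig eH]] ..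
  finally show "Asig (embI (mult_op unit_interval complex_of_real H)) = mlt sg (Asig (embI H))" .
qed

text \<open>Since arctan (1 / t) = pi/2 - \<beta>/2, the angle \<open>psi\<close> takes the value
  \<beta> at x = -1 and 2 pi - \<beta> at x = 1. The scaling of \<open>chi\<close> by tan
  (\<beta>/2) is made for this.\<close>

lemma chi_mem_arc: "chi \<alpha> \<beta> x \<in> {cis \<phi> |\<phi>. \<alpha> + \<beta> \<le> \<phi> \<and> \<phi> \<le> \<alpha> + 2 * pi - \<beta>} \<longleftrightarrow> x \<in> {-1..1}"
proof -
  have chi: "chi \<alpha> \<beta> x = cis (\<alpha> + psi x)" by (simp add: chi_zet zet_psi cis_mult)
  have "chi \<alpha> \<beta> x \<in> {cis \<phi> |\<phi>. \<alpha> + \<beta> \<le> \<phi> \<and> \<phi> \<le> \<alpha> + 2 * pi - \<beta>} \<longleftrightarrow> \<beta> \<le> psi x \<and> psi x \<le> 2 * pi - \<beta>"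
  proof
    assume "\<beta> \<le> psi x \<and> psi x \<le> 2 * pi - \<beta>"
    then show "chi \<alpha> \<beta> x \<in> {cis \<phi> |\<phi>. \<alpha> + \<beta> \<le> \<phi> \<and> \<phi> \<le> \<alpha> + 2 * pi - \<beta>}"
      unfolding chi by (intro CollectI exI[of _ "\<alpha> + psi x"]) auto
  next
    assume "chi \<alpha> \<beta> x \<in> {cis \<phi> |\<phi>. \<alpha> + \<beta> \<le> \<phi> \<and> \<phi> \<le> \<alpha> + 2 * pi - \<beta>}"
    then obtain \<phi> where \<phi>: "cis (\<alpha> + psi x) = cis \<phi>" "\<alpha> + \<beta> \<le> \<phi>" "\<phi> \<le> \<alpha> + 2 * pi - \<beta>"
      unfolding chi by blast
    have "cis (psi x) = cis (\<phi> - \<alpha>)"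
    proof -
      have "cis (- \<alpha>) * cis (\<alpha> + psi x) = cis (- \<alpha>) * cis \<phi>" using \<phi>(1) by simp
      then show ?thesis by (simp add: cis_mult)
    qed
    \<comment> \<open>Both angles lie between 0 and 2 pi, the latter excluded, where an argument is
      unique.\<close>
    then have "psi x = \<phi> - \<alpha>"
      using Arg2pi_unique[of 1 "psi x" "cis (psi x)"] Arg2pi_unique[of 1 "\<phi> - \<alpha>" "cis (psi x)"] psi_bounds[of x] \<phi>(2,3) \<beta>
      by (simp add: cis_conv_exp)
    then show "\<beta> \<le> psi x \<and> psi x \<le> 2 * pi - \<beta>" using \<phi>(2,3) by simp
  qed
  also have "\<dots> \<longleftrightarrow> arctan (- 1 / t) \<le> arctan (x / t) \<and> arctan (x / t) \<le> arctan (1 / t)"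
  proof -
    have "1 / t = tan (pi / 2 - \<beta> / 2)" by (simp add: t_def tan_cot' cot_altdef inverse_eq_divide)
    then have "arctan (1 / t) = pi / 2 - \<beta> / 2" using \<beta> by (simp add: arctan_tan)
    then show ?thesis by (auto simp: psi_def arctan_minus)
  qed
  also have "\<dots> \<longleftrightarrow> x \<in> {-1..1}"
    unfolding arctan_le_iff using t_pos by (auto simp: field_simps)
  finally show ?thesis .
qed

lemma embc_indicator_arc:
  assumes A: "A = {cis \<phi> |\<phi>. \<alpha> + \<beta> \<le> \<phi> \<and> \<phi> \<le> \<alpha> + 2 * pi - \<beta>}" and F: "F \<in> L2 circle_measure"
  shows "mult_op circle_measure (indicator A) F \<in> L2 circle_measure"
    "embc (mult_op circle_measure (indicator A) F) = mlt (indicator {-1..1}) (embc F)"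
proof -
  have "A = cis ` {\<alpha> + \<beta>..\<alpha> + 2 * pi - \<beta>}" unfolding A by auto
  then have "compact A" by (auto intro!: compact_continuous_image continuous_intros)
  then have [measurable]: "A \<in> sets borel" by (intro borel_closed compact_imp_closed)
  have f: "(\<lambda>z. indicator A z * L2_rep F z) \<in> L2_fun circle_measure"
  proof (rule L2_fun_bound[OF L2_rep_in[OF F], where C = 1])
    show "(\<lambda>z. indicator A z * L2_rep F z) \<in> borel_measurable circle_measure"
      by (rule borel_measurable_times[OF measurable_from_circle L2_fun_measurable[OF L2_rep_in[OF F]]]) simp
  qed (auto simp: indicator_def)
  then show "mult_op circle_measure (indicator A) F \<in> L2 circle_measure"
    unfolding mult_op_def by (rule L2_class_in)
  have "indicator A (chi \<alpha> \<beta> x) = (indicator {-1..1} x :: complex)" for x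
    using chi_mem_arc[of x] by (simp add: A indicator_def)
  then show "embc (mult_op circle_measure (indicator A) F) = mlt (indicator {-1..1}) (embc F)"
    unfolding mult_op_def emb_class[OF model_circle f]
    unfolding emb_def mlt_cls[OF weighted_comp_L2(1)[OF model_circle L2_rep_in[OF F]]]
    by (simp add: mult.left_commute)
qed

text \<open>\<open>mlt_cut_Gp\<close> and \<open>cut_Gp\<close> write the cut function as a
  \<open>Gp\<close> term and a \<open>Gm\<close> term; \<open>proj\<close> keeps the first and kills
  the second, and the first is the image of the multiplied class.\<close>

lemma toeplitz_arc:
  assumes A: "A = {cis \<phi> |\<phi>. \<alpha> + \<beta> \<le> \<phi> \<and> \<phi> \<le> \<alpha> + 2 * pi - \<beta>}" and H: "H \<in> L2 unit_interval"
  shows "toeplitz (indicator A) (Y_op \<alpha> \<beta> H) = Y_op \<alpha> \<beta> (mult_op unit_interval complex_of_real H)"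
  unfolding toeplitz_def
proof (rule Q_plus_eq)
  have YL: "Y_op \<alpha> \<beta> H \<in> L2 circle_measure" using Y_op_eq(1)[OF H] by (simp add: H2_iff)
  show "mult_op circle_measure (indicator A) (Y_op \<alpha> \<beta> H) \<in> L2 circle_measure"
    by (rule embc_indicator_arc(1)[OF A YL])
  show "Y_op \<alpha> \<beta> (mult_op unit_interval complex_of_real H) \<in> H2"
    by (rule Y_op_eq(1)[OF Asig_embI_mult(1)[OF H]])
  have "proj (Gp y + Gm z) = Gp y" for y z
  proof -
    have "proj (Gp y + Gm z) = FTi (mlt (indicator half_line) (FT (Gp y)))"
      by (simp add: proj_def bclin_add[OF FT(1)] bclin_add[OF bclin_mlt] Gm_hardy)
    then show ?thesis by (simp add: mlt_hardy Gp_hardy FTi_FT)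
  qed
  then show "embc (Y_op \<alpha> \<beta> (mult_op unit_interval complex_of_real H)) = proj (embc (mult_op circle_measure (indicator A) (Y_op \<alpha> \<beta> H)))"
    unfolding embc_indicator_arc(2)[OF A YL] Y_op_eq(2)[OF H] Y_op_eq(2)[OF Asig_embI_mult(1)[OF H]]
      Asig_embI_mult(2)[OF H] mlt_cut_Gp cut_Gp by simp
qed

end

theorem mainTheorem6:
  fixes \<alpha> \<beta> :: real and A :: "complex set"
  assumes "0 \<le> \<alpha>" and "\<alpha> < 2 * pi"
    and "0 < \<beta>" and "\<beta> < pi"
    and "A = {cis \<phi> |\<phi>. \<alpha> + \<beta> \<le> \<phi> \<and> \<phi> \<le> \<alpha> + 2 * pi - \<beta>}"
  shows "hilbert_isomorphism unit_interval (L2 unit_interval) circle_measure H2 (Y_op \<alpha> \<beta>) \<and>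
    (\<forall>F\<in>H2. toeplitz (indicator A) F =
      Y_op \<alpha> \<beta> (mult_op unit_interval complex_of_real (inv_into (L2 unit_interval) (Y_op \<alpha> \<beta>) F)))"
proof (intro conjI ballI)
  interpret circle_arc \<alpha> \<beta> "tan (\<beta> / 2)" by unfold_locales (use assms in auto)
  show iso: "hilbert_isomorphism unit_interval (L2 unit_interval) circle_measure H2 (Y_op \<alpha> \<beta>)"
    by (rule Y_op_isomorphism)
  fix F assume F: "F \<in> H2"
  define H where "H = inv_into (L2 unit_interval) (Y_op \<alpha> \<beta>) F"
  have img: "Y_op \<alpha> \<beta> ` L2 unit_interval = H2"
    using iso by (simp add: hilbert_isomorphism_def bij_betw_def)
  have "H \<in> L2 unit_interval" "Y_op \<alpha> \<beta> H = F"
    using F unfolding H_def img[symmetric] by (rule inv_into_into, rule f_inv_into_f)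
  then show "toeplitz (indicator A) F = Y_op \<alpha> \<beta> (mult_op unit_interval complex_of_real H)"
    using toeplitz_arc[OF assms(5)] by metis
qed

end
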